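(* For every integer $k\ge 0$, the minimum number of crossings of a closed meander in the stratum $\mathcal{Q}(k,-1^{k+4})$ is $4k+4$.
   Context: A closed meander is a planar configuration consisting of a bi-infinite horizontal line together with a simple closed curve intersecting the line transversally (in at least one point); the crossings are the intersection points. Adding the point at infinity, the line becomes a simple closed curve, so the configuration is a pair of transverse simple closed curves on the sphere. Stratum of a closed meander. View the configuration as a 4-valent graph on the sphere whose vertices are the crossings. Each complementary region (face) is a polygon with an even number of sides, and a $(2k+4)$-gon is assigned order $k$: bigons have order $-1$ (poles), 4-gons order $0$, hexagons order $1$, and so on. The meander lies in $\mathcal{Q}(k_1,\dots,k_n,-1^{p})$ (where $-1^p$ means $-1$ repeated $p$ times) if the multiset of orders of its faces is $\{k_1,\dots,k_n,-1,\dots,-1\}$ ($p$ copies of $-1$), where additional faces of order $0$ (4-gons) beyond those listed are ignored; an order $0$ appearing in the list must be realised by a 4-gon. *)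

theory Defs
  imports "HOL-Analysis.Analysis" "HOL-Library.Multiset"
begin

text \<open>
  The plane is \<^typ>\<open>complex\<close> and the horizontal line is the real axis \<open>\<real>\<close>.
  A closed meander is identified with the point set of its closed curve.
\<close>

text \<open>
  The parametrization is 1-periodic on the whole line, so that the curve is also
  continuously differentiable and regular at its base point.
\<close>

definition closed_meander :: "complex set \<Rightarrow> bool" where
  "closed_meander C \<longleftrightarrow>
     (\<exists>\<gamma> :: real \<Rightarrow> complex.
        (\<forall>t. \<gamma> (t + 1) = \<gamma> t) \<and>
        simple_path \<gamma> \<and>
        \<gamma> C1_differentiable_on UNIV \<and>
        (\<forall>t. vector_derivative \<gamma> (at t) \<noteq> 0) \<and>
        (\<forall>t. \<gamma> t \<in> \<real> \<longrightarrow> vector_derivative \<gamma> (at t) \<notin> \<real>) \<and>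
        C = path_image \<gamma>) \<and>
     C \<inter> \<real> \<noteq> {}"

definition crossings :: "complex set \<Rightarrow> complex set" where
  "crossings C = C \<inter> \<real>"

text \<open>
  On the sphere the two rays of the line beyond its extreme crossings form a single edge
  through the point at infinity; in the plane they are the two unbounded components below.
\<close>

definition meander_edges :: "complex set \<Rightarrow> complex set set" where
  "meander_edges C =
     (let S = components ((\<real> \<union> C) - crossings C)
      in {E \<in> S. bounded E} \<union> {\<Union> {E \<in> S. \<not> bounded E}})"

text \<open>
  The point at infinity lies on the line, so the complementary regions on the sphere are
  the components of the complement in the plane.
\<close>

definition meander_faces :: "complex set \<Rightarrow> complex set set" where
  "meander_faces C = components (- (\<real> \<union> C))"

text \<open>
  Every edge lies on one of two simple closed curves on the sphere, hence has different
  faces on its two sides. So no edge occurs twice on the boundary of the same face, and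
  counting sides as a set of edges loses no multiplicity.
\<close>

definition face_sides :: "complex set \<Rightarrow> complex set \<Rightarrow> complex set set" where
  "face_sides C F = {E \<in> meander_edges C. E \<subseteq> frontier F}"

text \<open>
  A \<open>(2k+4)\<close>-gon has order \<open>k\<close>. The division is exact because the sides of a face lie
  alternately on the line and on the curve.
\<close>

definition face_order :: "complex set \<Rightarrow> complex set \<Rightarrow> int" where
  "face_order C F = (int (card (face_sides C F)) - 4) div 2"

definition face_orders :: "complex set \<Rightarrow> int multiset" where
  "face_orders C = image_mset (face_order C) (mset_set (meander_faces C))"

text \<open>
  \<open>M\<close> is the list of orders naming the stratum. Faces of order 0 beyond those listed in
  \<open>M\<close> are ignored.
\<close>

definition in_stratum :: "complex set \<Rightarrow> int multiset \<Rightarrow> bool" where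
  "in_stratum C M \<longleftrightarrow> (\<exists>j. face_orders C = M + replicate_mset j 0)"

definition is_minimum :: "nat \<Rightarrow> nat set \<Rightarrow> bool" where
  "is_minimum m A \<longleftrightarrow> m \<in> A \<and> (\<forall>n\<in>A. m \<le> n)"

end

theory Submission
  imports Defs
begin

text \<open>
  The line and the curve each cut the sphere into two disks, so every face lies in one of four
  sectors. If there are \<open>2 N\<close> crossings, then each of the four disks is cut by \<open>N\<close> edges into at
  most \<open>N + 1\<close> faces. A face with \<open>2 d\<close> sides has \<open>d\<close> sides on each curve, so the numbers \<open>d\<close>
  add up to \<open>N\<close> in every sector, and the orders \<open>d - 2\<close> of the faces in one disk add up to at
  least -2. A disk without faces of positive order therefore contains at most two bigons. If the
  face of order \<open>k\<close> lies in the sector \<open>S\<close>, this applies to the two disks disjoint from \<open>S\<close>, so at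
  most four of the \<open>k + 4\<close> bigons lie outside \<open>S\<close>. Hence \<open>S\<close> contains at least \<open>k\<close> bigons besides
  the face of order \<open>k\<close>, and \<open>N \<ge> (k + 2) + k\<close>.

  Equality is attained by a curve made of semicircles. Assign to a point of a half-plane the set
  of semicircles that it lies under. There are \<open>N + 1\<close> such sets and at most \<open>N + 1\<close> faces, so
  they distinguish the faces, and the orders can be read off from the nesting of the semicircles.
\<close>

section \<open>Sets lying locally on one side of a point\<close>

text \<open>Faces and edges are given as connected components, so the polygons must be extracted
  from topology. The bridge is local: each crossing, and each point of an edge next to a sector, is
  adherent to exactly one component of that sector, and this component stays the same along the edge
  up to its ends. So every crossing is one corner in each sector, and each corner of a face ends one
  of its arcs and one of its line edges; this makes the two kinds of sides equally many. The bound
  \<open>N + 1\<close> is the vertex bound for a connected graph with the faces of a disk as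
  vertices and the \<open>N\<close> cuts as edges. In the example the faces are not traced: upper
  bounds for their numbers of sides are added up and compared with the exact total. The curve itself
  bounds the strip of half-width 1 around an arc that meets the line successively in -w 0, w 0, -w
  1, w 1, ..., -w k, w k, by lower semicircles about 0 and upper ones of radius 2. Doubling the 2k +
  2 points of this arc gives the 4k + 4 crossings.\<close>

definition onesided :: "'a::topological_space \<Rightarrow> 'a set \<Rightarrow> bool" where
  "onesided z W \<longleftrightarrow> z \<in> closure W \<and> (\<exists>U. open U \<and> z \<in> U \<and> connected (U \<inter> W))"

text \<open>Think of \<open>z\<close> as a boundary point looking into \<open>W\<close>. The
  description is meaningful only where \<open>onesided z W\<close> holds, see
  \<open>facing_unique\<close>.\<close>

definition facing :: "'a::topological_space set \<Rightarrow> 'a \<Rightarrow> 'a set" where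
  "facing W z = (THE F. F \<in> components W \<and> z \<in> closure F)"

text \<open>One neighbourhood with connected trace on \<open>W\<close> suffices: the trace is
  nonempty, hence inside a single component, and all other components are disjoint from it.\<close>

lemma onesided_local:
  assumes "onesided z W"
  obtains U F where "open U" "z \<in> U" "F \<in> components W" "z \<in> closure F" "U \<inter> W \<subseteq> F"
    "\<And>G. G \<in> components W \<Longrightarrow> G \<inter> U \<noteq> {} \<Longrightarrow> G = F"
proof -
  obtain U where U: "open U" "z \<in> U" "connected (U \<inter> W)" and z: "z \<in> closure W"
    using assms by (auto simp: onesided_def)
  have ne: "U \<inter> W \<noteq> {}" using z U by (meson open_Int_closure_eq_empty disjoint_iff)
  then obtain F where F: "F \<in> components W" "U \<inter> W \<subseteq> F"
    using exists_component_superset[of "U \<inter> W" W] U(3) by (metis inf_le2 subset_empty)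
  have "z \<in> closure (U \<inter> W)"
    using z U by (metis IntI open_Int_closure_subset subsetD)
  hence "z \<in> closure F" using F(2) closure_mono by blast
  moreover have "G = F" if "G \<in> components W" "G \<inter> U \<noteq> {}" for G
  proof -
    have "G \<inter> F \<noteq> {}" using that F in_components_subset[OF that(1)] by blast
    thus ?thesis using components_eq[OF that(1) F(1)] by blast
  qed
  ultimately show ?thesis using that U F by blast
qed

lemma facing_unique:
  assumes "onesided z W"
  shows "\<exists>!F. F \<in> components W \<and> z \<in> closure F"
proof -
  obtain U F where *: "open U" "z \<in> U" "F \<in> components W" "z \<in> closure F"
    "\<And>G. G \<in> components W \<Longrightarrow> G \<inter> U \<noteq> {} \<Longrightarrow> G = F"
    using onesided_local[OF assms] by metis
  have "G = F" if "G \<in> components W" "z \<in> closure G" for G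
    using *(5)[OF that(1)] that(2) *(1,2) open_Int_closure_eq_empty[OF *(1), of G] by blast
  thus ?thesis using * by blast
qed

lemma facing_props:
  assumes "onesided z W"
  shows "facing W z \<in> components W" "z \<in> closure (facing W z)"
  using theI'[OF facing_unique[OF assms]] by (auto simp: facing_def)

lemma facing_eqI:
  assumes "onesided z W" "F \<in> components W" "z \<in> closure F"
  shows "facing W z = F"
  using facing_unique[OF assms(1)] facing_props[OF assms(1)] assms(2,3) by blast

lemma facing_local:
  assumes "onesided z W"
  obtains U where "open U" "z \<in> U" "U \<inter> W \<subseteq> facing W z"
    "\<And>G. G \<in> components W \<Longrightarrow> G \<inter> U \<noteq> {} \<Longrightarrow> G = facing W z"
proof -
  obtain U F where *: "open U" "z \<in> U" "F \<in> components W" "z \<in> closure F" "U \<inter> W \<subseteq> F"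
    "\<And>G. G \<in> components W \<Longrightarrow> G \<inter> U \<noteq> {} \<Longrightarrow> G = F"
    using onesided_local[OF assms] by metis
  have "facing W z = F" using facing_eqI[OF assms *(3,4)] .
  thus ?thesis using that * by blast
qed

text \<open>Near \<open>a\<close> only the component \<open>facing W a\<close> is visible, so
  \<open>facing W\<close> is locally constant along \<open>E\<close>. This lets a whole edge be
  assigned to one face.\<close>

lemma facing_const:
  assumes E: "connected E" "\<And>z. z \<in> E \<Longrightarrow> onesided z W" and "x \<in> E" "y \<in> E"
  shows "facing W x = facing W y"
proof -
  have "\<exists>c. \<forall>z\<in>E. facing W z = c"
  proof (rule locally_constant_imp_constant[OF E(1), unfolded constant_on_def])
    fix a assume a: "a \<in> E"
    obtain U where U: "open U" "a \<in> U"
      "\<And>G. G \<in> components W \<Longrightarrow> G \<inter> U \<noteq> {} \<Longrightarrow> G = facing W a"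
      using facing_local[OF E(2)[OF a]] by metis
    have eq: "facing W x = facing W a" if "x \<in> E \<inter> U" for x
    proof (rule U(3))
      have os: "onesided x W" using that E(2) by blast
      show "facing W x \<in> components W" using facing_props(1)[OF os] .
      have "x \<in> closure (facing W x)" using facing_props(2)[OF os] .
      thus "facing W x \<inter> U \<noteq> {}" using that U(1)
        by (metis Int_iff closure_iff_nhds_not_empty inf.commute subset_refl)
    qed
    thus "\<exists>T. openin (top_of_set E) T \<and> a \<in> T \<and> (\<forall>x\<in>T. facing W x = facing W a)"
      using U(1,2) a eq by (intro exI[of _ "E \<inter> U"] conjI ballI openin_open_Int) blast+
  qed
  then obtain c where "\<forall>z\<in>E. facing W z = c" by blast
  thus ?thesis using assms(3,4) by simp
qed

text \<open>Connectivity is stated without paths: a nonempty vertex set that no edge leaves is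
  everything. Grow a subgraph from one vertex; each edge leaving it adds exactly one new vertex.
  Finiteness of \<open>V\<close> comes out of the same argument.\<close>

lemma card_le_of_connected_graph:
  fixes a b :: "'e \<Rightarrow> 'v"
  assumes "finite E" "V \<noteq> {}"
    and conn: "\<And>G. G \<subseteq> V \<Longrightarrow> G \<noteq> {} \<Longrightarrow> (\<And>e. e \<in> E \<Longrightarrow> a e \<in> G \<longleftrightarrow> b e \<in> G) \<Longrightarrow> G = V"
    and ends: "\<And>e. e \<in> E \<Longrightarrow> a e \<in> V \<and> b e \<in> V"
  shows "finite V \<and> card V \<le> card E + 1"
proof -
  have *: "finite V \<and> card V \<le> card E + 1"
    if "E' \<subseteq> E" "G \<subseteq> V" "G \<noteq> {}" "finite G" "card G \<le> card E' + 1"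
      "\<And>e. e \<in> E' \<Longrightarrow> a e \<in> G \<and> b e \<in> G" for E' G
    using that
  proof (induction "card (E - E')" arbitrary: E' G rule: less_induct)
    case less
    show ?case
    proof (cases "G = V")
      case True
      have "card E' \<le> card E" using less.prems(1) assms(1) card_mono by blast
      thus ?thesis using True less.prems by auto
    next
      case False
      \<comment> \<open>Since \<open>G\<close> is not all of \<open>V\<close>, it cannot be closed
        under the edges, so some edge has exactly one end in it.\<close>
      then obtain e where e: "e \<in> E" "(a e \<in> G) \<noteq> (b e \<in> G)"
        using conn[OF less.prems(2,3)] by blast
      define G' where "G' = insert (a e) (insert (b e) G)"
      have e': "e \<notin> E'" using less.prems(6) e by blast
      have fE': "finite E'" using less.prems(1) assms(1) finite_subset by blast
      have cG': "card G' = card G + 1"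
        using e(2) less.prems(4) by (cases "a e \<in> G") (auto simp: G'_def insert_absorb)
      show ?thesis
      proof (rule less.hyps[of "insert e E'" G'])
        show "card (E - insert e E') < card (E - E')"
          using e e' assms(1) by (intro psubset_card_mono) auto
        show "card G' \<le> card (insert e E') + 1" using cG' e' fE' less.prems(5) by simp
        show "a x \<in> G' \<and> b x \<in> G'" if "x \<in> insert e E'" for x
          using that less.prems(6) by (auto simp: G'_def)
      qed (use e less.prems ends in \<open>auto simp: G'_def\<close>)
    qed
  qed
  obtain v where "v \<in> V" using assms(2) by blast
  thus ?thesis using *[of "{}" "{v}"] by auto
qed

text \<open>The graph has the components as vertices, and each cut joins the faces on its two sides.
  It is connected because \<open>V\<close> is: the closure in \<open>V\<close> of a union of faces
  that no cut leaves is also open.\<close>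

lemma card_faces_le:
  fixes V W1 W2 :: "complex set"
  assumes V: "connected V" "open V" "W1 \<union> W2 \<noteq> {}"
    and W: "open W1" "open W2" "W1 \<inter> W2 = {}" "W1 \<subseteq> V" "W2 \<subseteq> V"
    and Z: "V - W1 - W2 = \<Union>\<E>" "finite \<E>" "{} \<notin> \<E>"
    and os: "\<And>z. z \<in> V - W1 - W2 \<Longrightarrow> onesided z W1 \<and> onesided z W2"
    and const: "\<And>E x y i. E \<in> \<E> \<Longrightarrow> x \<in> E \<Longrightarrow> y \<in> E \<Longrightarrow>
                  facing W1 x = facing W1 y \<and> facing W2 x = facing W2 y"
  shows "finite (components W1 \<union> components W2) \<and>
         card (components W1 \<union> components W2) \<le> card \<E> + 1"
proof -
  define pt where "pt E = (SOME z. z \<in> E)" for E :: "complex set"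
  have pt: "pt E \<in> E" if "E \<in> \<E>" for E
    using Z(3) that by (metis ex_in_conv pt_def someI_ex)
  have ptV: "pt E \<in> V - W1 - W2" if "E \<in> \<E>" for E
    using pt[OF that] that Z(1) by blast
  have op: "open F" if "F \<in> components W1 \<union> components W2" for F
    using that W(1,2) open_components by (metis UnE)
  show ?thesis
  proof (rule card_le_of_connected_graph[of _ _ "\<lambda>E. facing W1 (pt E)" "\<lambda>E. facing W2 (pt E)"])
    show "finite \<E>" by fact
    show "components W1 \<union> components W2 \<noteq> {}" using V(3) by auto
    show "facing W1 (pt e) \<in> components W1 \<union> components W2 \<and>
          facing W2 (pt e) \<in> components W1 \<union> components W2" if "e \<in> \<E>" for e
      using facing_props os[OF ptV[OF that]] by auto
    fix G assume G: "G \<subseteq> components W1 \<union> components W2" "G \<noteq> {}"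
      and cl: "\<And>e. e \<in> \<E> \<Longrightarrow> (facing W1 (pt e) \<in> G) = (facing W2 (pt e) \<in> G)"
    have disj: "F \<inter> F' = {}" if "F \<in> components W1 \<union> components W2" "F' \<in> components W1 \<union> components W2" "F \<noteq> F'" for F F'
    proof (rule ccontr)
      assume "F \<inter> F' \<noteq> {}"
      then obtain p where p: "p \<in> F" "p \<in> F'" by blast
      have "(F \<in> components W1 \<and> F' \<in> components W1) \<or> (F \<in> components W2 \<and> F' \<in> components W2)"
        using that(1,2) p W(3) in_components_subset by (metis Un_iff disjoint_iff subsetD)
      thus False using p that(3) components_eq by (metis disjoint_iff)
    qed
    define T where "T = V \<inter> closure (\<Union>G)"
    have GT: "\<Union>G \<subseteq> T"
    proof -
      have "F \<subseteq> V" if "F \<in> G" for F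
        using subsetD[OF G(1) that] W(4,5) in_components_subset[of F W1] in_components_subset[of F W2]
        by auto
      thus ?thesis using closure_subset[of "\<Union>G"] unfolding T_def by auto
    qed
    have "T \<noteq> {}"
    proof -
      obtain F where "F \<in> G" using G(2) by blast
      moreover from this have "F \<noteq> {}" using G(1) in_components_nonempty by blast
      ultimately show ?thesis using GT by blast
    qed
    have Top: "open T"
    proof (subst open_subopen, intro ballI)
      fix z assume z: "z \<in> T"
      hence zV: "z \<in> V" "z \<in> closure (\<Union>G)" by (auto simp: T_def)
      show "\<exists>S. open S \<and> z \<in> S \<and> S \<subseteq> T"
      proof (cases "z \<in> W1 \<union> W2")
        case True
        then obtain F where F: "F \<in> components W1 \<union> components W2" "z \<in> F"
          by (metis Un_iff UnionE Union_components)
        have "F \<inter> \<Union>G \<noteq> {}"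
          using zV(2) F(2) open_Int_closure_eq_empty[OF op[OF F(1)], of "\<Union>G"] by auto
        then obtain F' where F': "F' \<in> G" "F \<inter> F' \<noteq> {}" by auto
        hence "F \<in> G" using disj[OF F(1) subsetD[OF G(1) F'(1)]] by auto
        hence "F \<subseteq> T" using GT by blast
        thus ?thesis using F op by blast
      next
        case False
        hence zZ: "z \<in> V - W1 - W2" using zV by auto
        \<comment> \<open>At a point of a cut only two faces are visible nearby. One of them belongs
          to \<open>G\<close>, and then so does the other, because \<open>G\<close> is closed under
          the graph edges.\<close>
        then obtain E where E: "E \<in> \<E>" "z \<in> E" using Z(1) by blast
        have eq: "facing W1 z = facing W1 (pt E)" "facing W2 z = facing W2 (pt E)"
          using const[OF E(1) E(2) pt[OF E(1)]] by auto
        obtain U1 where U1: "open U1" "z \<in> U1" "U1 \<inter> W1 \<subseteq> facing W1 z"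
          "\<And>G. G \<in> components W1 \<Longrightarrow> G \<inter> U1 \<noteq> {} \<Longrightarrow> G = facing W1 z"
          using facing_local os[OF zZ] by metis
        obtain U2 where U2: "open U2" "z \<in> U2" "U2 \<inter> W2 \<subseteq> facing W2 z"
          "\<And>G. G \<in> components W2 \<Longrightarrow> G \<inter> U2 \<noteq> {} \<Longrightarrow> G = facing W2 z"
          using facing_local os[OF zZ] by metis
        define U where "U = V \<inter> U1 \<inter> U2"
        have U: "open U" "z \<in> U" using U1 U2 V(2) zV by (auto simp: U_def)
        have "U \<inter> \<Union>G \<noteq> {}"
          using zV(2) U(2) open_Int_closure_eq_empty[OF U(1), of "\<Union>G"] by auto
        then obtain F where F: "F \<in> G" "F \<inter> U \<noteq> {}" by blast
        have "F = facing W1 z \<or> F = facing W2 z"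
          using F G(1) U1(4)[of F] U2(4)[of F] by (auto simp: U_def)
        hence both: "facing W1 z \<in> G" "facing W2 z \<in> G" using F cl[OF E(1)] eq by auto
        have "u \<in> T" if u: "u \<in> U" for u
        proof (cases "u \<in> W1 \<union> W2")
          case True
          hence "u \<in> facing W1 z \<union> facing W2 z" using U1(3) U2(3) u by (auto simp: U_def)
          thus ?thesis using both GT by blast
        next
          case False
          \<comment> \<open>Nearby points of the cuts are reached as limits of the face in
            \<open>W1\<close>, which lies in \<open>G\<close>.\<close>
          hence "u \<in> closure W1" using os[of u] u by (auto simp: U_def onesided_def)
          hence "u \<in> closure (U \<inter> W1)" using u U(1)
            by (metis IntI open_Int_closure_subset subsetD)
          moreover have "U \<inter> W1 \<subseteq> \<Union>G" using U1(3) both by (auto simp: U_def)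
          ultimately have "u \<in> closure (\<Union>G)" using closure_mono by blast
          thus ?thesis using u by (auto simp: T_def U_def)
        qed
        thus ?thesis using U by blast
      qed
    qed
    have "openin (top_of_set V) T" using Top V(2) by (auto simp: T_def openin_open_eq)
    moreover have "closedin (top_of_set V) T" by (auto simp: T_def closedin_closed)
    ultimately have TV: "T = V" using V(1) \<open>T \<noteq> {}\<close> connected_clopen by blast
    show "G = components W1 \<union> components W2"
    proof (rule ccontr)
      assume "G \<noteq> components W1 \<union> components W2"
      then obtain F where F: "F \<in> components W1 \<union> components W2" "F \<notin> G" using G by blast
      have "F \<inter> F' = {}" if "F' \<in> G" for F'
        using disj[OF F(1) subsetD[OF G(1) that]] that F(2) by auto
      hence "F \<inter> \<Union>G = {}" by auto
      hence "F \<inter> closure (\<Union>G) = {}" using op[OF F(1)] open_Int_closure_eq_empty by blast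
      moreover have "F \<subseteq> V"
        using F(1) W(4,5) in_components_subset[of F W1] in_components_subset[of F W2] by auto
      moreover have "F \<noteq> {}" using F(1) in_components_nonempty by blast
      ultimately show False using TV by (auto simp: T_def)
    qed
  qed
qed

section \<open>Local structure of a meander\<close>

locale meander =
  fixes \<gamma> :: "real \<Rightarrow> complex" and C :: "complex set"
  assumes per: "\<gamma> (t + 1) = \<gamma> t"
    and simple: "simple_path \<gamma>"
    and C1: "\<gamma> C1_differentiable_on UNIV"
    and reg: "vector_derivative \<gamma> (at t) \<noteq> 0"
    and trans: "\<gamma> t \<in> \<real> \<Longrightarrow> vector_derivative \<gamma> (at t) \<notin> \<real>"
    and C_eq: "C = path_image \<gamma>"
    and meets: "C \<inter> \<real> \<noteq> {}"

lemma closed_meander_iff: "closed_meander C \<longleftrightarrow> (\<exists>\<gamma>. meander \<gamma> C)"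
  unfolding closed_meander_def meander_def by blast

text \<open>Boolean indices for half-planes and regions let a negation name the opposite side, so
  that statements about sectors cover all four at once.\<close>

definition half :: "bool \<Rightarrow> complex set" where
  "half X = (if X then {z. Im z > 0} else {z. Im z < 0})"

definition region :: "complex set \<Rightarrow> bool \<Rightarrow> complex set" where
  "region C Y = (if Y then inside C else outside C)"

lemma open_half: "open (half X)"
  by (auto simp: half_def open_halfspace_Im_gt open_halfspace_Im_lt)

lemma convex_half: "convex (half X)"
  by (auto simp: half_def convex_halfspace_Im_gt convex_halfspace_Im_lt)

lemma half_disjoint: "half X \<inter> half (\<not> X) = {}"
  by (auto simp: half_def)

lemma half_not_Reals: "half X \<inter> \<real> = {}"
  by (auto simp: half_def complex_is_Real_iff)

context meander
begin

abbreviation "\<gamma>' t \<equiv> vector_derivative \<gamma> (at t)"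

lemma deriv: "(\<gamma> has_vector_derivative \<gamma>' t) (at t within S)"
  using C1 vector_derivative_works[of \<gamma> "at t"]
  by (simp add: C1_differentiable_on_eq has_vector_derivative_at_within)

lemma cont_deriv: "continuous_on S \<gamma>'"
  using C1 continuous_on_subset[of UNIV \<gamma>' S] by (simp add: C1_differentiable_on_eq)

lemma cont: "continuous_on S \<gamma>"
  unfolding continuous_on_eq_continuous_within
  using has_vector_derivative_continuous[OF deriv] by simp

lemma per_nat: "\<gamma> (t + of_nat n) = \<gamma> t"
proof (induction n)
  case (Suc n)
  have "\<gamma> (t + of_nat (Suc n)) = \<gamma> ((t + of_nat n) + 1)" by (simp add: add_ac)
  thus ?case using Suc per by simp
qed simp

lemma per_int: "\<gamma> (t + of_int n) = \<gamma> t"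
proof (cases "n \<ge> 0")
  case True thus ?thesis using per_nat[of t "nat n"] by simp
next
  case False thus ?thesis using per_nat[of "t + of_int n" "nat (- n)"] by simp
qed

lemma per_frac: "\<gamma> (frac t) = \<gamma> t"
  using per_int[of "frac t" "\<lfloor>t\<rfloor>"] by (simp add: frac_def)

text \<open>Both parameters are moved into the period [0, 1), where the path is injective.\<close>

lemma inj: assumes "\<gamma> x = \<gamma> y" shows "x - y \<in> \<int>"
proof -
  have "frac x = frac y"
  proof -
    have "frac x \<in> {0..1}" "frac y \<in> {0..1}" "frac x < 1" "frac y < 1"
      by (simp_all add: frac_lt_1 less_imp_le)
    moreover have "\<gamma> (frac x) = \<gamma> (frac y)" using assms per_frac by simp
    ultimately show ?thesis using simple unfolding simple_path_def loop_free_def by fastforce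
  qed
  hence "x - y = of_int (\<lfloor>x\<rfloor> - \<lfloor>y\<rfloor>)" by (simp add: frac_def)
  thus ?thesis by (metis Ints_of_int)
qed

lemma inj_near: assumes "\<gamma> x = \<gamma> y" "\<bar>x - y\<bar> < 1" shows "x = y"
proof -
  obtain n where n: "x - y = of_int n" using inj[OF assms(1)] Ints_cases by blast
  hence "real_of_int \<bar>n\<bar> < 1" using assms(2) by simp
  hence "n = 0" by linarith
  thus ?thesis using n by simp
qed

lemma C_range: "C = range \<gamma>"
proof -
  have "\<gamma> t \<in> C" for t
    using per_frac[of t] frac_lt_1[of t] frac_ge_0[of t] C_eq unfolding path_image_def
    by (metis atLeastAtMost_iff imageI less_imp_le)
  thus ?thesis using C_eq by (auto simp: path_image_def)
qed

lemma C_window: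
  assumes "z \<in> C" obtains t where "a \<le> t" "t < a + 1" "\<gamma> t = z"
proof -
  obtain s where s: "z = \<gamma> s" using assms C_range by auto
  have "\<gamma> (a + frac (s - a)) = \<gamma> s"
    using per_int[of "a + frac (s - a)" "\<lfloor>s - a\<rfloor>"] by (simp add: frac_def)
  thus ?thesis using that[of "a + frac (s - a)"] s by (simp add: frac_lt_1)
qed

lemma closed_path: "pathfinish \<gamma> = pathstart \<gamma>"
  using per[of 0] by (simp add: pathfinish_def pathstart_def)

lemma compact_C: "compact C"
  using C_eq simple by (simp add: compact_simple_path_image)

lemma jordan:
  shows "open (region C Y)" "connected (region C Y)" "frontier (region C Y) = C"
    "region C Y \<inter> region C (\<not> Y) = {}" "region C True \<union> region C False = - C"
    "bounded (region C True)" "region C Y \<inter> C = {}" "C \<subseteq> closure (region C Y)"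
proof -
  have J: "frontier (inside C) = C" "frontier (outside C) = C" "open (inside C)" "open (outside C)"
    "connected (inside C)" "connected (outside C)" "bounded (inside C)"
    "inside C \<inter> outside C = {}" "inside C \<union> outside C = - C"
    using Jordan_inside_outside[OF simple closed_path] C_eq by auto
  show "open (region C Y)" "connected (region C Y)" "frontier (region C Y) = C"
    "bounded (region C True)" "region C True \<union> region C False = - C"
    using J by (auto simp: region_def)
  show "region C Y \<inter> region C (\<not> Y) = {}" using J(8) by (cases Y) (simp_all add: region_def Int_commute)
  show "region C Y \<inter> C = {}" using J(9) by (auto simp: region_def)
  show "C \<subseteq> closure (region C Y)" using J by (auto simp: region_def frontier_def)
qed

section \<open>Flow boxes around points of the curve\<close>

definition chart :: "real \<Rightarrow> complex \<Rightarrow> real \<times> real \<Rightarrow> complex" where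
  "chart t0 w p = \<gamma> (t0 + snd p) + of_real (fst p) * w"

definition square :: "real \<Rightarrow> (real \<times> real) set" where
  "square e = {-e<..<e} \<times> {-e<..<e}"

lemma chart_0 [simp]: "chart t0 w (0, 0) = \<gamma> t0"
  by (simp add: chart_def)

lemma cont_chart: "continuous_on S (chart t0 w)"
  unfolding chart_def
  by (intro continuous_intros continuous_on_compose2[OF cont[of UNIV]]) auto

text \<open>Dividing by \<open>w\<close> turns the direction \<open>w\<close> into the real axis, so
  \<open>Im (z / w)\<close> measures the displacement transversal to \<open>w\<close>. Its
  derivative along the curve stays positive near \<open>t0\<close> by continuity.\<close>

lemma increasing_near:
  assumes "Im (\<gamma>' t0 / w) > 0"
  obtains e where "e > 0" "\<And>s t. \<bar>s - t0\<bar> < e \<Longrightarrow> \<bar>t - t0\<bar> < e \<Longrightarrow> s < t \<Longrightarrow>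
    Im (\<gamma> s / w) < Im (\<gamma> t / w)"
proof -
  have w: "w \<noteq> 0" using assms by auto
  have "continuous_on UNIV (\<lambda>t. Im (\<gamma>' t / w))"
    using w by (intro continuous_intros cont_deriv) auto
  hence "open {t. Im (\<gamma>' t / w) > 0}" by (intro open_Collect_less continuous_on_const)
  then obtain e where e: "e > 0" "ball t0 e \<subseteq> {t. Im (\<gamma>' t / w) > 0}"
    using assms open_contains_ball by blast
  have "Im (\<gamma> s / w) < Im (\<gamma> t / w)" if "\<bar>s - t0\<bar> < e" "\<bar>t - t0\<bar> < e" "s < t" for s t
  proof (rule DERIV_pos_imp_increasing[OF that(3)])
    fix x assume x: "s \<le> x" "x \<le> t"
    have "((\<lambda>t. \<gamma> t / w) has_vector_derivative \<gamma>' x / w) (at x)"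
      by (rule has_vector_derivative_divide[OF deriv])
    hence "((\<lambda>t. Im (\<gamma> t / w)) has_vector_derivative Im (\<gamma>' x / w)) (at x)"
      by (rule bounded_linear.has_vector_derivative[OF bounded_linear_Im])
    moreover have "x \<in> ball t0 e" using x that by (auto simp: dist_real_def)
    ultimately show "\<exists>y. ((\<lambda>t. Im (\<gamma> t / w)) has_real_derivative y) (at x) \<and> 0 < y"
      using e(2) by (auto simp: has_real_derivative_iff_has_vector_derivative)
  qed
  thus ?thesis using that e(1) by blast
qed

text \<open>The second coordinate follows the curve, and the first moves away from it in a
  transversal direction \<open>w\<close>. Monotonicity of \<open>Im (z / w)\<close> along the curve
  makes the chart injective, and compactness keeps the rest of the curve away. The sign statement
  identifies the line once \<open>w\<close> is horizontal.\<close>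

lemma chart_exists:
  assumes w: "Im (\<gamma>' t0 / w) > 0" and S: "open S" "\<gamma> t0 \<in> S"
  obtains e where "e > 0" "open (chart t0 w ` square e)" "chart t0 w ` square e \<subseteq> S"
    "\<And>p. p \<in> square e \<Longrightarrow> chart t0 w p \<in> C \<longleftrightarrow> fst p = 0"
    "\<And>p. p \<in> square e \<Longrightarrow> sgn (Im (chart t0 w p / w) - Im (\<gamma> t0 / w)) = sgn (snd p)"
proof -
  have w0: "w \<noteq> 0" using w by auto
  obtain e0 where e0: "e0 > 0" "\<And>s t. \<bar>s - t0\<bar> < e0 \<Longrightarrow> \<bar>t - t0\<bar> < e0 \<Longrightarrow> s < t \<Longrightarrow>
    Im (\<gamma> s / w) < Im (\<gamma> t / w)" using increasing_near[OF w] by blast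
  \<comment> \<open>The bound 1/2 keeps \<open>t0 + 1 - e1\<close> inside the parameter interval
    defining \<open>K\<close>; this is needed for the boundary parameter \<open>t0 - e1\<close>
    below.\<close>
  define e1 where "e1 = min e0 (1/2)"
  have e1: "e1 > 0" "e1 \<le> e0" "e1 \<le> 1/2" using e0(1) by (auto simp: e1_def)
  define K where "K = \<gamma> ` {t0 + e1..t0 + 1 - e1}"
  have "closed K" unfolding K_def
    by (intro compact_imp_closed compact_continuous_image cont) auto
  moreover have "\<gamma> t0 \<notin> K"
  proof
    assume "\<gamma> t0 \<in> K"
    then obtain t where "t0 + e1 \<le> t" "t \<le> t0 + 1 - e1" "\<gamma> t0 = \<gamma> t" by (auto simp: K_def)
    thus False using inj_near[of t0 t] e1 by auto
  qed
  ultimately have "open (chart t0 w -` (S - K))" "(0,0) \<in> chart t0 w -` (S - K)"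
    using S cont_chart[of UNIV] by (auto intro!: open_vimage)
  then obtain A B where AB: "open A" "open B" "0 \<in> A" "0 \<in> B" "A \<times> B \<subseteq> chart t0 w -` (S - K)"
    using open_prod_elim by (metis mem_Sigma_iff)
  obtain a where a: "a > 0" "ball 0 a \<subseteq> A" using AB open_contains_ball by blast
  obtain b where b: "b > 0" "ball 0 b \<subseteq> B" using AB open_contains_ball by blast
  define e where "e = Min {a, b, e1}"
  have e: "e > 0" "e \<le> a" "e \<le> b" "e \<le> e1" using a b e1 by (auto simp: e_def)
  have sq: "p \<in> square e \<longleftrightarrow> \<bar>fst p\<bar> < e \<and> \<bar>snd p\<bar> < e" for p
    by (cases p) (auto simp: square_def)
  have sub: "chart t0 w ` square e \<subseteq> S - K"
  proof -
    have "square e \<subseteq> A \<times> B" using a b e by (fastforce simp: square_def dist_real_def)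
    thus ?thesis using AB(5) by blast
  qed
  have Im_chart: "Im (chart t0 w p / w) = Im (\<gamma> (t0 + snd p) / w)" for p
    using w0 by (simp add: chart_def add_divide_distrib)
  have mono: "Im (\<gamma> (t0 + s) / w) < Im (\<gamma> (t0 + t) / w)" if "\<bar>s\<bar> < e" "\<bar>t\<bar> < e" "s < t" for s t
    using e0(2)[of "t0 + s" "t0 + t"] that e e1 by auto
  have inj: "p = q" if p: "p \<in> square e" "q \<in> square e" "chart t0 w p = chart t0 w q" for p q
  proof -
    have "snd p = snd q"
      using mono[of "snd p" "snd q"] mono[of "snd q" "snd p"] p Im_chart[of p] Im_chart[of q]
      unfolding sq by (metis linorder_neqE_linordered_idom less_irrefl)
    moreover from this have "fst p = fst q" using p(3) w0 by (simp add: chart_def)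
    ultimately show ?thesis by (simp add: prod_eq_iff)
  qed
  show ?thesis
  proof (rule that[OF e(1)])
    \<comment> \<open>Invariance of domain: an injective continuous map between planes is
      open.\<close>
    show "open (chart t0 w ` square e)"
      using inj by (intro invariance_of_domain_gen cont_chart inj_onI)
        (auto simp: square_def open_Times)
    show "chart t0 w ` square e \<subseteq> S" using sub by blast
    fix p assume p: "p \<in> square e"
    show "chart t0 w p \<in> C \<longleftrightarrow> fst p = 0"
    proof
      assume "fst p = 0"
      thus "chart t0 w p \<in> C" by (simp add: chart_def C_range)
    next
      assume "chart t0 w p \<in> C"
      then obtain t where t: "t0 - e1 \<le> t" "t < t0 - e1 + 1" "\<gamma> t = chart t0 w p"
        using C_window[of "chart t0 w p" "t0 - e1"] by blast
      have "\<gamma> t \<notin> K" using t(3) sub p by blast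
      hence t': "t < t0 + e1" using t(2) unfolding K_def by (metis add_diff_eq atLeastAtMost_iff
        imageI less_eq_real_def linorder_not_le diff_add_eq)
      \<comment> \<open>The window of one period is half-open; its left end is excluded because one
        period later it lies in \<open>K\<close>.\<close>
      moreover have "t \<noteq> t0 - e1"
      proof
        assume "t = t0 - e1"
        hence "t + 1 = t0 + 1 - e1" by simp
        hence "\<gamma> t = \<gamma> (t0 + 1 - e1)" using per[of t] by metis
        thus False using \<open>\<gamma> t \<notin> K\<close> e1 unfolding K_def by auto
      qed
      ultimately have tt: "\<bar>t - t0\<bar> < e0" "\<bar>t0 + snd p - t0\<bar> < e0"
        using t(1) e e1 p unfolding sq by auto
      have "Im (\<gamma> t / w) = Im (\<gamma> (t0 + snd p) / w)" using t(3) Im_chart[of p] by simp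
      hence "t = t0 + snd p" using e0(2)[OF tt] e0(2)[OF tt(2,1)] by force
      thus "fst p = 0" using t(3) w0 by (simp add: chart_def)
    qed
    show "sgn (Im (chart t0 w p / w) - Im (\<gamma> t0 / w)) = sgn (snd p)"
      using mono[of 0 "snd p"] mono[of "snd p" 0] p e(1) Im_chart[of p] unfolding sq
      by (cases "snd p" "0::real" rule: linorder_cases) auto
  qed
qed

text \<open>In the chart \<open>W\<close> becomes a product of intervals with the centre in its
  closure. Half-open choices give quadrants and half-squares, and the factor {0} gives germs of the
  curve or of the line.\<close>

lemma onesided_chart:
  assumes "e > 0" "open (chart t0 w ` square e)" "convex I" "convex J"
    "I \<subseteq> {-e<..<e}" "J \<subseteq> {-e<..<e}" "0 \<in> closure I" "0 \<in> closure J"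
    "\<And>p. p \<in> square e \<Longrightarrow> chart t0 w p \<in> W \<longleftrightarrow> p \<in> I \<times> J"
  shows "onesided (\<gamma> t0) W"
proof -
  have eq: "chart t0 w ` square e \<inter> W = chart t0 w ` (I \<times> J)"
    using assms(5,6,9) unfolding square_def by blast
  have "connected (I \<times> J)" using assms(3,4) by (intro convex_connected convex_Times)
  hence "connected (chart t0 w ` square e \<inter> W)"
    unfolding eq using connected_continuous_image cont_chart by blast
  moreover have "\<gamma> t0 \<in> chart t0 w ` square e"
    using assms(1) by (intro image_eqI[of _ _ "(0,0)"]) (auto simp: square_def)
  moreover have "\<gamma> t0 \<in> closure W"
  proof -
    have "chart t0 w ` closure (I \<times> J) \<subseteq> closure (chart t0 w ` (I \<times> J))"
      by (rule image_closure_subset[OF cont_chart]) (auto simp: closure_subset)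
    moreover have "(0,0) \<in> closure (I \<times> J)" using assms(7,8) by (simp add: closure_Times)
    ultimately have "\<gamma> t0 \<in> closure (chart t0 w ` (I \<times> J))" using chart_0 by (metis image_subset_iff)
    thus ?thesis using eq closure_mono by (metis inf_le2 subsetD)
  qed
  ultimately show ?thesis using assms(2) unfolding onesided_def by blast
qed

text \<open>The two halves of a chart square off the curve lie on different sides of the curve,
  since the centre is a boundary point of both sides.\<close>

lemma chart_sides:
  assumes e: "e > 0" "open (chart t0 w ` square e)"
    and C: "\<And>p. p \<in> square e \<Longrightarrow> chart t0 w p \<in> C \<longleftrightarrow> fst p = 0"
  obtains b where "\<And>p Y. p \<in> square e \<Longrightarrow>
    chart t0 w p \<in> region C Y \<longleftrightarrow> (if Y = b then fst p > 0 else fst p < 0)"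
proof -
  define U where "U s = chart t0 w ` {p \<in> square e. if s then fst p > 0 else fst p < 0}" for s
  have conn: "connected (U s)" for s
  proof -
    have "{p \<in> square e. if s then fst p > 0 else fst p < 0} =
       (if s then {0<..<e} else {-e<..<0}) \<times> {-e<..<e}" by (auto simp: square_def)
    moreover have "connected ((if s then {0<..<e} else {-e<..<0}) \<times> {-e<..<e})"
      by (intro connected_Times) auto
    ultimately show ?thesis unfolding U_def using connected_continuous_image cont_chart by metis
  qed
  have UC: "U s \<inter> C = {}" for s using C by (fastforce simp: U_def split: if_splits)
  have "\<exists>Y. U s \<subseteq> region C Y" for s
  proof -
    have "U s \<subseteq> region C True \<union> region C False" using UC[of s] jordan(5) by blast
    thus ?thesis using connectedD[OF conn[of s] jordan(1)[of True] jordan(1)[of False]]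
      jordan(4)[of True] by fastforce
  qed
  then obtain Y where Y: "\<And>s. U s \<subseteq> region C (Y s)" by metis
  have t0: "\<gamma> t0 \<in> chart t0 w ` square e"
    using e(1) by (intro image_eqI[of _ _ "(0,0)"]) (auto simp: square_def)
  have "Y True \<noteq> Y False"
  proof
    assume eq: "Y True = Y False"
    have "chart t0 w ` square e \<inter> region C (\<not> Y True) = {}"
    proof -
      have "chart t0 w p \<notin> region C (\<not> Y True)" if "p \<in> square e" for p
      proof (cases "fst p = 0")
        case True
        thus ?thesis using C[OF that] jordan(7) by blast
      next
        case False
        hence "chart t0 w p \<in> U (fst p > 0)" using that by (auto simp: U_def)
        hence "chart t0 w p \<in> region C (Y True)" using Y[of "fst p > 0"] eq by (cases "fst p > 0") auto
        thus ?thesis using jordan(4) by blast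
      qed
      thus ?thesis by blast
    qed
    hence "chart t0 w ` square e \<inter> closure (region C (\<not> Y True)) = {}"
      using open_Int_closure_eq_empty[OF e(2)] by blast
    thus False using t0 jordan(8) C_range by blast
  qed
  hence "chart t0 w p \<in> region C Y' \<longleftrightarrow> (if Y' = Y True then fst p > 0 else fst p < 0)"
    if p: "p \<in> square e" for p Y'
  proof (cases "fst p = 0")
    case True
    hence "chart t0 w p \<notin> region C Y'" using C[OF p] jordan(7) by blast
    thus ?thesis using True by simp
  next
    case False
    hence "chart t0 w p \<in> U (fst p > 0)" using p by (auto simp: U_def)
    hence "chart t0 w p \<in> region C (Y (fst p > 0))" using Y by blast
    moreover from this have "chart t0 w p \<notin> region C (\<not> Y (fst p > 0))" using jordan(4) by blast
    ultimately show ?thesis using \<open>Y True \<noteq> Y False\<close> False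
      by (cases "fst p > 0"; cases "Y' = Y True"; cases "Y True"; cases "Y False") auto
  qed
  thus ?thesis using that by blast
qed

end

section \<open>Decomposing components along open sets, and the four sectors\<close>

lemma components_maximalI:
  assumes "c \<noteq> {}" "c \<subseteq> S" "connected c"
    and "\<And>d. connected d \<Longrightarrow> d \<subseteq> S \<Longrightarrow> c \<subseteq> d \<Longrightarrow> d \<subseteq> c"
  shows "c \<in> components S"
  unfolding in_components_maximal using assms by (metis subset_antisym)

text \<open>Every connected subset of \<open>S\<close> lies in one of the two pieces.
  \<open>U\<close> and \<open>V\<close> may overlap, provided that they do not do so on
  \<open>S\<close>.\<close>

lemma components_split:
  assumes S: "S = A \<union> B" "A = S \<inter> U" "B = S \<inter> V" "open U" "open V" "A \<inter> B = {}"
  shows "components S = components A \<union> components B"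
proof -
  have piece: "c \<subseteq> A \<or> c \<subseteq> B" if "connected c" "c \<subseteq> S" for c
  proof -
    have "c \<subseteq> U \<union> V" "U \<inter> V \<inter> c = {}" using that S by blast+
    hence "U \<inter> c = {} \<or> V \<inter> c = {}" using connectedD[OF that(1) S(4,5)] by blast
    thus ?thesis using that S by blast
  qed
  have up: "c \<in> components T" if "c \<in> components S" "c \<subseteq> T" "T \<subseteq> S" for c T
  proof (rule components_maximalI)
    show "c \<noteq> {}" "connected c"
      using that(1) in_components_nonempty in_components_connected by auto
    show "d \<subseteq> c" if d: "connected d" "d \<subseteq> T" "c \<subseteq> d" for d
      using components_maximal[OF \<open>c \<in> components S\<close> d(1)] d(2,3) \<open>T \<subseteq> S\<close> \<open>c \<noteq> {}\<close> by blast
  qed fact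
  have down: "c \<in> components S"
    if "c \<in> components T" "T \<subseteq> S" "\<And>d. connected d \<Longrightarrow> d \<subseteq> S \<Longrightarrow> c \<subseteq> d \<Longrightarrow> d \<subseteq> T" for c T
  proof (rule components_maximalI)
    show "c \<noteq> {}" "connected c"
      using that(1) in_components_nonempty in_components_connected by auto
    show "c \<subseteq> S" using that(1,2) in_components_subset by blast
    show "d \<subseteq> c" if d: "connected d" "d \<subseteq> S" "c \<subseteq> d" for d
      using components_maximal[OF \<open>c \<in> components T\<close> d(1)] d \<open>c \<noteq> {}\<close> that
        \<open>\<And>d. connected d \<Longrightarrow> d \<subseteq> S \<Longrightarrow> c \<subseteq> d \<Longrightarrow> d \<subseteq> T\<close>[OF d] by blast
  qed
  show ?thesis
  proof (intro equalityI subsetI)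
    fix c assume c: "c \<in> components S"
    hence "c \<subseteq> A \<or> c \<subseteq> B"
      using piece in_components_connected in_components_subset by blast
    thus "c \<in> components A \<union> components B" using up[OF c] S(1) by blast
  next
    fix c assume "c \<in> components A \<union> components B"
    moreover have "c \<in> components S" if c: "c \<in> components A"
    proof (rule down[OF c])
      have "c \<noteq> {}" "c \<subseteq> A" using in_components_nonempty[OF c] in_components_subset[OF c] by auto
      thus "d \<subseteq> A" if "connected d" "d \<subseteq> S" "c \<subseteq> d" for d
        using piece[OF that(1,2)] that(3) S(6) by blast
    qed (use S in blast)
    moreover have "c \<in> components S" if c: "c \<in> components B"
    proof (rule down[OF c])
      have "c \<noteq> {}" "c \<subseteq> B" using in_components_nonempty[OF c] in_components_subset[OF c] by auto
      thus "d \<subseteq> B" if "connected d" "d \<subseteq> S" "c \<subseteq> d" for d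
        using piece[OF that(1,2)] that(3) S(6) by blast
    qed (use S in blast)
    ultimately show "c \<in> components S" by blast
  qed
qed

definition sector :: "complex set \<Rightarrow> bool \<Rightarrow> bool \<Rightarrow> complex set" where
  "sector C X Y = half X \<inter> region C Y"

context meander
begin

lemma open_sector: "open (sector C X Y)"
  by (simp add: sector_def open_Int open_half jordan)

text \<open>Transversality makes the horizontal direction admissible for a chart, so the line and
  the curve become the two coordinate axes. \<open>a\<close> is the half-plane that the curve
  enters, and \<open>b\<close> tells the side of the curve on which the first coordinate is
  positive.\<close>

lemma crossing_chart:
  assumes "p \<in> crossings C"
  obtains t0 w e a b where "\<gamma> t0 = p" "e > 0" "open (chart t0 w ` square e)"
    "\<And>q. q \<in> square e \<Longrightarrow> chart t0 w q \<in> C \<longleftrightarrow> fst q = 0"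
    "\<And>q. q \<in> square e \<Longrightarrow> chart t0 w q \<in> \<real> \<longleftrightarrow> snd q = 0"
    "\<And>q X. q \<in> square e \<Longrightarrow> chart t0 w q \<in> half X \<longleftrightarrow> (if X = a then snd q > 0 else snd q < 0)"
    "\<And>q Y. q \<in> square e \<Longrightarrow> chart t0 w q \<in> region C Y \<longleftrightarrow> (if Y = b then fst q > 0 else fst q < 0)"
proof -
  obtain t0 where t0: "\<gamma> t0 = p" "p \<in> \<real>" using assms C_range by (auto simp: crossings_def)
  have im: "Im (\<gamma>' t0) \<noteq> 0" using trans[of t0] t0 by (simp add: complex_is_Real_iff)
  define a where "a \<longleftrightarrow> Im (\<gamma>' t0) > 0"
  \<comment> \<open>The sign makes \<open>Im (\<gamma>' t0 / w)\<close> positive both for rising and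
    for falling crossings.\<close>
  define w where "w = (if a then 1 else - 1 :: complex)"
  have "Im (\<gamma>' t0 / w) > 0" using im by (auto simp: w_def a_def)
  then obtain e where e: "e > 0" "open (chart t0 w ` square e)"
    "\<And>q. q \<in> square e \<Longrightarrow> chart t0 w q \<in> C \<longleftrightarrow> fst q = 0"
    "\<And>q. q \<in> square e \<Longrightarrow> sgn (Im (chart t0 w q / w) - Im (\<gamma> t0 / w)) = sgn (snd q)"
    using chart_exists[OF _ open_UNIV UNIV_I] by metis
  obtain b where b: "\<And>q Y. q \<in> square e \<Longrightarrow>
    chart t0 w q \<in> region C Y \<longleftrightarrow> (if Y = b then fst q > 0 else fst q < 0)"
    using chart_sides[OF e(1-3)] by metis
  have s: "sgn (if a then Im (chart t0 w q) else - Im (chart t0 w q)) = sgn (snd q)"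
    if "q \<in> square e" for q
    using e(4)[OF that] t0 by (simp add: w_def complex_is_Real_iff split: if_splits)
  have r: "chart t0 w q \<in> \<real> \<longleftrightarrow> snd q = 0" if "q \<in> square e" for q
    using s[OF that] by (auto simp: complex_is_Real_iff sgn_if split: if_splits)
  have h: "chart t0 w q \<in> half X \<longleftrightarrow> (if X = a then snd q > 0 else snd q < 0)"
    if "q \<in> square e" for q X
    using s[OF that] by (auto simp: half_def sgn_if split: if_splits)
  show ?thesis by (rule that[of t0 e w a b]) (fact t0 e r h b)+
qed

text \<open>In the chart these sets are an open quadrant and two open half-axes.\<close>

lemma onesided_crossing:
  assumes "p \<in> crossings C"
  shows "onesided p (sector C X Y)" "onesided p (C \<inter> half X)" "onesided p (\<real> \<inter> region C Y)"
proof -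
  obtain t0 w e a b where *: "\<gamma> t0 = p" "e > 0" "open (chart t0 w ` square e)"
    "\<And>q. q \<in> square e \<Longrightarrow> chart t0 w q \<in> C \<longleftrightarrow> fst q = 0"
    "\<And>q. q \<in> square e \<Longrightarrow> chart t0 w q \<in> \<real> \<longleftrightarrow> snd q = 0"
    "\<And>q X. q \<in> square e \<Longrightarrow> chart t0 w q \<in> half X \<longleftrightarrow> (if X = a then snd q > 0 else snd q < 0)"
    "\<And>q Y. q \<in> square e \<Longrightarrow> chart t0 w q \<in> region C Y \<longleftrightarrow> (if Y = b then fst q > 0 else fst q < 0)"
    by (rule crossing_chart[OF assms]) (rule that)
  define I where "I = (if Y = b then {0<..<e} else {-e<..<0})"
  define J where "J = (if X = a then {0<..<e} else {-e<..<0})"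
  have IJ: "convex I" "convex J" "I \<subseteq> {-e<..<e}" "J \<subseteq> {-e<..<e}" "0 \<in> closure I" "0 \<in> closure J"
    using *(2) by (auto simp: I_def J_def)
  have Z: "convex {0}" "{0} \<subseteq> {-e<..<e}" "(0::real) \<in> closure {0}" using *(2) by auto
  have "onesided (\<gamma> t0) (sector C X Y)"
    by (rule onesided_chart[OF *(2,3) IJ(1,2,3,4,5,6)])
       (auto simp: I_def J_def sector_def *(6,7) square_def split: if_splits)
  thus "onesided p (sector C X Y)" by (simp add: *(1))
  have "onesided (\<gamma> t0) (C \<inter> half X)"
    by (rule onesided_chart[OF *(2,3) Z(1) IJ(2) Z(2) IJ(4) Z(3) IJ(6)])
       (auto simp: J_def *(4,6) square_def split: if_splits)
  thus "onesided p (C \<inter> half X)" by (simp add: *(1))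
  have "onesided (\<gamma> t0) (\<real> \<inter> region C Y)"
    by (rule onesided_chart[OF *(2,3) IJ(1) Z(1) IJ(3) Z(2) IJ(5) Z(3)])
       (auto simp: I_def *(5,7) square_def split: if_splits)
  thus "onesided p (\<real> \<inter> region C Y)" by (simp add: *(1))
qed

lemma onesided_curve:
  assumes "z \<in> C \<inter> half X"
  shows "onesided z (sector C X Y)"
proof -
  obtain t0 where t0: "\<gamma> t0 = z" using assms C_range by auto
  have g: "\<gamma> t0 \<in> half X" using assms t0 by simp
  \<comment> \<open>Away from the line the normal direction is used, which is transversal whatever
    the slope of the curve; the quotient is the imaginary unit.\<close>
  have w: "Im (\<gamma>' t0 / (- \<i> * \<gamma>' t0)) > 0" using reg by (simp add: field_simps)
  obtain e where e: "e > 0" "open (chart t0 (- \<i> * \<gamma>' t0) ` square e)"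
    "chart t0 (- \<i> * \<gamma>' t0) ` square e \<subseteq> half X"
    "\<And>q. q \<in> square e \<Longrightarrow> chart t0 (- \<i> * \<gamma>' t0) q \<in> C \<longleftrightarrow> fst q = 0"
    "\<And>q. q \<in> square e \<Longrightarrow> sgn (Im (chart t0 (- \<i> * \<gamma>' t0) q / (- \<i> * \<gamma>' t0)) -
       Im (\<gamma> t0 / (- \<i> * \<gamma>' t0))) = sgn (snd q)"
    by (rule chart_exists[OF w open_half g]) (rule that)
  obtain b where b: "\<And>q Y. q \<in> square e \<Longrightarrow>
    chart t0 (- \<i> * \<gamma>' t0) q \<in> region C Y \<longleftrightarrow> (if Y = b then fst q > 0 else fst q < 0)"
    using chart_sides[OF e(1,2,4)] by metis
  define I where "I = (if Y = b then {0<..<e} else {-e<..<0})"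
  have I: "convex I" "I \<subseteq> {-e<..<e}" "0 \<in> closure I"
    using e(1) by (auto simp: I_def)
  have J: "convex {-e<..<e}" "{-e<..<e} \<subseteq> {-e<..<e}" "0 \<in> closure {-e<..<e}"
    using e(1) closure_subset[of "{-e<..<e}"] by auto
  have "onesided (\<gamma> t0) (sector C X Y)"
  proof (rule onesided_chart[OF e(1,2) I(1) J(1) I(2) J(2) I(3) J(3)])
    fix q assume q: "q \<in> square e"
    hence "chart t0 (- \<i> * \<gamma>' t0) q \<in> half X" using e(3) by blast
    thus "chart t0 (- \<i> * \<gamma>' t0) q \<in> sector C X Y \<longleftrightarrow> q \<in> I \<times> {-e<..<e}"
      using q b[OF q, of Y] by (cases q) (auto simp: I_def sector_def square_def)
  qed
  thus ?thesis using t0 by simp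
qed

text \<open>Away from the curve a small ball meets the sector in a half-disk, which is
  convex.\<close>

lemma onesided_line:
  assumes "z \<in> \<real> \<inter> region C Y"
  shows "onesided z (sector C X Y)"
proof -
  obtain e where e: "e > 0" "ball z e \<subseteq> region C Y"
    using assms jordan(1) open_contains_ball by blast
  have eq: "ball z e \<inter> sector C X Y = ball z e \<inter> half X" using e(2) by (auto simp: sector_def)
  have "z \<in> closure (half X)"
  proof (cases X)
    case True
    have "z \<in> {z. Im z \<ge> 0}" using assms by (simp add: complex_is_Real_iff)
    thus ?thesis using True closure_halfspace_gt[of "\<i>" 0] by (simp add: half_def inner_complex_def)
  next
    case False
    have "z \<in> {z. Im z \<le> 0}" using assms by (simp add: complex_is_Real_iff)
    thus ?thesis using False closure_halfspace_lt[of "\<i>" 0] by (simp add: half_def inner_complex_def)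
  qed
  hence "z \<in> closure (ball z e \<inter> half X)"
    using e(1) open_Int_closure_subset[of "ball z e" "half X"] by auto
  hence "z \<in> closure (sector C X Y)"
    unfolding eq[symmetric] using closure_mono[of "ball z e \<inter> sector C X Y" "sector C X Y"] by auto
  moreover have "connected (ball z e \<inter> sector C X Y)"
    unfolding eq by (intro convex_connected convex_Int convex_ball convex_half)
  ultimately show ?thesis
    unfolding onesided_def using e(1) by (meson centre_in_ball open_ball)
qed

text \<open>An accumulation point would itself be a crossing by compactness, but in its chart the
  two axes meet only at the centre.\<close>

lemma finite_crossings: "finite (crossings C)"
proof (rule ccontr)
  assume inf: "infinite (crossings C)"
  have "compact (crossings C)"
    unfolding crossings_def by (intro compact_Int_closed compact_C closed_complex_Reals)
  then obtain p where p: "p \<in> crossings C" "p islimpt crossings C"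
    using inf by (metis compact_eq_Bolzano_Weierstrass order_refl)
  obtain t0 w e a b where *: "\<gamma> t0 = p" "e > 0" "open (chart t0 w ` square e)"
    "\<And>q. q \<in> square e \<Longrightarrow> chart t0 w q \<in> C \<longleftrightarrow> fst q = 0"
    "\<And>q. q \<in> square e \<Longrightarrow> chart t0 w q \<in> \<real> \<longleftrightarrow> snd q = 0"
    "\<And>q X. q \<in> square e \<Longrightarrow> chart t0 w q \<in> half X \<longleftrightarrow> (if X = a then snd q > 0 else snd q < 0)"
    "\<And>q Y. q \<in> square e \<Longrightarrow> chart t0 w q \<in> region C Y \<longleftrightarrow> (if Y = b then fst q > 0 else fst q < 0)"
    by (rule crossing_chart[OF p(1)]) (rule that)
  have p0: "chart t0 w (0, 0) = p" "(0, 0) \<in> square e" using *(1,2) by (auto simp: square_def)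
  hence "p \<in> chart t0 w ` square e" by force
  then obtain y where y: "y \<in> crossings C" "y \<in> chart t0 w ` square e" "y \<noteq> p"
    using p(2) *(3) unfolding islimpt_def by blast
  then obtain q where q: "q \<in> square e" "y = chart t0 w q" by blast
  have "q = (0, 0)" using *(4,5)[OF q(1)] y(1) q(2) by (cases q) (auto simp: crossings_def)
  thus False using y(3) q(2) p0 by simp
qed

lemma crossings_nonempty: "crossings C \<noteq> {}"
  using meets by (simp add: crossings_def)

end

section \<open>Edges and their endpoints\<close>

definition arcs :: "complex set \<Rightarrow> bool \<Rightarrow> complex set set" where
  "arcs C X = components (C \<inter> half X)"

text \<open>Selected from \<open>meander_edges\<close> rather than taken as components, since the
  outer edge consists of two components in the plane.\<close>

definition lines :: "complex set \<Rightarrow> bool \<Rightarrow> complex set set" where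
  "lines C Y = {E \<in> meander_edges C. E \<subseteq> \<real> \<inter> region C Y}"

definition ends :: "complex set \<Rightarrow> complex set \<Rightarrow> complex set" where
  "ends C E = {p \<in> crossings C. p \<in> closure E}"

context meander
begin

lemma edge_components:
  "components ((\<real> \<union> C) - crossings C) = arcs C True \<union> arcs C False \<union> components (\<real> - C)"
proof -
  have cl: "open (- C)" using compact_C by (simp add: compact_imp_closed open_Compl)
  have "components ((\<real> \<union> C) - crossings C) =
      components (C \<inter> half True) \<union> components (C \<inter> half False \<union> (\<real> - C))"
  proof (rule components_split)
    show "\<real> \<union> C - crossings C = C \<inter> half True \<union> (C \<inter> half False \<union> (\<real> - C))"
      by (auto simp: crossings_def half_def complex_is_Real_iff)
    show "C \<inter> half True = (\<real> \<union> C - crossings C) \<inter> half True"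
      "C \<inter> half False \<union> (\<real> - C) = (\<real> \<union> C - crossings C) \<inter> (half False \<union> - C)"
      "C \<inter> half True \<inter> (C \<inter> half False \<union> (\<real> - C)) = {}"
      by (auto simp: crossings_def half_def complex_is_Real_iff)
    show "open (half True)" "open (half False \<union> - C)" by (intro open_half open_Un cl)+
  qed
  moreover have "components (C \<inter> half False \<union> (\<real> - C)) =
      components (C \<inter> half False) \<union> components (\<real> - C)"
  proof (rule components_split)
    show "C \<inter> half False = (C \<inter> half False \<union> (\<real> - C)) \<inter> half False"
      "\<real> - C = (C \<inter> half False \<union> (\<real> - C)) \<inter> - C" "C \<inter> half False \<inter> (\<real> - C) = {}"
      by (auto simp: half_def complex_is_Real_iff)
    show "open (half False)" "open (- C)" by (intro open_half cl)+
  qed simp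
  ultimately show ?thesis by (simp add: arcs_def Un_assoc)
qed

lemma line_components:
  "components (\<real> - C) = components (\<real> \<inter> region C True) \<union> components (\<real> \<inter> region C False)"
proof (rule components_split[where U = "region C True" and V = "region C False"])
  show "\<real> - C = \<real> \<inter> region C True \<union> \<real> \<inter> region C False" using jordan(5) by blast
  show "\<real> \<inter> region C True = (\<real> - C) \<inter> region C True"
    "\<real> \<inter> region C False = (\<real> - C) \<inter> region C False" using jordan(7) by blast+
  show "\<real> \<inter> region C True \<inter> (\<real> \<inter> region C False) = {}" using jordan(4)[of True] by auto
qed (simp_all add: jordan)

lemma meander_faces_eq:
  "meander_faces C = (\<Union>X. \<Union>Y. components (sector C X Y))"
proof -
  have "components (- (\<real> \<union> C)) = components (half True - C) \<union> components (half False - C)"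
  proof (rule components_split)
    show "- (\<real> \<union> C) = (half True - C) \<union> (half False - C)"
      "half True - C = - (\<real> \<union> C) \<inter> half True" "half False - C = - (\<real> \<union> C) \<inter> half False"
      "(half True - C) \<inter> (half False - C) = {}"
      by (auto simp: half_def complex_is_Real_iff)
  qed (rule open_half)+
  moreover have "components (half X - C) = components (sector C X True) \<union> components (sector C X False)" for X
  proof (rule components_split[where U = "region C True" and V = "region C False"])
    show "half X - C = sector C X True \<union> sector C X False"
      using jordan(5) by (auto simp: sector_def)
    show "sector C X True = (half X - C) \<inter> region C True"
      "sector C X False = (half X - C) \<inter> region C False"
      using jordan(7) by (auto simp: sector_def)
    show "sector C X True \<inter> sector C X False = {}" using jordan(4)[of True] by (auto simp: sector_def)
  qed (simp_all add: jordan)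
  ultimately show ?thesis unfolding meander_faces_def UNIV_bool by auto
qed

text \<open>Starting the period at a crossing, \<open>u\<close> and \<open>v\<close> are the last
  parameter before and the first one after a point of \<open>E\<close> at which the curve meets the
  line. The image of the open interval between them is split off from the rest of the half-plane
  part, hence is the whole component.\<close>

lemma arc_param:
  assumes "E \<in> arcs C X"
  obtains u v where "u < v" "E = \<gamma> ` {u<..<v}" "ends C E = {\<gamma> u, \<gamma> v}" "\<gamma> u \<noteq> \<gamma> v"
proof -
  obtain p0 where p0: "p0 \<in> crossings C" using crossings_nonempty by blast
  then obtain t0 where t0: "\<gamma> t0 = p0" "p0 \<in> \<real>" using C_range by (auto simp: crossings_def)
  have t1: "\<gamma> (t0 + 1) \<in> \<real>" using t0 per by simp
  obtain z where z: "z \<in> E" using assms in_components_nonempty unfolding arcs_def by blast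
  have EC: "E \<subseteq> C \<inter> half X" using assms in_components_subset unfolding arcs_def by blast
  obtain t where t: "t0 \<le> t" "t < t0 + 1" "\<gamma> t = z" using C_window z EC by blast
  have zR: "z \<notin> \<real>" using z EC half_not_Reals by blast
  define T where "T = {s \<in> {t0..t0+1}. \<gamma> s \<in> \<real>}"
  have "closed ({t0..t0+1} \<inter> \<gamma> -` \<real>)"
    by (rule continuous_closed_preimage[OF cont closed_atLeastAtMost closed_complex_Reals])
  hence "compact ({t0..t0+1} \<inter> ({t0..t0+1} \<inter> \<gamma> -` \<real>))" by (rule compact_Int_closed[OF compact_Icc])
  moreover have "T = {t0..t0+1} \<inter> ({t0..t0+1} \<inter> \<gamma> -` \<real>)" by (auto simp: T_def)
  ultimately have "compact T" by simp
  hence c: "compact (T \<inter> {..t})" "compact (T \<inter> {t..})" by (auto intro: compact_Int_closed)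
  have "t0 \<in> T \<inter> {..t}" "t0 + 1 \<in> T \<inter> {t..}" using t t0 t1 by (auto simp: T_def)
  hence "T \<inter> {..t} \<noteq> {}" "T \<inter> {t..} \<noteq> {}" by blast+
  then obtain u v where u: "u \<in> T" "u \<le> t" "\<And>s. s \<in> T \<Longrightarrow> s \<le> t \<Longrightarrow> s \<le> u"
    and v: "v \<in> T" "t \<le> v" "\<And>s. s \<in> T \<Longrightarrow> t \<le> s \<Longrightarrow> v \<le> s"
    using compact_attains_sup[OF c(1)] compact_attains_inf[OF c(2)] by auto
  have uR: "\<gamma> u \<in> \<real>" "t0 \<le> u" and vR: "\<gamma> v \<in> \<real>" "v \<le> t0 + 1" using u v by (auto simp: T_def)
  have utv: "u < t" "t < v" using u(2) v(2) uR vR zR t(3) by (auto simp: less_le)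
  have int: "\<gamma> s \<notin> \<real>" if "s \<in> {u<..<v}" for s
    using that u(3)[of s] v(3)[of s] uR vR by (cases "s \<le> t") (auto simp: T_def)
  define A where "A = \<gamma> ` {u<..<v}"
  have Aconn: "connected A" unfolding A_def by (intro connected_continuous_image cont) auto
  have zA: "z \<in> A" using utv t(3) by (auto simp: A_def)
  have AX: "A \<subseteq> half X"
  proof -
    have "A \<subseteq> half X \<union> half (\<not> X)"
    proof
      fix x assume "x \<in> A"
      hence "Im x \<noteq> 0" using int by (auto simp: A_def complex_is_Real_iff)
      thus "x \<in> half X \<union> half (\<not> X)" by (auto simp: half_def)
    qed
    hence "half X \<inter> A = {} \<or> half (\<not> X) \<inter> A = {}"
      using connectedD[OF Aconn open_half open_half] half_disjoint[of X] by blast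
    thus ?thesis using \<open>A \<subseteq> half X \<union> half (\<not> X)\<close> zA z EC by blast
  qed
  define S where "S = C \<inter> half X"
  have SR: "S \<inter> \<real> = {}" using half_not_Reals by (auto simp: S_def)
  have cl: "closed (\<gamma> ` {t0..u} \<union> \<gamma> ` {v..t0+1})" "closed (\<gamma> ` {u..v})"
    by (intro closed_Un compact_imp_closed compact_continuous_image cont compact_Icc)+
  have AS: "A \<subseteq> S" using AX C_range by (auto simp: S_def A_def)
  \<comment> \<open>Both parts arise from \<open>S\<close> by deleting the compact image of closed
    parameter intervals; the two endpoints of the arc are real and so outside \<open>S\<close>
    anyway.\<close>
  have "components S = components A \<union> components (S - A)"
  proof (rule components_split)
    show "A = S \<inter> - (\<gamma> ` {t0..u} \<union> \<gamma> ` {v..t0+1})"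
    proof (intro equalityI subsetI)
      fix x assume x: "x \<in> A"
      then obtain s where s: "x = \<gamma> s" "u < s" "s < v" by (auto simp: A_def)
      have "\<gamma> s \<noteq> \<gamma> s'" if "s' \<in> {t0..u} \<union> {v..t0+1}" for s'
        using inj_near[of s s'] that s uR vR by auto
      hence "\<gamma> s \<notin> \<gamma> ` ({t0..u} \<union> {v..t0+1})" by blast
      thus "x \<in> S \<inter> - (\<gamma> ` {t0..u} \<union> \<gamma> ` {v..t0+1})"
        using x AS s(1) by (simp add: image_Un subset_eq)
    next
      fix x assume x: "x \<in> S \<inter> - (\<gamma> ` {t0..u} \<union> \<gamma> ` {v..t0+1})"
      then obtain s where s: "t0 \<le> s" "s < t0 + 1" "\<gamma> s = x"
        using C_window[of x t0] by (auto simp: S_def)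
      have "s \<notin> {t0..u} \<union> {v..t0+1}" using x s(3) by auto
      thus "x \<in> A" using s by (auto simp: A_def)
    qed
    show "S - A = S \<inter> - (\<gamma> ` {u..v})"
    proof -
      have "{u..v} = insert u (insert v {u<..<v})" using utv by auto
      hence "\<gamma> ` {u..v} = insert (\<gamma> u) (insert (\<gamma> v) A)" by (simp add: A_def)
      thus ?thesis using uR vR SR by auto
    qed
    show "open (- (\<gamma> ` {t0..u} \<union> \<gamma> ` {v..t0+1}))" "open (- (\<gamma> ` {u..v}))"
      by (intro open_Compl cl)+
  qed (use AS in auto)
  moreover have "A \<in> components A" using Aconn zA by (intro components_maximalI) auto
  ultimately have "A \<in> components S" by blast
  moreover have "E \<in> components S" using assms by (simp add: arcs_def S_def)
  ultimately have EA: "E = A" using components_eq[of E S A] z zA by blast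
  have clA: "closure A = \<gamma> ` {u..v}"
  proof
    show "closure A \<subseteq> \<gamma> ` {u..v}" by (rule closure_minimal[OF _ cl(2)]) (auto simp: A_def)
    have "\<gamma> ` closure {u<..<v} \<subseteq> closure A"
      by (rule image_closure_subset[OF cont]) (auto simp: A_def closure_subset)
    thus "\<gamma> ` {u..v} \<subseteq> closure A" using utv by simp
  qed
  have ends: "ends C E = {\<gamma> u, \<gamma> v}"
  proof -
    have "{u..v} = insert u (insert v {u<..<v})" using utv by auto
    hence "\<gamma> ` {u..v} = insert (\<gamma> u) (insert (\<gamma> v) A)" by (simp add: A_def)
    moreover have "A \<inter> \<real> = {}" using AS SR by blast
    moreover have "\<gamma> u \<in> C" "\<gamma> v \<in> C" by (auto simp: C_range)
    ultimately show ?thesis using uR vR unfolding ends_def EA clA crossings_def by auto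
  qed
  \<comment> \<open>Otherwise the arc would be the whole curve except for the crossing
    \<open>p0\<close>, and the curve would miss the other half-plane, contrary to transversality at
    \<open>p0\<close>.\<close>
  have "\<gamma> u \<noteq> \<gamma> v"
  proof
    assume eq: "\<gamma> u = \<gamma> v"
    have "\<bar>u - v\<bar> \<ge> 1" using inj_near[OF eq] utv by force
    hence uv: "u = t0" "v = t0 + 1" using uR vR utv by auto
    have "C \<subseteq> insert p0 A"
    proof
      fix x assume "x \<in> C"
      then obtain s where "t0 \<le> s" "s < t0 + 1" "\<gamma> s = x" using C_window[of x t0] by auto
      thus "x \<in> insert p0 A" using uv t0 by (cases "s = t0") (auto simp: A_def)
    qed
    hence "C \<inter> half (\<not> X) = {}" using AX t0 half_not_Reals half_disjoint[of X] by blast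
    thus False using onesided_crossing(2)[OF p0, of "\<not> X"] by (simp add: onesided_def)
  qed
  moreover have "u < v" using utv by simp
  ultimately show ?thesis using that ends EA A_def by blast
qed

lemma card_ends_arc: "E \<in> arcs C X \<Longrightarrow> card (ends C E) = 2"
  by (erule arc_param) simp

text \<open>By transversality exactly one branch of the curve at \<open>p\<close> enters each
  half-plane; formally this is \<open>facing_unique\<close> for the curve inside
  \<open>half X\<close>.\<close>

lemma arc_at_crossing:
  assumes "p \<in> crossings C"
  shows "\<exists>!E. E \<in> arcs C X \<and> p \<in> ends C E"
  using facing_unique[OF onesided_crossing(2)[OF assms, of X]] assms by (simp add: arcs_def ends_def)

section \<open>The edges on the line as real intervals\<close>

definition cut :: "real set" where "cut = Re ` crossings C"

lemma crossings_cut: "crossings C = of_real ` cut"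
proof -
  have "x = complex_of_real (Re x)" if "x \<in> crossings C" for x
    using that by (simp add: crossings_def complex_is_Real_iff complex_eq_iff)
  hence "(\<lambda>x. complex_of_real (Re x)) ` crossings C = crossings C" by force
  thus ?thesis by (simp add: cut_def image_image)
qed

lemma finite_cut: "finite cut"
  by (simp add: cut_def finite_crossings)

lemma of_real_in_C: "complex_of_real x \<in> C \<longleftrightarrow> x \<in> cut"
proof -
  have "complex_of_real x \<in> C \<longleftrightarrow> complex_of_real x \<in> crossings C" by (simp add: crossings_def)
  thus ?thesis unfolding crossings_cut by auto
qed

lemma two_crossings: "card cut \<ge> 2"
proof -
  obtain p E where "p \<in> crossings C" "E \<in> arcs C True"
    using crossings_nonempty arc_at_crossing by blast
  hence "2 \<le> card (crossings C)"
    using card_mono[OF finite_crossings, of "ends C E"] card_ends_arc by (auto simp: ends_def)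
  moreover have "card (crossings C) = card cut"
    unfolding crossings_cut by (intro card_image inj_onI) simp
  ultimately show ?thesis by simp
qed

lemma cut_nonempty: "cut \<noteq> {}"
  using two_crossings by auto

abbreviation "leftmost \<equiv> Min cut"
abbreviation "rightmost \<equiv> Max cut"

lemma leftmost_less: "leftmost < rightmost"
proof (rule ccontr)
  assume "\<not> leftmost < rightmost"
  hence "cut \<subseteq> {leftmost}"
    using Min_le[OF finite_cut] Max_ge[OF finite_cut] by force
  thus False using two_crossings card_mono[of "{leftmost}" cut] by simp
qed

text \<open>A larger connected set would have to pass through the frontier of \<open>J\<close>,
  which consists of crossings.\<close>

lemma interval_component:
  assumes "connected J" "J \<noteq> {}" "J \<inter> cut = {}" "frontier J \<subseteq> cut"
  shows "complex_of_real ` J \<in> components (\<real> - C)"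
proof (rule components_maximalI)
  show "complex_of_real ` J \<noteq> {}" using assms by simp
  show "complex_of_real ` J \<subseteq> \<real> - C" using assms(3) of_real_in_C by auto
  show "connected (complex_of_real ` J)"
    by (intro connected_continuous_image assms continuous_intros)
  fix d assume d: "connected d" "d \<subseteq> \<real> - C" "complex_of_real ` J \<subseteq> d"
  have conn: "connected (Re ` d)" by (intro connected_continuous_image d continuous_intros)
  have dR: "x = complex_of_real (Re x)" if "x \<in> d" for x
    using that d(2) by (auto simp: complex_is_Real_iff complex_eq_iff)
  have "Re x \<notin> cut" if "x \<in> d" for x
    using that d(2) of_real_in_C[of "Re x"] dR[OF that] by auto
  hence "Re ` d \<inter> frontier J = {}" using assms(4) by blast
  moreover have "Re ` d \<inter> J \<noteq> {}" using assms(2) d(3) by force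
  ultimately have "Re ` d - J = {}" using connected_Int_frontier[OF conn] by blast
  show "d \<subseteq> complex_of_real ` J"
  proof
    fix x assume x: "x \<in> d"
    hence "Re x \<in> J" using \<open>Re ` d - J = {}\<close> by blast
    thus "x \<in> complex_of_real ` J" using dR[OF x] by (rule rev_image_eqI)
  qed
qed

lemma rays_components:
  "complex_of_real ` {..<leftmost} \<in> components (\<real> - C)"
  "complex_of_real ` {rightmost<..} \<in> components (\<real> - C)"
proof -
  have lr: "leftmost \<in> cut" "rightmost \<in> cut" "\<And>x. x \<in> cut \<Longrightarrow> leftmost \<le> x \<and> x \<le> rightmost"
    using finite_cut cut_nonempty by auto
  show "complex_of_real ` {..<leftmost} \<in> components (\<real> - C)"
  proof (rule interval_component)
    show "{..<leftmost} \<inter> cut = {}" using lr(3) by (meson disjoint_iff lessThan_iff not_less)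
    show "frontier {..<leftmost} \<subseteq> cut" using lr(1) by (force simp: frontier_def interior_open le_less)
  qed (auto simp: lt_ex)
  show "complex_of_real ` {rightmost<..} \<in> components (\<real> - C)"
  proof (rule interval_component)
    show "{rightmost<..} \<inter> cut = {}" using lr(3) by (meson disjoint_iff greaterThan_iff not_less)
    show "frontier {rightmost<..} \<subseteq> cut" using lr(2) by (force simp: frontier_def interior_open le_less)
  qed (auto simp: gt_ex)
qed

lemma line_component_cases:
  assumes "E \<in> components (\<real> - C)"
  obtains "E = complex_of_real ` {..<leftmost}" | "E = complex_of_real ` {rightmost<..}"
  | p q where "p \<in> cut" "q \<in> cut" "p < q" "{p<..<q} \<inter> cut = {}" "E = complex_of_real ` {p<..<q}"
proof -
  obtain z where z: "z \<in> E" using assms in_components_nonempty by blast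
  hence "z \<in> \<real> - C" using assms in_components_subset by blast
  then obtain r where r: "z = of_real r" "r \<notin> cut" using of_real_in_C by (auto elim: Reals_cases)
  have eq: "E = E'" if "E' \<in> components (\<real> - C)" "z \<in> E'" for E'
    using components_eq[OF assms that(1)] z that(2) by blast
  consider "r < leftmost" | "r > rightmost" | "leftmost \<le> r" "r \<le> rightmost" by linarith
  thus ?thesis
  proof cases
    case 1
    thus ?thesis using that(1) eq[OF rays_components(1)] r by blast
  next
    case 2
    thus ?thesis using that(2) eq[OF rays_components(2)] r by blast
  next
    case 3
    define p where "p = Max {x \<in> cut. x < r}"
    define q where "q = Min {x \<in> cut. x > r}"
    have "leftmost \<in> {x \<in> cut. x < r}" "rightmost \<in> {x \<in> cut. x > r}"
      using 3 r(2) Min_in[OF finite_cut cut_nonempty] Max_in[OF finite_cut cut_nonempty]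
      by (auto simp: less_le)
    moreover have fin: "finite {x \<in> cut. x < r}" "finite {x \<in> cut. x > r}" using finite_cut by auto
    ultimately have p: "p \<in> cut" "p < r" and q: "q \<in> cut" "r < q"
      using Max_in[OF fin(1)] Min_in[OF fin(2)] unfolding p_def q_def by blast+
    have gap: "{p<..<q} \<inter> cut = {}"
    proof -
      have "x \<notin> cut" if "p < x" "x < q" for x
        using that Max_ge[OF fin(1), of x] Min_le[OF fin(2), of x] r(2)
        unfolding p_def q_def by (cases x r rule: linorder_cases) auto
      thus ?thesis by auto
    qed
    have "complex_of_real ` {p<..<q} \<in> components (\<real> - C)"
      using p q gap by (intro interval_component) (auto simp: frontier_def)
    hence "E = complex_of_real ` {p<..<q}" using eq p q r by auto
    thus ?thesis using that(3) p q gap by auto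
  qed
qed

definition outer_edge :: "complex set" where
  "outer_edge = complex_of_real ` ({..<leftmost} \<union> {rightmost<..})"

lemma outer_edge_rays:
  "outer_edge = complex_of_real ` {..<leftmost} \<union> complex_of_real ` {rightmost<..}"
  by (simp add: outer_edge_def image_Un)

lemma unbounded_rays:
  "\<not> bounded (complex_of_real ` {..<x})" "\<not> bounded (complex_of_real ` {x<..})"
proof -
  have *: False if bd: "bounded (complex_of_real ` J)" and ex: "\<And>B. \<exists>y\<in>J. \<bar>y\<bar> > B" for J
  proof -
    obtain B where "\<forall>y\<in>J. \<bar>y\<bar> \<le> B" using bd by (auto simp: bounded_iff)
    moreover obtain y where "y \<in> J" "\<bar>y\<bar> > B" using ex by blast
    ultimately show False by force
  qed
  show "\<not> bounded (complex_of_real ` {..<x})"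
    by (rule notI, erule *, rule_tac x = "min (x - 1) (- B - 1)" in bexI) auto
  show "\<not> bounded (complex_of_real ` {x<..})"
    by (rule notI, erule *, rule_tac x = "max (x + 1) (B + 1)" in bexI) auto
qed

lemma unbounded_line:
  "{E \<in> components (\<real> - C). \<not> bounded E} =
    {complex_of_real ` {..<leftmost}, complex_of_real ` {rightmost<..}}"
proof -
  have "bounded (complex_of_real ` {p<..<q})" for p q
    unfolding bounded_iff by (rule exI[of _ "\<bar>p\<bar> + \<bar>q\<bar>"]) auto
  hence "E \<in> {complex_of_real ` {..<leftmost}, complex_of_real ` {rightmost<..}}"
    if "E \<in> components (\<real> - C)" "\<not> bounded E" for E
    using line_component_cases[OF that(1)] that(2) by (metis insertCI)
  thus ?thesis using rays_components unbounded_rays by blast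
qed

lemma arc_bounded: "E \<in> arcs C X \<Longrightarrow> bounded E"
  using compact_imp_bounded[OF compact_C] in_components_subset[of E "C \<inter> half X"]
    bounded_subset[of C E] by (auto simp: arcs_def)

lemma meander_edges_eq:
  "meander_edges C = arcs C True \<union> arcs C False \<union> {E \<in> components (\<real> - C). bounded E} \<union> {outer_edge}"
proof -
  have "{E \<in> components ((\<real> \<union> C) - crossings C). \<not> bounded E} =
      {complex_of_real ` {..<leftmost}, complex_of_real ` {rightmost<..}}"
    unfolding edge_components unbounded_line[symmetric] using arc_bounded by auto
  moreover have "{E \<in> components ((\<real> \<union> C) - crossings C). bounded E} =
      arcs C True \<union> arcs C False \<union> {E \<in> components (\<real> - C). bounded E}"
    unfolding edge_components using arc_bounded by auto
  ultimately show ?thesis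
    unfolding meander_edges_def Let_def by (simp add: outer_edge_rays)
qed

lemma component_region:
  assumes "c \<in> components (\<real> - C)"
  shows "c \<in> components (\<real> \<inter> region C Y) \<longleftrightarrow> c \<subseteq> region C Y"
proof
  show "c \<in> components (\<real> \<inter> region C Y) \<Longrightarrow> c \<subseteq> region C Y"
    using in_components_subset by blast
  assume sub: "c \<subseteq> region C Y"
  have "c \<noteq> {}" using assms in_components_nonempty by blast
  hence "\<not> c \<subseteq> region C (\<not> Y)" using sub jordan(4)[of Y] by blast
  hence "c \<notin> components (\<real> \<inter> region C (\<not> Y))" using in_components_subset by blast
  thus "c \<in> components (\<real> \<inter> region C Y)"
    using assms line_components by (cases Y) auto
qed

text \<open>The rays are unbounded, whereas the inside of the curve is bounded.\<close>

lemma outer_edge_outside: "outer_edge \<subseteq> \<real> \<inter> region C False"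
proof -
  have "c \<subseteq> \<real> \<inter> region C False" if c: "c \<in> components (\<real> - C)" "\<not> bounded c" for c
  proof -
    have "\<not> c \<subseteq> region C True" using c(2) jordan(6) bounded_subset by blast
    hence "c \<in> components (\<real> \<inter> region C False)"
      using c(1) line_components component_region[OF c(1)] by blast
    thus ?thesis using in_components_subset by blast
  qed
  thus ?thesis unfolding outer_edge_rays using rays_components unbounded_rays by blast
qed

lemma lines_eq:
  "lines C Y = {E \<in> components (\<real> \<inter> region C Y). bounded E} \<union> (if Y then {} else {outer_edge})"
proof -
  have ne: "outer_edge \<noteq> {}" by (simp add: outer_edge_def)
  have j: "region C True \<inter> region C False = {}" using jordan(4)[of True] by simp
  have outer: "outer_edge \<subseteq> \<real> \<inter> region C Y \<longleftrightarrow> \<not> Y"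
    using outer_edge_outside ne j by (cases Y) auto
  have arc: "\<not> E \<subseteq> \<real>" if "E \<in> arcs C X" for E X
  proof -
    have "E \<subseteq> half X" "E \<noteq> {}"
      using that in_components_subset[of E "C \<inter> half X"] in_components_nonempty[of E "C \<inter> half X"]
      by (auto simp: arcs_def)
    thus ?thesis using half_not_Reals[of X] by blast
  qed
  have line: "E \<in> components (\<real> \<inter> region C Y) \<longleftrightarrow> E \<in> components (\<real> - C) \<and> E \<subseteq> \<real> \<inter> region C Y" for E
  proof
    assume E: "E \<in> components (\<real> \<inter> region C Y)"
    hence "E \<in> components (\<real> - C)" unfolding line_components by (cases Y) auto
    thus "E \<in> components (\<real> - C) \<and> E \<subseteq> \<real> \<inter> region C Y" using in_components_subset[OF E] by simp
  qed (use component_region in blast)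
  show ?thesis
    unfolding lines_def meander_edges_eq using outer arc line by (cases Y) auto
qed

end

context meander
begin

lemma meander_edges_split:
  "meander_edges C = arcs C True \<union> arcs C False \<union> lines C True \<union> lines C False"
  unfolding meander_edges_eq lines_eq line_components by auto

lemma closure_of_real: "closure (complex_of_real ` J) = complex_of_real ` closure J"
  by (rule closure_injective_linear_image[symmetric])
     (auto simp: inj_def bounded_linear.linear[OF bounded_linear_of_real])

lemma ends_of_real: "ends C (complex_of_real ` J) = complex_of_real ` (closure J \<inter> cut)"
  unfolding ends_def crossings_cut closure_of_real by auto

lemma ends_gap:
  assumes "p \<in> cut" "q \<in> cut" "p < q" "{p<..<q} \<inter> cut = {}"
  shows "ends C (complex_of_real ` {p<..<q}) = {of_real p, of_real q}"
proof -
  have "{p..q} = insert p (insert q {p<..<q})" using assms(3) by auto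
  hence "closure {p<..<q} \<inter> cut = {p, q}" using assms by auto
  thus ?thesis unfolding ends_of_real by simp
qed

lemma ends_rays:
  "ends C (complex_of_real ` {..<leftmost}) = {of_real leftmost}"
  "ends C (complex_of_real ` {rightmost<..}) = {of_real rightmost}"
proof -
  have "{..leftmost} \<inter> cut = {leftmost}"
    using Min_in[OF finite_cut cut_nonempty] Min_le[OF finite_cut] by (auto intro: antisym)
  moreover have "{rightmost..} \<inter> cut = {rightmost}"
    using Max_in[OF finite_cut cut_nonempty] Max_ge[OF finite_cut] by (auto intro: antisym)
  ultimately show "ends C (complex_of_real ` {..<leftmost}) = {of_real leftmost}"
    "ends C (complex_of_real ` {rightmost<..}) = {of_real rightmost}"
    unfolding ends_of_real by simp_all
qed

lemma ends_Un: "ends C (A \<union> B) = ends C A \<union> ends C B"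
  by (auto simp: ends_def)

lemma bounded_line_component:
  assumes "E \<in> components (\<real> \<inter> region C Y)"
  shows "E \<in> components (\<real> - C)"
  using assms line_components by (cases Y) auto

lemma card_ends_line:
  assumes "E \<in> lines C Y"
  shows "card (ends C E) = 2"
proof (cases "E = outer_edge")
  case True
  thus ?thesis using leftmost_less by (simp add: outer_edge_rays ends_Un ends_rays)
next
  case False
  hence E: "E \<in> components (\<real> - C)" "bounded E"
    using assms bounded_line_component unfolding lines_eq by (auto split: if_splits)
  show ?thesis
    using E(2) unbounded_rays ends_gap by (cases rule: line_component_cases[OF E(1)]) auto
qed

lemma rays_in_components:
  assumes "c \<in> components (\<real> \<inter> region C Y)" "\<not> bounded c"
  shows "\<not> Y" "c = complex_of_real ` {..<leftmost} \<or> c = complex_of_real ` {rightmost<..}"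
proof -
  have "c \<in> {E \<in> components (\<real> - C). \<not> bounded E}" using assms bounded_line_component by blast
  thus "c = complex_of_real ` {..<leftmost} \<or> c = complex_of_real ` {rightmost<..}"
    unfolding unbounded_line by blast
  have "c \<subseteq> region C Y" using assms(1) in_components_subset by blast
  thus "\<not> Y" using assms(2) jordan(6) bounded_subset by (cases Y) auto
qed

text \<open>The local picture at \<open>p\<close> gives a unique component of the line inside the
  region. If it is a ray, it stands for the outer edge, and both rays stand for the same
  edge.\<close>

lemma line_at_crossing:
  assumes p: "p \<in> crossings C"
  shows "\<exists>!E. E \<in> lines C Y \<and> p \<in> ends C E"
proof -
  have os: "onesided p (\<real> \<inter> region C Y)" by (rule onesided_crossing(3)[OF p])
  define c where "c = facing (\<real> \<inter> region C Y) p"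
  have c: "c \<in> components (\<real> \<inter> region C Y)" "p \<in> closure c"
    using facing_props[OF os] by (auto simp: c_def)
  have uniq: "c' = c" if "c' \<in> components (\<real> \<inter> region C Y)" "p \<in> closure c'" for c'
    unfolding c_def using facing_eqI[OF os that] by simp
  have rays: "complex_of_real ` {..<leftmost} \<in> components (\<real> \<inter> region C False)"
    "complex_of_real ` {rightmost<..} \<in> components (\<real> \<inter> region C False)"
    using rays_components component_region outer_edge_outside unfolding outer_edge_rays by auto
  define E where "E = (if bounded c then c else outer_edge)"
  have E: "E \<in> lines C Y"
    using c(1) rays_in_components(1)[OF c(1)] by (auto simp: E_def lines_eq)
  moreover have "p \<in> ends C E"
  proof (cases "bounded c")
    case True
    thus ?thesis using c(2) p by (simp add: E_def ends_def)
  next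
    case False
    have "p \<in> ends C c" using c(2) p by (simp add: ends_def)
    thus ?thesis using False rays_in_components(2)[OF c(1) False]
      by (auto simp: E_def outer_edge_rays ends_Un)
  qed
  moreover have "E' = E" if E': "E' \<in> lines C Y" "p \<in> ends C E'" for E'
  proof (cases "E' \<in> components (\<real> \<inter> region C Y) \<and> bounded E'")
    case True
    hence "E' = c" using uniq E'(2) by (auto simp: ends_def)
    thus ?thesis using True by (simp add: E_def)
  next
    case False
    hence out: "E' = outer_edge" "\<not> Y" using E'(1) unfolding lines_eq by (auto split: if_splits)
    then obtain r where "r = complex_of_real ` {..<leftmost} \<or> r = complex_of_real ` {rightmost<..}"
      "p \<in> ends C r" using E'(2) by (auto simp: outer_edge_rays ends_Un)
    hence "r = c" "\<not> bounded r" using uniq rays out(2) unbounded_rays by (auto simp: ends_def)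
    thus ?thesis using out(1) by (simp add: E_def)
  qed
  ultimately show ?thesis by blast
qed

text \<open>Adding endpoints keeps the edge connected, and crossings are one-sided too. Thus the
  face seen from an edge is also the face having a corner at its ends.\<close>

lemma facing_ends:
  assumes "connected E" "\<And>z. z \<in> E \<Longrightarrow> onesided z (sector C X Y)"
    "x \<in> E \<union> ends C E" "y \<in> E \<union> ends C E"
  shows "facing (sector C X Y) x = facing (sector C X Y) y"
proof (rule facing_const[OF _ _ assms(3,4)])
  show "connected (E \<union> ends C E)"
    by (rule connected_intermediate_closure[OF assms(1)]) (auto simp: ends_def intro: subsetD[OF closure_subset])
  show "onesided z (sector C X Y)" if "z \<in> E \<union> ends C E" for z
    using that assms(2) onesided_crossing(1) by (auto simp: ends_def)
qed

lemma facing_arc: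
  assumes "E \<in> arcs C X" "x \<in> E \<union> ends C E" "y \<in> E \<union> ends C E"
  shows "facing (sector C X Y) x = facing (sector C X Y) y"
proof (rule facing_ends[OF _ _ assms(2,3)])
  show "connected E" using assms(1) in_components_connected by (auto simp: arcs_def)
  show "onesided z (sector C X Y)" if "z \<in> E" for z
    using that assms(1) in_components_subset[of E "C \<inter> half X"]
    by (intro onesided_curve) (auto simp: arcs_def)
qed

text \<open>The line passes through infinity inside the outer edge: its two rays are joined by
  a region of the half-plane that lies far away from the curve.\<close>

lemma facing_rays:
  obtains x y where "x < leftmost" "rightmost < y"
    "facing (sector C X False) (of_real x) = facing (sector C X False) (of_real y)"
proof -
  obtain R where R: "\<And>z. z \<in> C \<Longrightarrow> norm z < R" "R > 0"
    using compact_imp_bounded[OF compact_C] unfolding bounded_pos_less by blast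
  have in_C: "complex_of_real leftmost \<in> C" "complex_of_real rightmost \<in> C"
    using Min_in[OF finite_cut cut_nonempty] Max_in[OF finite_cut cut_nonempty] of_real_in_C by auto
  define x where "x = - (R + 1)"
  define y where "y = R + 1"
  have xy: "x < leftmost" "rightmost < y"
    using R(1)[OF in_C(1)] R(1)[OF in_C(2)] by (auto simp: x_def y_def)
  define K1 where "K1 = half X \<inter> {z. Re z < - R}"
  define K2 where "K2 = (if X then {z. Im z > R} else {z. Im z < - R})"
  define K3 where "K3 = half X \<inter> {z. Re z > R}"
  have conv: "convex K1" "convex K2" "convex K3"
    unfolding K1_def K2_def K3_def
    by (simp_all add: convex_Int convex_half convex_halfspace_Re_lt convex_halfspace_Re_gt
        convex_halfspace_Im_lt convex_halfspace_Im_gt)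
  define s where "s = (if X then 1 else - 1 :: real)"
  have "Complex x (s * y) \<in> K1 \<inter> K2" "Complex y (s * y) \<in> K2 \<inter> K3"
    using R(2) by (auto simp: K1_def K2_def K3_def x_def y_def s_def half_def)
  hence conn: "connected (K1 \<union> K2 \<union> K3)"
    using conv by (intro connected_Un convex_connected) auto
  have K_half: "K1 \<union> K2 \<union> K3 \<subseteq> half X"
    using R(2) by (auto simp: K1_def K2_def K3_def half_def)
  have "K1 \<union> K2 \<union> K3 \<subseteq> - ball 0 R"
  proof
    fix z assume "z \<in> K1 \<union> K2 \<union> K3"
    hence "\<bar>Re z\<bar> \<ge> R \<or> \<bar>Im z\<bar> \<ge> R" by (auto simp: K1_def K2_def K3_def split: if_splits)
    thus "z \<in> - ball 0 R" using abs_Re_le_cmod[of z] abs_Im_le_cmod[of z] by auto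
  qed
  moreover have "- ball 0 R \<subseteq> outside C"
    using R(1) by (intro outside_subset_convex convex_ball) auto
  ultimately have K: "K1 \<union> K2 \<union> K3 \<subseteq> sector C X False"
    using K_half by (auto simp: sector_def region_def)
  hence "sector C X False \<noteq> {}" using \<open>Complex x (s * y) \<in> K1 \<inter> K2\<close> by blast
  then obtain F where F: "F \<in> components (sector C X False)" "K1 \<union> K2 \<union> K3 \<subseteq> F"
    using exists_component_superset[OF K _ conn] by blast
  have os: "onesided (complex_of_real t) (sector C X False)" if "t < leftmost \<or> rightmost < t" for t
  proof -
    have "complex_of_real t \<in> outer_edge" using that by (auto simp: outer_edge_def)
    thus ?thesis using outer_edge_outside onesided_line by blast
  qed
  have half: "of_real t \<in> closure (half X)" if "t < leftmost \<or> rightmost < t" for t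
    using os[OF that] closure_mono[of "sector C X False" "half X"]
    by (auto simp: onesided_def sector_def)
  have "complex_of_real x \<in> {z. Re z < - R} \<inter> closure (half X)"
    using half[of x] xy by (simp add: x_def)
  hence "complex_of_real x \<in> closure K1"
    using open_Int_closure_subset[OF open_halfspace_Re_lt[of "- R"], of "half X"]
    by (auto simp: K1_def Int_commute)
  hence "facing (sector C X False) (of_real x) = F"
    using F closure_mono[of K1 F] xy by (intro facing_eqI os) auto
  moreover have "complex_of_real y \<in> {z. Re z > R} \<inter> closure (half X)"
    using half[of y] xy by (simp add: y_def)
  hence "complex_of_real y \<in> closure K3"
    using open_Int_closure_subset[OF open_halfspace_Re_gt[of R], of "half X"]
    by (auto simp: K3_def Int_commute)
  hence "facing (sector C X False) (of_real y) = F"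
    using F closure_mono[of K3 F] xy by (intro facing_eqI os) auto
  ultimately show ?thesis using that xy by metis
qed

text \<open>Only the outer edge is disconnected; there the value is carried from one ray to the
  other by \<open>facing_rays\<close>.\<close>

lemma facing_line:
  assumes E: "E \<in> lines C Y" and xy: "x \<in> E \<union> ends C E" "y \<in> E \<union> ends C E"
  shows "facing (sector C X Y) x = facing (sector C X Y) y"
proof (cases "E = outer_edge")
  case False
  hence c: "E \<in> components (\<real> \<inter> region C Y)" using E unfolding lines_eq by (auto split: if_splits)
  show ?thesis
  proof (rule facing_ends[OF _ _ xy])
    show "connected E" using c in_components_connected by blast
    show "onesided z (sector C X Y)" if "z \<in> E" for z
      using onesided_line that in_components_subset[OF c] by blast
  qed
next
  case True
  have "outer_edge \<noteq> {}" by (simp add: outer_edge_def)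
  moreover have "region C True \<inter> region C False = {}" using jordan(4)[of True] by simp
  ultimately have "\<not> outer_edge \<subseteq> region C True" using outer_edge_outside by blast
  moreover have "outer_edge \<subseteq> region C Y" using E True by (simp add: lines_def)
  ultimately have Y: "\<not> Y" by (cases Y) simp_all
  let ?L = "complex_of_real ` {..<leftmost}" and ?R = "complex_of_real ` {rightmost<..}"
  have os: "onesided z (sector C X False)" if "z \<in> ?L \<union> ?R" for z
    using that outer_edge_outside by (intro onesided_line) (auto simp: outer_edge_def)
  have conn: "connected ?L" "connected ?R"
    by (intro connected_continuous_image continuous_intros; simp)+
  obtain a b where ab: "a < leftmost" "rightmost < b"
    "facing (sector C X False) (of_real a) = facing (sector C X False) (of_real b)"
    by (rule facing_rays)
  have L: "facing (sector C X False) z = facing (sector C X False) (of_real a)" if "z \<in> ?L \<union> ends C ?L" for z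
    by (rule facing_ends[OF conn(1) _ that]) (use os ab in auto)
  have R: "facing (sector C X False) z = facing (sector C X False) (of_real b)" if "z \<in> ?R \<union> ends C ?R" for z
    by (rule facing_ends[OF conn(2) _ that]) (use os ab in auto)
  have "facing (sector C X False) z = facing (sector C X False) (of_real a)"
    if "z \<in> E \<union> ends C E" for z
    using that L[of z] R[of z] ab(3) unfolding True outer_edge_rays ends_Un by blast
  thus ?thesis using xy Y by simp
qed

end

section \<open>Counting faces and sides\<close>

text \<open>The two-element sets \<open>e E\<close> partition \<open>P\<close>, and the labels agree
  on each of them. Constant labels give the number of edges; labelling by faces counts the sides of
  one face through its corners.\<close>

lemma card_double_cover:
  assumes fin: "finite P"
    and two: "\<And>E. E \<in> \<E> \<Longrightarrow> e E \<subseteq> P \<and> card (e E) = 2"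
    and ex1: "\<And>p. p \<in> P \<Longrightarrow> \<exists>!E. E \<in> \<E> \<and> p \<in> e E"
    and const: "\<And>E p. E \<in> \<E> \<Longrightarrow> p \<in> e E \<Longrightarrow> g p = f E"
  shows "finite \<E>" "card {p \<in> P. g p = c} = 2 * card {E \<in> \<E>. f E = c}"
proof -
  have inj: "E = E'" if "E \<in> \<E>" "E' \<in> \<E>" "p \<in> e E" "p \<in> e E'" for E E' p
    using that ex1[of p] two[of E] by blast
  have "inj_on e \<E>"
  proof (rule inj_onI)
    fix E E' assume "E \<in> \<E>" "E' \<in> \<E>" "e E = e E'"
    moreover have "e E \<noteq> {}" using two[OF \<open>E \<in> \<E>\<close>] by auto
    ultimately show "E = E'" using inj by blast
  qed
  moreover have "e ` \<E> \<subseteq> Pow P" using two by blast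
  ultimately show finE: "finite \<E>" using fin by (meson finite_Pow_iff inj_on_finite)
  have "{p \<in> P. g p = c} = (\<Union>E\<in>{E \<in> \<E>. f E = c}. e E)"
  proof (intro equalityI subsetI)
    fix p assume p: "p \<in> {p \<in> P. g p = c}"
    then obtain E where "E \<in> \<E>" "p \<in> e E" using ex1 by blast
    thus "p \<in> (\<Union>E\<in>{E \<in> \<E>. f E = c}. e E)" using p const by force
  next
    fix p assume "p \<in> (\<Union>E\<in>{E \<in> \<E>. f E = c}. e E)"
    thus "p \<in> {p \<in> P. g p = c}" using two const by fastforce
  qed
  also have "card \<dots> = (\<Sum>E\<in>{E \<in> \<E>. f E = c}. card (e E))"
  proof (rule card_UN_disjoint)
    show "\<forall>E\<in>{E \<in> \<E>. f E = c}. finite (e E)" using two fin finite_subset by blast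
    show "\<forall>E\<in>{E \<in> \<E>. f E = c}. \<forall>E'\<in>{E \<in> \<E>. f E = c}. E \<noteq> E' \<longrightarrow> e E \<inter> e E' = {}"
      using inj by blast
  qed (use finE in simp)
  also have "\<dots> = (\<Sum>E\<in>{E \<in> \<E>. f E = c}. 2)" by (intro sum.cong) (use two in auto)
  finally show "card {p \<in> P. g p = c} = 2 * card {E \<in> \<E>. f E = c}" by simp
qed

definition pick :: "'a set \<Rightarrow> 'a" where "pick E = (SOME z. z \<in> E)"

lemma pick_in: "E \<noteq> {} \<Longrightarrow> pick E \<in> E"
  by (simp add: pick_def some_in_eq)

text \<open>Translates the sides of a face, defined by inclusion in its frontier, into the face
  assigned to the edge by \<open>facing\<close>.\<close>

lemma subset_frontier_iff:
  assumes "open W" "E \<inter> W = {}" "E \<noteq> {}" "\<And>z. z \<in> E \<Longrightarrow> onesided z W"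
    "\<And>z. z \<in> E \<Longrightarrow> facing W z = c" "F \<in> components W"
  shows "E \<subseteq> frontier (F :: complex set) \<longleftrightarrow> F = c"
proof
  assume "E \<subseteq> frontier F"
  moreover obtain z where "z \<in> E" using assms(3) by blast
  ultimately have "z \<in> closure F" by (auto simp: frontier_def)
  thus "F = c" using facing_eqI[OF assms(4) assms(6)] assms(5) \<open>z \<in> E\<close> by auto
next
  assume "F = c"
  hence "z \<in> closure F" if "z \<in> E" for z
    using facing_props(2)[OF assms(4)[OF that]] assms(5)[OF that] by simp
  moreover have "open F" using assms(1,6) open_components by blast
  moreover have "E \<inter> F = {}" using assms(2,6) in_components_subset by blast
  ultimately show "E \<subseteq> frontier F" by (auto simp: frontier_def interior_open)
qed

text \<open>Half the number of sides of a face in the half-plane \<open>X\<close>.\<close>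

definition arc_sides :: "complex set \<Rightarrow> bool \<Rightarrow> complex set \<Rightarrow> nat" where
  "arc_sides C X F = card {E \<in> arcs C X. E \<subseteq> frontier F}"

context meander
begin

text \<open>Constant along an edge, so any point of it may be taken. Despite the name it also serves
  for the edges on the line.\<close>

definition arc_face :: "bool \<Rightarrow> bool \<Rightarrow> complex set \<Rightarrow> complex set" where
  "arc_face X Y E = facing (sector C X Y) (pick E)"

lemma arc_subset: "E \<in> arcs C X \<Longrightarrow> E \<subseteq> C \<inter> half X" "E \<in> arcs C X \<Longrightarrow> E \<noteq> {}"
  using in_components_subset in_components_nonempty unfolding arcs_def by blast+

lemma line_subset: "E \<in> lines C Y \<Longrightarrow> E \<subseteq> \<real> \<inter> region C Y" "E \<in> lines C Y \<Longrightarrow> E \<noteq> {}"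
proof -
  assume E: "E \<in> lines C Y"
  thus "E \<subseteq> \<real> \<inter> region C Y" by (simp add: lines_def)
  have "ends C E \<noteq> {}" using card_ends_line[OF E] by auto
  thus "E \<noteq> {}" by (auto simp: ends_def)
qed

lemma facing_arc_face:
  "E \<in> arcs C X \<Longrightarrow> z \<in> E \<union> ends C E \<Longrightarrow> facing (sector C X Y) z = arc_face X Y E"
  unfolding arc_face_def using facing_arc[of E X z "pick E" Y] pick_in[OF arc_subset(2)] by auto

lemma facing_line_face:
  "E \<in> lines C Y \<Longrightarrow> z \<in> E \<union> ends C E \<Longrightarrow> facing (sector C X Y) z = arc_face X Y E"
  unfolding arc_face_def using facing_line[of E Y z "pick E" X] pick_in[OF line_subset(2)] by auto

lemma arc_onesided: "E \<in> arcs C X \<Longrightarrow> z \<in> E \<Longrightarrow> onesided z (sector C X Y)"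
  using arc_subset(1) by (intro onesided_curve) blast

lemma line_onesided: "E \<in> lines C Y \<Longrightarrow> z \<in> E \<Longrightarrow> onesided z (sector C X Y)"
  using line_subset(1) by (intro onesided_line) blast

lemma ends_subset: "ends C E \<subseteq> crossings C"
  by (auto simp: ends_def)

lemma finite_arcs: "finite (arcs C X)"
  by (rule card_double_cover(1)[OF finite_crossings, of _ "ends C" "\<lambda>_. ()" "\<lambda>_. ()"])
     (auto simp: card_ends_arc arc_at_crossing ends_subset[THEN subsetD])

lemma finite_lines: "finite (lines C Y)"
  by (rule card_double_cover(1)[OF finite_crossings, of _ "ends C" "\<lambda>_. ()" "\<lambda>_. ()"])
     (auto simp: card_ends_line line_at_crossing ends_subset[THEN subsetD])

lemma card_arcs: "card (crossings C) = 2 * card (arcs C X)"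
  using card_double_cover(2)[OF finite_crossings, of "arcs C X" "ends C" "\<lambda>_. ()" "\<lambda>_. ()" "()"]
  by (simp add: card_ends_arc arc_at_crossing ends_subset)

lemma card_lines: "card (crossings C) = 2 * card (lines C Y)"
  using card_double_cover(2)[OF finite_crossings, of "lines C Y" "ends C" "\<lambda>_. ()" "\<lambda>_. ()" "()"]
  by (simp add: card_ends_line line_at_crossing ends_subset)

text \<open>Every corner of a face is the end of one of its arcs and of one of its line edges. This
  replaces the alternation of the sides around the face: both kinds are half as many as the
  corners.\<close>

lemma face_corners:
  "card {p \<in> crossings C. facing (sector C X Y) p = F} = 2 * card {E \<in> arcs C X. arc_face X Y E = F}"
  "card {p \<in> crossings C. facing (sector C X Y) p = F} = 2 * card {E \<in> lines C Y. arc_face X Y E = F}"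
  by (rule card_double_cover(2)[OF finite_crossings, of _ "ends C"];
      simp add: card_ends_arc arc_at_crossing card_ends_line line_at_crossing ends_subset
        facing_arc_face facing_line_face)+

lemma arc_subset_frontier:
  assumes "E \<in> arcs C X" "F \<in> components (sector C X Y)"
  shows "E \<subseteq> frontier F \<longleftrightarrow> F = arc_face X Y E"
proof (rule subset_frontier_iff[OF open_sector _ _ _ _ assms(2)])
  show "E \<inter> sector C X Y = {}" using arc_subset[OF assms(1)] jordan(7) by (auto simp: sector_def)
qed (use assms(1) arc_subset arc_onesided facing_arc_face in auto)

lemma line_subset_frontier:
  assumes "E \<in> lines C Y" "F \<in> components (sector C X Y)"
  shows "E \<subseteq> frontier F \<longleftrightarrow> F = arc_face X Y E"
proof (rule subset_frontier_iff[OF open_sector _ _ _ _ assms(2)])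
  show "E \<inter> sector C X Y = {}" using line_subset[OF assms(1)] half_not_Reals by (auto simp: sector_def)
qed (use assms(1) line_subset line_onesided facing_line_face in auto)

lemma not_subset_frontier:
  assumes "open A" "open B" "A \<inter> B = {}" "E \<subseteq> A" "E \<noteq> {}" "F \<subseteq> B"
  shows "\<not> E \<subseteq> frontier F"
proof
  assume "E \<subseteq> frontier F"
  hence "A \<inter> closure F \<noteq> {}" using assms(4,5) by (auto simp: frontier_def)
  hence "A \<inter> F \<noteq> {}" using open_Int_closure_eq_empty[OF assms(1)] by blast
  thus False using assms(3,6) by blast
qed

text \<open>Edges of the opposite half-plane or region are separated from the face by open sets; the
  two remaining kinds of sides are equinumerous by \<open>face_corners\<close>.\<close>

lemma card_face_sides:
  assumes F: "F \<in> components (sector C X Y)"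
  shows "card (face_sides C F) = 2 * arc_sides C X F"
proof -
  have sub: "F \<subseteq> half X" "F \<subseteq> region C Y"
    using in_components_subset[OF F] by (auto simp: sector_def)
  have arc: "{E \<in> arcs C X. E \<subseteq> frontier F} = {E \<in> arcs C X. arc_face X Y E = F}"
    using arc_subset_frontier[OF _ F] by blast
  have line: "{E \<in> lines C Y. E \<subseteq> frontier F} = {E \<in> lines C Y. arc_face X Y E = F}"
    using line_subset_frontier[OF _ F] by blast
  have "\<not> E \<subseteq> frontier F" if "E \<in> arcs C (\<not> X)" for E
    using arc_subset[OF that] sub(1) half_disjoint[of "\<not> X"]
    by (intro not_subset_frontier[of "half (\<not> X)" "half X"]) (auto simp: open_half)
  moreover have "\<not> E \<subseteq> frontier F" if "E \<in> lines C (\<not> Y)" for E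
    using line_subset[OF that] sub(2) jordan(4)[of "\<not> Y"]
    by (intro not_subset_frontier[of "region C (\<not> Y)" "region C Y"]) (auto simp: jordan)
  moreover have "meander_edges C = arcs C X \<union> arcs C (\<not> X) \<union> lines C Y \<union> lines C (\<not> Y)"
    unfolding meander_edges_split by (cases X; cases Y) auto
  ultimately have "face_sides C F = {E \<in> arcs C X. arc_face X Y E = F} \<union> {E \<in> lines C Y. arc_face X Y E = F}"
    unfolding face_sides_def arc[symmetric] line[symmetric] by blast
  moreover have "arcs C X \<inter> lines C Y = {}"
    using arc_subset line_subset half_not_Reals[of X] by blast
  ultimately have "card (face_sides C F) =
      card {E \<in> arcs C X. arc_face X Y E = F} + card {E \<in> lines C Y. arc_face X Y E = F}"
    using finite_arcs finite_lines by (simp add: card_Un_disjoint disjoint_iff)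
  thus ?thesis using face_corners[of X Y F] by (simp add: arc_sides_def arc)
qed

lemma face_order_eq:
  assumes "F \<in> components (sector C X Y)"
  shows "face_order C F = int (arc_sides C X F) - 2"
  by (simp add: face_order_def card_face_sides[OF assms])

lemma card_faces_half:
  "finite (components (sector C X True) \<union> components (sector C X False))"
  "card (components (sector C X True) \<union> components (sector C X False)) \<le> card (arcs C X) + 1"
proof -
  have "finite (components (sector C X True) \<union> components (sector C X False)) \<and>
    card (components (sector C X True) \<union> components (sector C X False)) \<le> card (arcs C X) + 1"
  proof (rule card_faces_le)
    have eq: "half X - sector C X True - sector C X False = C \<inter> half X"
      using jordan(5) jordan(7) by (auto simp: sector_def)
    thus "half X - sector C X True - sector C X False = \<Union>(arcs C X)"
      by (simp add: arcs_def Union_components)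
    show "onesided z (sector C X True) \<and> onesided z (sector C X False)"
      if "z \<in> half X - sector C X True - sector C X False" for z
      using that onesided_curve unfolding eq by blast
    obtain p where "p \<in> crossings C" using crossings_nonempty by blast
    hence "p \<in> closure (sector C X True)" using onesided_crossing(1) by (auto simp: onesided_def)
    thus "sector C X True \<union> sector C X False \<noteq> {}" by auto
    show "sector C X True \<inter> sector C X False = {}" using jordan(4)[of True] by (auto simp: sector_def)
    show "{} \<notin> arcs C X" using arc_subset(2) by blast
    show "facing (sector C X True) x = facing (sector C X True) y \<and>
       facing (sector C X False) x = facing (sector C X False) y"
      if "E \<in> arcs C X" "x \<in> E" "y \<in> E" for E x y using facing_arc that by blast
  qed (auto simp: open_half convex_half convex_connected open_Int jordan(1) finite_arcs sector_def)
  thus "finite (components (sector C X True) \<union> components (sector C X False))"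
    "card (components (sector C X True) \<union> components (sector C X False)) \<le> card (arcs C X) + 1" by auto
qed

lemma card_faces_region:
  "card (components (sector C True Y) \<union> components (sector C False Y)) \<le> card (lines C Y) + 1"
proof -
  have "finite (components (sector C True Y) \<union> components (sector C False Y)) \<and>
    card (components (sector C True Y) \<union> components (sector C False Y)) \<le> card (lines C Y) + 1"
  proof (rule card_faces_le)
    have eq: "region C Y - sector C True Y - sector C False Y = \<real> \<inter> region C Y"
      by (auto simp: sector_def half_def complex_is_Real_iff)
    \<comment> \<open>The two unbounded components have to be merged into the outer edge, so this is
      not immediate from the decomposition into components.\<close>
    have "z \<in> \<Union>(lines C Y)" if z: "z \<in> \<real> \<inter> region C Y" for z
    proof -
      obtain c where c: "c \<in> components (\<real> \<inter> region C Y)" "z \<in> c"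
        using z by (metis UnionE Union_components)
      show ?thesis
      proof (cases "bounded c")
        case True thus ?thesis using c by (auto simp: lines_eq)
      next
        case False
        have "z \<in> outer_edge"
          using rays_in_components(2)[OF c(1) False] c(2) by (auto simp: outer_edge_def)
        thus ?thesis using rays_in_components(1)[OF c(1) False] by (auto simp: lines_eq)
      qed
    qed
    hence "\<real> \<inter> region C Y = \<Union>(lines C Y)" using line_subset(1) by blast
    thus "region C Y - sector C True Y - sector C False Y = \<Union>(lines C Y)" unfolding eq .
    show "onesided z (sector C True Y) \<and> onesided z (sector C False Y)"
      if "z \<in> region C Y - sector C True Y - sector C False Y" for z
      using that onesided_line unfolding eq by blast
    obtain p where "p \<in> crossings C" using crossings_nonempty by blast
    hence "p \<in> closure (sector C True Y)" using onesided_crossing(1) by (auto simp: onesided_def)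
    thus "sector C True Y \<union> sector C False Y \<noteq> {}" by auto
    show "sector C True Y \<inter> sector C False Y = {}" using half_disjoint[of True] by (auto simp: sector_def)
    show "{} \<notin> lines C Y" using line_subset(2) by blast
    show "facing (sector C True Y) x = facing (sector C True Y) y \<and>
       facing (sector C False Y) x = facing (sector C False Y) y"
      if "E \<in> lines C Y" "x \<in> E" "y \<in> E" for E x y using facing_line that by blast
  qed (auto simp: jordan open_Int open_half finite_lines sector_def)
  thus ?thesis by auto
qed

lemma finite_faces: "finite (components (sector C X Y))"
  using card_faces_half(1)[of X] by (cases Y) auto

text \<open>Each arc of the half-plane borders exactly one face of the sector, whichever side
  \<open>Y\<close> of the curve is chosen.\<close>

lemma sum_arc_sides: "(\<Sum>F\<in>components (sector C X Y). arc_sides C X F) = card (arcs C X)"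
proof -
  have "arc_sides C X F = card {E \<in> arcs C X. arc_face X Y E = F}"
    if "F \<in> components (sector C X Y)" for F
    unfolding arc_sides_def using arc_subset_frontier[OF _ that] by (metis (mono_tags, lifting))
  hence "(\<Sum>F\<in>components (sector C X Y). arc_sides C X F) =
      (\<Sum>F\<in>components (sector C X Y). \<Sum>E\<in>{E \<in> arcs C X. arc_face X Y E = F}. 1)" by simp
  also have "\<dots> = (\<Sum>E\<in>arcs C X. 1)"
  proof (rule sum.group[OF finite_arcs finite_faces])
    show "arc_face X Y ` arcs C X \<subseteq> components (sector C X Y)"
      unfolding arc_face_def using facing_props(1) arc_onesided pick_in[OF arc_subset(2)] by blast
  qed
  finally show ?thesis by simp
qed

lemma sectors_disjoint:
  assumes "(X, Y) \<noteq> (X', Y')"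
  shows "components (sector C X Y) \<inter> components (sector C X' Y') = {}"
proof -
  have "sector C X Y \<inter> sector C X' Y' = {}"
    using assms half_disjoint[of X] jordan(4)[of Y]
    by (cases "X = X'"; cases "Y = Y'") (auto simp: sector_def)
  moreover have "F \<noteq> {}" if "F \<in> components (sector C X Y)" for F
    using that in_components_nonempty by blast
  ultimately show ?thesis using in_components_subset by (metis Int_greatest disjoint_iff subset_empty)
qed

end

lemma card_vimage_mset_set:
  assumes "finite A"
  shows "count (image_mset f (mset_set A)) x = card {a \<in> A. f a = x}"
proof -
  have "f -` {x} \<inter> A = {a \<in> A. f a = x}" by auto
  thus ?thesis using assms by (simp add: count_image_mset sum.cong)
qed

section \<open>The lower bound for the number of crossings\<close>

context meander
begin

lemma finite_meander_faces: "finite (meander_faces C)"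
  by (auto simp: meander_faces_eq finite_faces)

lemma sum_order_sector:
  "(\<Sum>F\<in>components (sector C X Y). face_order C F) =
     int (card (arcs C X)) - 2 * int (card (components (sector C X Y)))"
proof -
  have "(\<Sum>F\<in>components (sector C X Y). face_order C F) =
      (\<Sum>F\<in>components (sector C X Y). int (arc_sides C X F) - 2)"
    by (intro sum.cong) (auto simp: face_order_eq)
  also have "\<dots> = int (\<Sum>F\<in>components (sector C X Y). arc_sides C X F) -
      2 * int (card (components (sector C X Y)))"
    by (simp add: sum_subtractf)
  finally show ?thesis by (simp add: sum_arc_sides)
qed

text \<open>A pair of sectors that share an edge makes up one side of one of the two curves, and
  there the orders sum up to at least -2, the Euler characteristic bound for a disk.\<close>

lemma card_bigons_le:
  assumes adj: "X = X' \<and> Y = (\<not> Y') \<or> X = (\<not> X') \<and> Y = Y'"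
    and ord: "\<And>F. F \<in> components (sector C X Y) \<union> components (sector C X' Y') \<Longrightarrow> face_order C F \<le> 0"
  shows "card {F \<in> components (sector C X Y). face_order C F = -1} +
         card {F \<in> components (sector C X' Y'). face_order C F = -1} \<le> 2"
proof -
  define N where "N = card (arcs C True)"
  have N: "card (arcs C Z) = N" "card (lines C Z) = N" for Z
    using card_arcs[of Z] card_arcs[of True] card_lines[of Z] by (auto simp: N_def)
  have "card (components (sector C X Y) \<union> components (sector C X' Y')) \<le> N + 1"
    using adj card_faces_half(2)[of X] card_faces_region[of Y] N
    by (cases X; cases Y) (auto simp: Un_commute)
  moreover have "components (sector C X Y) \<inter> components (sector C X' Y') = {}"
    using adj by (intro sectors_disjoint) auto
  ultimately have le: "card (components (sector C X Y)) + card (components (sector C X' Y')) \<le> N + 1"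
    by (simp add: card_Un_disjoint finite_faces)
  \<comment> \<open>Once all orders are at most 0, a bigon adds 1 to the negated sum and every other
    face adds at least 0.\<close>
  have bound: "int (card {F \<in> components (sector C U V). face_order C F = -1}) \<le>
      - (\<Sum>F\<in>components (sector C U V). face_order C F)"
    if "\<And>F. F \<in> components (sector C U V) \<Longrightarrow> face_order C F \<le> 0" for U V
  proof -
    have "int (card {F \<in> components (sector C U V). face_order C F = -1}) =
        (\<Sum>F\<in>components (sector C U V). if face_order C F = -1 then 1 else 0)"
      by (subst sum.inter_filter[OF finite_faces, symmetric]) simp
    also have "\<dots> \<le> (\<Sum>F\<in>components (sector C U V). - face_order C F)"
      by (intro sum_mono) (use that in auto)
    finally show ?thesis by (simp add: sum_negf)
  qed
  have "int (card {F \<in> components (sector C X Y). face_order C F = -1}) +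
      int (card {F \<in> components (sector C X' Y'). face_order C F = -1}) \<le>
      - (int N - 2 * int (card (components (sector C X Y)))) -
      (int N - 2 * int (card (components (sector C X' Y'))))"
    using bound[of X Y] bound[of X' Y'] ord sum_order_sector[of X Y] sum_order_sector[of X' Y'] N by auto
  thus ?thesis using le by linarith
qed

lemma crossings_lower_bound:
  assumes st: "in_stratum C ({#int k#} + replicate_mset (k + 4) (-1))"
  shows "4 * k + 4 \<le> card (crossings C)"
proof -
  obtain j where j: "face_orders C = {#int k#} + replicate_mset (k + 4) (-1) + replicate_mset j 0"
    using st by (auto simp: in_stratum_def)
  hence "int k \<in># face_orders C" by simp
  then obtain F0 where F0: "F0 \<in> meander_faces C" "face_order C F0 = int k"
    using finite_meander_faces by (auto simp: face_orders_def)
  \<comment> \<open>One face is removed rather than one order, since for k = 0 other faces may have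
    the same order as \<open>F0\<close>.\<close>
  have "mset_set (meander_faces C) = {#F0#} + mset_set (meander_faces C - {F0})"
    using mset_set.remove[OF finite_meander_faces F0(1)] by simp
  hence "image_mset (face_order C) (mset_set (meander_faces C - {F0})) =
      replicate_mset (k + 4) (-1) + replicate_mset j 0"
    using j F0(2) by (simp add: face_orders_def)
  hence "set_mset (image_mset (face_order C) (mset_set (meander_faces C - {F0}))) \<subseteq> {-1, 0}"
    by auto
  hence rest: "face_order C F \<le> 0" if "F \<in> meander_faces C" "F \<noteq> F0" for F
    using that finite_meander_faces by auto
  obtain X Y where XY: "F0 \<in> components (sector C X Y)" using F0(1) by (auto simp: meander_faces_eq)
  define B where "B U V = {F \<in> components (sector C U V). face_order C F = -1}" for U V
  define b where "b U V = card (B U V)" for U V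
  have finB: "finite (B U V)" for U V by (simp add: B_def finite_faces)
  have disj: "B U V \<inter> B U' V' = {}" if "(U, V) \<noteq> (U', V')" for U V U' V'
    using sectors_disjoint[OF that] by (auto simp: B_def)
  have in_faces: "F \<in> meander_faces C" if "F \<in> components (sector C U V)" for F U V
    using that by (auto simp: meander_faces_eq)
  have other: "face_order C F \<le> 0" if "F \<in> components (sector C U V)" "(U, V) \<noteq> (X, Y)" for F U V
    using rest[OF in_faces[OF that(1)]] sectors_disjoint[OF that(2)] that(1) XY by blast
  have total: "b X Y + b (\<not> X) Y + b X (\<not> Y) + b (\<not> X) (\<not> Y) = k + 4"
  proof -
    have "k + 4 = count (face_orders C) (-1)" unfolding j by simp
    also have "\<dots> = card {F \<in> meander_faces C. face_order C F = -1}"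
      unfolding face_orders_def by (rule card_vimage_mset_set[OF finite_meander_faces])
    also have "{F \<in> meander_faces C. face_order C F = -1} =
        B X Y \<union> B (\<not> X) Y \<union> (B X (\<not> Y) \<union> B (\<not> X) (\<not> Y))"
    proof -
      have "meander_faces C = components (sector C X Y) \<union> components (sector C (\<not> X) Y) \<union>
          (components (sector C X (\<not> Y)) \<union> components (sector C (\<not> X) (\<not> Y)))"
        unfolding meander_faces_eq UNIV_bool by (cases X; cases Y) auto
      thus ?thesis unfolding B_def by blast
    qed
    also have "card \<dots> = b X Y + b (\<not> X) Y + (b X (\<not> Y) + b (\<not> X) (\<not> Y))"
      unfolding b_def using finB disj by (simp add: card_Un_disjoint Int_Un_distrib Int_Un_distrib2)
    finally show ?thesis by simp
  qed
  have "b (\<not> X) Y + b (\<not> X) (\<not> Y) \<le> 2"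
    unfolding b_def B_def by (rule card_bigons_le) (use other in auto)
  moreover have "b X (\<not> Y) + b (\<not> X) (\<not> Y) \<le> 2"
    unfolding b_def B_def by (rule card_bigons_le) (use other in auto)
  ultimately have "b X Y \<ge> k" using total by linarith
  moreover have "(k + 2) + b X Y \<le> card (arcs C X)"
  proof -
    let ?S = "components (sector C X Y)"
    let ?B = "B X Y"
    have "int (arc_sides C X F0) = int k + 2" using face_order_eq[OF XY] F0(2) by simp
    moreover have "arc_sides C X F = 1" if "F \<in> ?B" for F
      using face_order_eq[of F X Y] that by (simp add: B_def)
    moreover have "F0 \<notin> ?B" using F0(2) by (simp add: B_def)
    ultimately have "(k + 2) + b X Y = (\<Sum>F\<in>insert F0 ?B. arc_sides C X F)"
      using finB by (simp add: b_def)
    also have "\<dots> \<le> (\<Sum>F\<in>?S. arc_sides C X F)"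
      using XY finite_faces by (intro sum_mono2) (auto simp: B_def)
    finally show ?thesis by (simp add: sum_arc_sides)
  qed
  ultimately show ?thesis using card_arcs[of X] by linarith
qed

end

section \<open>Meanders made of semicircles\<close>

definition glue :: "(int \<Rightarrow> real \<Rightarrow> 'a) \<Rightarrow> real \<Rightarrow> 'a" where
  "glue f u = f \<lfloor>u\<rfloor> (u - of_int \<lfloor>u\<rfloor>)"

lemma glue_eq:
  assumes "\<And>j. f j 1 = f (j + 1) 0" "of_int j \<le> u" "u \<le> of_int j + 1"
  shows "glue f u = f j (u - of_int j)"
proof (cases "u = of_int j + 1")
  case True
  hence "\<lfloor>u\<rfloor> = j + 1" by linarith
  thus ?thesis using True assms(1)[of j] by (simp add: glue_def)
next
  case False
  hence "\<lfloor>u\<rfloor> = j" using assms by linarith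
  thus ?thesis by (simp add: glue_def)
qed

text \<open>At an integer \<open>u\<close> the two unit intervals lie on its two sides, and
  otherwise they coincide. So one-sided arguments on both treat junctions and interior points
  alike.\<close>

lemma around_real:
  fixes u :: real
  obtains m M :: int where "of_int m < u" "u \<le> of_int m + 1" "of_int M \<le> u" "u < of_int M + 1"
proof (rule that)
  show "of_int (\<lceil>u\<rceil> - 1) < u" "u \<le> of_int (\<lceil>u\<rceil> - 1) + 1" "of_int \<lfloor>u\<rfloor> \<le> u" "u < of_int \<lfloor>u\<rfloor> + 1"
    by linarith+
qed

text \<open>The derivative is found separately from the left and from the right; both have the same
  value because the derivatives of adjacent pieces match.\<close>

lemma glue_has_vector_derivative:
  fixes f f' :: "int \<Rightarrow> real \<Rightarrow> 'a::real_normed_vector"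
  assumes der: "\<And>j s. (f j has_vector_derivative f' j s) (at s)"
    and match: "\<And>j. f j 1 = f (j + 1) 0" "\<And>j. f' j 1 = f' (j + 1) 0"
  shows "(glue f has_vector_derivative glue f' u) (at u)"
proof -
  obtain m M :: int where m: "of_int m < u" "u \<le> of_int m + 1" and M: "of_int M \<le> u" "u < of_int M + 1"
    by (rule around_real)
  have piece: "(glue f has_vector_derivative glue f' u) (at u within S)"
    if j: "of_int j \<le> u" "u \<le> of_int j + 1" and S: "S \<subseteq> {of_int j..of_int j + 1}" "u \<in> S" for j S
  proof (rule has_vector_derivative_transform[OF S(2)])
    show "glue f x = f j (x - of_int j)" if "x \<in> S" for x
      using glue_eq[of f j x] match(1) that S(1) by auto
    have "((\<lambda>x. x - of_int j) has_vector_derivative 1) (at u)"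
      by (auto intro!: derivative_eq_intros)
    from vector_diff_chain_at[OF this der]
    show "((\<lambda>x. f j (x - of_int j)) has_vector_derivative glue f' u) (at u within S)"
      using glue_eq[of f' j u] match(2) j by (simp add: o_def has_vector_derivative_at_within)
  qed
  have "(glue f has_vector_derivative glue f' u) (at u within {of_int m..u})"
    by (rule piece[of m]) (use m in auto)
  moreover have "(glue f has_vector_derivative glue f' u) (at u within {u..of_int M + 1})"
    by (rule piece[of M]) (use M in auto)
  ultimately have "(glue f has_vector_derivative glue f' u) (at u within {of_int m..u} \<union> {u..of_int M + 1})"
    unfolding has_vector_derivative_def has_derivative_within Lim_within_Un by blast
  moreover have "{of_int m..u} \<union> {u..of_int M + 1} = {of_int m..of_int M + 1}" using m M by auto
  ultimately show ?thesis using at_within_Icc_at[OF m(1) M(2)] by simp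
qed

lemma continuous_glue:
  fixes f :: "int \<Rightarrow> real \<Rightarrow> 'a::real_normed_vector"
  assumes cont: "\<And>j. continuous_on UNIV (f j)" and match: "\<And>j. f j 1 = f (j + 1) 0"
  shows "continuous_on UNIV (glue f)"
proof -
  have "isCont (glue f) u" for u
  proof -
    obtain m M :: int where m: "of_int m < u" "u \<le> of_int m + 1" and M: "of_int M \<le> u" "u < of_int M + 1"
      by (rule around_real)
    have piece: "continuous_on S (glue f)" if S: "S \<subseteq> {of_int j..of_int j + 1}" for j S
    proof (rule continuous_on_eq)
      show "continuous_on S (\<lambda>x. f j (x - of_int j))"
        by (intro continuous_on_compose2[OF cont[of j]] continuous_intros) auto
      show "f j (x - of_int j) = glue f x" if "x \<in> S" for x
        using glue_eq[of f j x] match that S by auto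
    qed
    have "continuous_on ({of_int m..u} \<union> {u..of_int M + 1}) (glue f)"
      using m M by (intro continuous_on_closed_Un piece[of _ m] piece[of _ M]) auto
    moreover have "{of_int m..u} \<union> {u..of_int M + 1} = {of_int m..of_int M + 1}" using m M by auto
    ultimately show ?thesis using m(1) M(2) continuous_on_interior by fastforce
  qed
  thus ?thesis by (simp add: continuous_at_imp_continuous_on)
qed

text \<open>The crossings are listed in the cyclic order of the curve; the arc from \<open>y j\<close> to
  \<open>y (j + 1)\<close> is a semicircle, in the upper half-plane if and only if \<open>j\<close> is odd.\<close>

locale semicircles =
  fixes N :: nat and y :: "int \<Rightarrow> int"
  assumes N_pos: "N > 0"
    and y_per: "y (j + 2 * int N) = y j"
    and y_inj: "inj_on y {0..<2 * int N}"
    and nested: "i \<in> {0..<2 * int N} \<Longrightarrow> j \<in> {0..<2 * int N} \<Longrightarrow> even i = even j \<Longrightarrow> i \<noteq> j \<Longrightarrow>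
      (y i + y (i + 1) = y j + y (j + 1) \<and> \<bar>\<bar>y i - y (i + 1)\<bar> - \<bar>y j - y (j + 1)\<bar>\<bar> \<ge> 2) \<or>
      \<bar>(y i + y (i + 1)) - (y j + y (j + 1))\<bar> \<ge> \<bar>y i - y (i + 1)\<bar> + \<bar>y j - y (j + 1)\<bar>"
begin

abbreviation "n \<equiv> 2 * int N"

lemma y_mod: "y (j mod n) = y j"
proof -
  have nat: "y (i + n * int q) = y i" for i q
  proof (induction q)
    case (Suc q)
    have "y (i + n * int (Suc q)) = y ((i + n * int q) + n)" by (simp add: algebra_simps)
    thus ?case using Suc y_per by simp
  qed simp
  show ?thesis
  proof (cases "j div n \<ge> 0")
    case True
    have "j = j mod n + n * int (nat (j div n))" using True by simp
    thus ?thesis using nat by metis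
  next
    case False
    have "j mod n = j + n * int (nat (- (j div n)))" using False by (simp add: minus_mult_div_eq_mod[symmetric])
    thus ?thesis using nat by metis
  qed
qed

lemma y_eq_iff: "y i = y j \<longleftrightarrow> i mod n = j mod n"
proof
  have range: "i mod n \<in> {0..<n}" for i using N_pos by simp
  show "y i = y j \<Longrightarrow> i mod n = j mod n"
    using inj_onD[OF y_inj _ range range, of i j] y_mod by simp
  show "i mod n = j mod n \<Longrightarrow> y i = y j" using y_mod[of i] y_mod[of j] by simp
qed

lemma y_Suc_neq: "y j \<noteq> y (j + 1)"
proof
  assume "y j = y (j + 1)"
  hence "(j + 1 - j) mod n = 0" unfolding y_eq_iff by (metis mod_eq_dvd_iff mod_0_imp_dvd dvd_imp_mod_0)
  thus False using N_pos by simp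
qed

section \<open>A regular parametrization of the curve\<close>

definition ctr :: "int \<Rightarrow> real" where "ctr j = of_int (y j + y (j + 1)) / 2"
text \<open>Signed, so that \<open>ctr j + hw j * cos\<close> of an angle running from 0 to pi leads
  from \<open>y j\<close> to \<open>y (j + 1)\<close> in either direction.\<close>

definition hw :: "int \<Rightarrow> real" where "hw j = of_int (y j - y (j + 1)) / 2"
definition rad :: "int \<Rightarrow> real" where "rad j = \<bar>hw j\<bar>"
definition sg :: "int \<Rightarrow> real" where "sg j = (if odd j then 1 else -1)"

text \<open>The correction term makes the speed at both ends of the semicircle independent of its radius.\<close>

definition ang :: "int \<Rightarrow> real \<Rightarrow> real" where
  "ang j s = pi * s + (1 / (2 * rad j) - 1) / 2 * sin (2 * pi * s)"

definition dang :: "int \<Rightarrow> real \<Rightarrow> real" where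
  "dang j s = pi * (1 + (1 / (2 * rad j) - 1) * cos (2 * pi * s))"

definition piece :: "int \<Rightarrow> real \<Rightarrow> complex" where
  "piece j s = Complex (ctr j + hw j * cos (ang j s)) (sg j * rad j * sin (ang j s))"

definition dpiece :: "int \<Rightarrow> real \<Rightarrow> complex" where
  "dpiece j s = Complex (- hw j * sin (ang j s) * dang j s) (sg j * rad j * cos (ang j s) * dang j s)"

definition curve :: "real \<Rightarrow> complex" where "curve t = glue piece (of_int n * t)"
definition dcurve :: "real \<Rightarrow> complex" where "dcurve t = of_int n * glue dpiece (of_int n * t)"

lemma rad_ge: "rad j \<ge> 1 / 2"
proof -
  have "\<bar>y j - y (j + 1)\<bar> \<ge> 1" using y_Suc_neq[of j] by linarith
  hence "real_of_int \<bar>y j - y (j + 1)\<bar> \<ge> 1" by linarith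
  thus ?thesis by (simp add: rad_def hw_def)
qed

text \<open>The endpoints are distinct integers, so the radius is at least 1/2. This keeps the
  correction term too small to make the angle stop or turn back.\<close>

lemma coeff: "\<bar>1 / (2 * rad j) - 1\<bar> < 1"
proof -
  have "0 < 1 / (2 * rad j)" "1 / (2 * rad j) \<le> 1" using rad_ge[of j] by (auto simp: field_simps)
  thus ?thesis by linarith
qed

lemma dang_pos: "dang j s > 0"
proof -
  define b where "b = 1 / (2 * rad j) - 1"
  have "\<bar>b * cos (2 * pi * s)\<bar> \<le> \<bar>b\<bar> * 1"
    unfolding abs_mult by (intro mult_left_mono) auto
  moreover have "\<bar>b\<bar> < 1" using coeff[of j] by (simp add: b_def)
  ultimately have "1 + b * cos (2 * pi * s) > 0" by linarith
  hence "1 + (1 / (2 * rad j) - 1) * cos (2 * pi * s) > 0" by (simp add: b_def)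
  thus ?thesis unfolding dang_def by (intro mult_pos_pos) auto
qed

lemma ang_deriv: "(ang j has_real_derivative dang j s) (at s)"
proof -
  have "rad j \<noteq> 0" using rad_ge[of j] by linarith
  thus ?thesis
    unfolding ang_def dang_def by (auto intro!: derivative_eq_intros simp: field_simps)
qed

lemma ang_less: "s < t \<Longrightarrow> ang j s < ang j t"
  by (rule DERIV_pos_imp_increasing) (use ang_deriv dang_pos in blast)+

lemma ang_ends: "ang j 0 = 0" "ang j 1 = pi"
  by (simp_all add: ang_def)

lemma ang_range: "0 < s \<Longrightarrow> s < 1 \<Longrightarrow> 0 < ang j s \<and> ang j s < pi"
  using ang_less[of 0 s j] ang_less[of s 1 j] by (simp add: ang_ends)

lemma dang_ends: "dang j 0 = pi / (2 * rad j)" "dang j 1 = pi / (2 * rad j)"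
proof -
  have "rad j \<noteq> 0" using rad_ge[of j] by linarith
  thus "dang j 0 = pi / (2 * rad j)" "dang j 1 = pi / (2 * rad j)"
    by (simp_all add: dang_def)
qed

lemma piece_ends: "piece j 0 = of_int (y j)" "piece j 1 = of_int (y (j + 1))"
  by (simp_all add: piece_def ang_ends complex_eq_iff ctr_def hw_def field_simps)

text \<open>The radius cancels against the angular speed. The tangents are vertical, and since the
  half-planes alternate, the end of one piece has the same velocity as the start of the
  next.\<close>

lemma dpiece_ends: "dpiece j 0 = Complex 0 (sg j * pi / 2)" "dpiece j 1 = Complex 0 (- sg j * pi / 2)"
  using rad_ge[of j] by (simp_all add: dpiece_def ang_ends dang_ends)

lemma piece_match: "piece j 1 = piece (j + 1) 0"
  by (simp add: piece_ends)

lemma dpiece_match: "dpiece j 1 = dpiece (j + 1) 0"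
  by (simp add: dpiece_ends sg_def)

lemma has_vector_derivative_Complex:
  assumes "(f has_real_derivative f') (at s)" "(g has_real_derivative g') (at s)"
  shows "((\<lambda>s. Complex (f s) (g s)) has_vector_derivative Complex f' g') (at s)"
proof -
  have "((\<lambda>s. of_real (f s) + \<i> * of_real (g s)) has_vector_derivative of_real f' + \<i> * of_real g') (at s)"
    using assms by (intro derivative_intros has_vector_derivative_of_real)
      (auto simp: has_real_derivative_iff_has_vector_derivative)
  thus ?thesis by (simp add: Complex_eq)
qed

lemma piece_deriv: "(piece j has_vector_derivative dpiece j s) (at s)"
  unfolding piece_def dpiece_def
  by (rule has_vector_derivative_Complex)
     (auto intro!: derivative_eq_intros ang_deriv simp: algebra_simps)

lemma cont_dpiece: "continuous_on UNIV (dpiece j)"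
  unfolding dpiece_def Complex_eq dang_def ang_def by (intro continuous_intros)

lemma curve_deriv: "(curve has_vector_derivative dcurve t) (at t)"
proof -
  have "((\<lambda>t. of_int n * t) has_vector_derivative of_int n) (at t)"
    by (auto intro!: derivative_eq_intros simp: has_real_derivative_iff_has_vector_derivative[symmetric])
  from vector_diff_chain_at[OF this glue_has_vector_derivative[of piece dpiece, OF piece_deriv piece_match dpiece_match]]
  show ?thesis by (simp add: o_def curve_def[abs_def] dcurve_def scaleR_conv_of_real)
qed

lemma cont_dcurve: "continuous_on UNIV dcurve"
  unfolding dcurve_def
  by (intro continuous_intros continuous_on_compose2[OF continuous_glue[of dpiece, OF cont_dpiece dpiece_match]]) auto

lemma curve_per: "curve (t + 1) = curve t"
proof -
  have fl: "\<lfloor>of_int n * (t + 1)\<rfloor> = \<lfloor>of_int n * t\<rfloor> + n"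
    using floor_add_int[of "of_int n * t" n] by (simp add: distrib_left)
  have "y (j + n + 1) = y (j + 1)" for j using y_per[of "j + 1"] by (simp add: add_ac)
  hence "piece (j + n) s = piece j s" for j s
    using y_per[of j] by (simp add: piece_def ctr_def hw_def rad_def sg_def ang_def)
  moreover have "of_int n * (t + 1) - of_int (\<lfloor>of_int n * t\<rfloor> + n) = of_int n * t - of_int \<lfloor>of_int n * t\<rfloor>"
    by (simp add: distrib_left)
  ultimately show ?thesis unfolding curve_def glue_def fl by metis
qed

lemma dpiece_nonzero: "dpiece j s \<noteq> 0"
proof
  assume "dpiece j s = 0"
  hence "hw j * sin (ang j s) = 0" "hw j * cos (ang j s) = 0"
    using dang_pos[of j s] by (auto simp: dpiece_def complex_eq_iff rad_def sg_def split: if_splits)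
  moreover have "hw j \<noteq> 0" using rad_ge[of j] by (auto simp: rad_def)
  ultimately have "sin (ang j s) = 0" "cos (ang j s) = 0" by auto
  thus False using sin_cos_squared_add[of "ang j s"] by simp
qed

lemma sg_rad_pos: "sg j * sg j = 1" "rad j > 0"
  using rad_ge[of j] by (auto simp: sg_def)

lemma piece_real: "0 \<le> s \<Longrightarrow> s < 1 \<Longrightarrow> piece j s \<in> \<real> \<longleftrightarrow> s = 0"
  using ang_range[of s j] sin_gt_zero[of "ang j s"] sg_rad_pos[of j]
  by (cases "s = 0") (auto simp: complex_is_Real_iff piece_def ang_ends)

definition circ :: "int \<Rightarrow> complex set" where
  "circ j = {z. cmod (z - of_real (ctr j)) = rad j}"

lemma piece_circ: "piece j s \<in> circ j"
proof -
  have "(hw j * cos (ang j s))\<^sup>2 + (sg j * rad j * sin (ang j s))\<^sup>2 = (rad j)\<^sup>2"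
    by (simp add: power_mult_distrib sg_def rad_def sin_squared_eq algebra_simps)
  thus ?thesis using sg_rad_pos[of j] by (simp add: circ_def piece_def cmod_def)
qed

lemma piece_half: "0 < s \<Longrightarrow> s < 1 \<Longrightarrow> piece j s \<in> half (odd j)"
  using ang_range[of s j] sin_gt_zero[of "ang j s"] sg_rad_pos(2)[of j]
  by (auto simp: half_def piece_def sg_def)

end

section \<open>The curve is simple and its arcs are the given semicircles\<close>

lemma abs_Re_less_cmod: "Im z \<noteq> 0 \<Longrightarrow> \<bar>Re z\<bar> < cmod z"
  by (rule power2_less_imp_less) (simp_all add: cmod_power2)

context semicircles
begin

definition idx :: "bool \<Rightarrow> int set" where "idx X = {j \<in> {0..<n}. odd j = X}"

lemma finite_idx: "finite (idx X)"
  by (rule finite_subset[of _ "{0..<n}"]) (auto simp: idx_def)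

lemma card_idx: "card (idx X) = N"
proof -
  have "idx X = (\<lambda>i. 2 * i + (if X then 1 else 0)) ` {0..<int N}"
  proof (intro equalityI subsetI)
    fix j assume j: "j \<in> idx X"
    hence "j = 2 * (j div 2) + (if X then 1 else 0)" by (auto simp: idx_def elim: oddE)
    moreover have "j div 2 \<in> {0..<int N}" using j by (auto simp: idx_def)
    ultimately show "j \<in> (\<lambda>i. 2 * i + (if X then 1 else 0)) ` {0..<int N}" by (rule image_eqI)
  qed (auto simp: idx_def split: if_splits)
  moreover have "inj_on (\<lambda>i::int. 2 * i + (if X then 1 else 0)) {0..<int N}" by (auto intro: inj_onI)
  ultimately show ?thesis by (simp add: card_image)
qed

text \<open>The locale assumption speaks of doubled centres and diameters to remain within the
  integers. Halved, it says that two semicircles in one half-plane are concentric with radii at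
  least 1 apart, or bound disks that do not overlap; nesting without a common centre does not
  occur.\<close>

lemma idx_nested:
  assumes "i \<in> idx X" "j \<in> idx X" "i \<noteq> j"
  shows "(ctr i = ctr j \<and> \<bar>rad i - rad j\<bar> \<ge> 1) \<or> \<bar>ctr i - ctr j\<bar> \<ge> rad i + rad j"
proof -
  define a b c d where abcd: "a = y i" "b = y (i + 1)" "c = y j" "d = y (j + 1)"
  have "(a + b = c + d \<and> \<bar>\<bar>a - b\<bar> - \<bar>c - d\<bar>\<bar> \<ge> 2) \<or> \<bar>(a + b) - (c + d)\<bar> \<ge> \<bar>a - b\<bar> + \<bar>c - d\<bar>"
    using nested[of i j] assms unfolding abcd by (auto simp: idx_def)
  moreover have "ctr i - ctr j = real_of_int ((a + b) - (c + d)) / 2"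
    "rad i = real_of_int \<bar>a - b\<bar> / 2" "rad j = real_of_int \<bar>c - d\<bar> / 2"
    by (auto simp: ctr_def rad_def hw_def abcd field_simps)
  ultimately show ?thesis
  proof (elim disjE conjE)
    assume "a + b = c + d" "2 \<le> \<bar>\<bar>a - b\<bar> - \<bar>c - d\<bar>\<bar>"
      and *: "ctr i - ctr j = real_of_int ((a + b) - (c + d)) / 2"
      "rad i = real_of_int \<bar>a - b\<bar> / 2" "rad j = real_of_int \<bar>c - d\<bar> / 2"
    hence "ctr i = ctr j" by simp
    have "real_of_int 2 \<le> real_of_int \<bar>\<bar>a - b\<bar> - \<bar>c - d\<bar>\<bar>"
      using \<open>2 \<le> \<bar>\<bar>a - b\<bar> - \<bar>c - d\<bar>\<bar>\<close> by (simp only: of_int_le_iff)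
    also have "\<dots> = 2 * \<bar>rad i - rad j\<bar>"
      unfolding * by (simp add: diff_divide_distrib[symmetric])
    finally show ?thesis using \<open>ctr i = ctr j\<close> by simp
  next
    assume "\<bar>a - b\<bar> + \<bar>c - d\<bar> \<le> \<bar>a + b - (c + d)\<bar>"
      and *: "ctr i - ctr j = real_of_int ((a + b) - (c + d)) / 2"
      "rad i = real_of_int \<bar>a - b\<bar> / 2" "rad j = real_of_int \<bar>c - d\<bar> / 2"
    hence "real_of_int (\<bar>a - b\<bar> + \<bar>c - d\<bar>) \<le> real_of_int \<bar>a + b - (c + d)\<bar>"
      by (simp only: of_int_le_iff)
    also have "\<dots> = 2 * \<bar>ctr i - ctr j\<bar>"
      unfolding * by simp
    also have "real_of_int (\<bar>a - b\<bar> + \<bar>c - d\<bar>) = 2 * (rad i + rad j)"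
      unfolding * by simp
    finally show ?thesis by simp
  qed
qed

text \<open>If the disks touch, they do so on the line. Off the line the real part is strictly
  smaller than the modulus, which makes the inequality strict.\<close>

lemma separated:
  assumes "\<bar>ctr i - ctr j\<bar> \<ge> rad i + rad j" "Im z \<noteq> 0" "cmod (z - of_real (ctr i)) \<le> rad i"
  shows "cmod (z - of_real (ctr j)) > rad j"
  using assms abs_Re_less_cmod[of "z - of_real (ctr i)"] abs_Re_less_cmod[of "z - of_real (ctr j)"] by auto

lemma circ_disjoint:
  assumes "i \<in> idx X" "j \<in> idx X" "z \<in> circ i" "z \<in> circ j" "Im z \<noteq> 0"
  shows "i = j"
proof (rule ccontr)
  assume "i \<noteq> j"
  from idx_nested[OF assms(1,2) this] show False
    using assms(3,4) separated[of i j z] assms(5) by (auto simp: circ_def)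
qed

lemma floor_idx:
  assumes "0 \<le> t" "t < 1"
  obtains j s where "j \<in> {0..<n}" "0 \<le> s" "s < 1" "curve t = piece j s" "dcurve t = of_int n * dpiece j s"
    "of_int n * t = of_int j + s"
proof -
  define u where "u = of_int n * t"
  have n: "real_of_int n > 0" using N_pos by simp
  have "0 \<le> u" "u < of_int n" using assms n by (auto simp: u_def)
  hence "\<lfloor>u\<rfloor> \<in> {0..<n}" by (simp add: floor_less_iff)
  moreover have "0 \<le> u - of_int \<lfloor>u\<rfloor>" "u - of_int \<lfloor>u\<rfloor> < 1" by linarith+
  ultimately show ?thesis
    using that[of "\<lfloor>u\<rfloor>" "u - of_int \<lfloor>u\<rfloor>"]
    by (simp add: curve_def dcurve_def glue_def u_def)
qed

text \<open>Crossings are told apart by injectivity of \<open>y\<close>. For other points the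
  half-plane gives the parity of the index, the circle gives the index, and the cosine gives the
  parameter.\<close>

lemma curve_inj:
  assumes s: "0 \<le> s" "s < 1" and t: "0 \<le> t" "t < 1" and eq: "curve s = curve t"
  shows "s = t"
proof -
  obtain i a where i: "i \<in> {0..<n}" "0 \<le> a" "a < 1" "curve s = piece i a" "of_int n * s = of_int i + a"
    using floor_idx[OF s] by metis
  obtain j b where j: "j \<in> {0..<n}" "0 \<le> b" "b < 1" "curve t = piece j b" "of_int n * t = of_int j + b"
    using floor_idx[OF t] by metis
  have pe: "piece i a = piece j b" using eq i j by simp
  have "i = j \<and> a = b"
  proof (cases "a = 0")
    case True
    hence "b = 0" using piece_real[of a i] piece_real[of b j] i j pe by auto
    hence "y i = y j" using True pe by (simp add: piece_ends)
    thus ?thesis using inj_onD[OF y_inj _ i(1) j(1)] True \<open>b = 0\<close> by simp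
  next
    case False
    hence ab: "0 < a" "0 < b" using piece_real[of a i] piece_real[of b j] i j pe by auto
    have h: "piece i a \<in> half (odd i)" "piece i a \<in> half (odd j)"
      using piece_half[of a i] piece_half[of b j] ab i j pe by auto
    hence "odd i = odd j" by (auto simp: half_def split: if_splits)
    moreover have "Im (piece i a) \<noteq> 0" using h by (auto simp: half_def split: if_splits)
    ultimately have ij: "i = j"
      using circ_disjoint[of i "odd i" j "piece i a"] piece_circ[of i a] piece_circ[of j b] i j pe
      by (simp add: idx_def)
    have "hw i \<noteq> 0" using rad_ge[of i] by (auto simp: rad_def)
    hence "cos (ang i a) = cos (ang i b)" using pe ij by (simp add: piece_def)
    hence "ang i a = ang i b"
      using ang_range[OF ab(1) i(3), of i] ang_range[OF ab(2) j(3), of i] cos_inj_pi by (meson less_imp_le)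
    hence "a = b" using ang_less[of a b i] ang_less[of b a i] by (metis less_irrefl linorder_neqE_linordered_idom)
    thus ?thesis using ij by simp
  qed
  hence "of_int n * s = of_int n * t" using i(5) j(5) by simp
  thus ?thesis using N_pos by simp
qed

lemma curve_vector_derivative: "vector_derivative curve (at t) = dcurve t"
  by (rule vector_derivative_at[OF curve_deriv])

lemma curve_pieces: "curve t = piece \<lfloor>of_int n * t\<rfloor> (of_int n * t - of_int \<lfloor>of_int n * t\<rfloor>)"
  "dcurve t = of_int n * dpiece \<lfloor>of_int n * t\<rfloor> (of_int n * t - of_int \<lfloor>of_int n * t\<rfloor>)"
  by (simp_all add: curve_def dcurve_def glue_def)

lemma curve_0: "curve 0 = of_int (y 0)" "curve 1 = of_int (y 0)"
proof -
  show "curve 0 = of_int (y 0)" by (simp add: curve_pieces piece_ends)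
  thus "curve 1 = of_int (y 0)" using curve_per[of 0] by simp
qed

lemma loop_free_curve: "loop_free curve"
proof -
  have "s = t \<or> s = 0 \<and> t = 1 \<or> s = 1 \<and> t = 0"
    if "s \<in> {0..1}" "t \<in> {0..1}" "curve s = curve t" for s t
  proof -
    have "s = 1 \<or> s < 1" "t = 1 \<or> t < 1" using that by auto
    thus ?thesis using that curve_inj[of s t] curve_inj[of 0 t] curve_inj[of s 0] curve_0 by auto
  qed
  thus ?thesis by (simp add: loop_free_def)
qed

lemma meander_curve: "meander curve (path_image curve)"
proof
  show "curve (t + 1) = curve t" for t by (rule curve_per)
  have "continuous_on UNIV curve"
    using curve_deriv has_vector_derivative_continuous by (intro continuous_at_imp_continuous_on) blast
  hence "path curve" by (auto simp: path_def intro: continuous_on_subset)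
  thus "simple_path curve" using loop_free_curve by (simp add: simple_path_def)
  show "curve C1_differentiable_on UNIV"
    unfolding C1_differentiable_on_def using curve_deriv cont_dcurve by blast
  show "vector_derivative curve (at t) \<noteq> 0" for t
    using dpiece_nonzero N_pos by (simp add: curve_vector_derivative curve_pieces)
  show "vector_derivative curve (at t) \<notin> \<real>" if "curve t \<in> \<real>" for t
  proof -
    define j where "j = \<lfloor>of_int n * t\<rfloor>"
    define s where "s = of_int n * t - of_int j"
    have s: "0 \<le> s" "s < 1" unfolding s_def j_def by linarith+
    have "curve t = piece j s" "dcurve t = of_int n * dpiece j s"
      unfolding curve_pieces j_def s_def by auto
    moreover from this have "s = 0" using piece_real[OF s, of j] that by simp
    ultimately show ?thesis
      using N_pos by (auto simp: curve_vector_derivative dpiece_ends complex_is_Real_iff sg_def)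
  qed
  have "curve 0 \<in> path_image curve" unfolding path_image_def by (rule imageI) simp
  moreover have "curve 0 \<in> \<real>" by (simp add: curve_0(1))
  ultimately have "curve 0 \<in> path_image curve \<inter> \<real>" by blast
  thus "path_image curve \<inter> \<real> \<noteq> {}" by blast
qed (rule refl)

sublocale meander curve "path_image curve"
  by (rule meander_curve)

abbreviation "CC \<equiv> path_image curve"

lemma CC_eq: "CC = (\<Union>j\<in>{0..<n}. piece j ` {0..<1})"
proof (intro equalityI subsetI)
  fix z assume "z \<in> CC"
  then obtain t where t: "0 \<le> t" "t < 0 + 1" "curve t = z" by (rule C_window)
  then obtain j s where "j \<in> {0..<n}" "0 \<le> s" "s < 1" "z = piece j s"
    using floor_idx[of t thesis] by (metis add_0)
  thus "z \<in> (\<Union>j\<in>{0..<n}. piece j ` {0..<1})" by (intro UN_I[of j]) auto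
next
  fix z assume "z \<in> (\<Union>j\<in>{0..<n}. piece j ` {0..<1})"
  then obtain j where j: "j \<in> {0..<n}" "z \<in> piece j ` {0..<1}" by blast
  then obtain s where js: "0 \<le> s" "s < 1" "z = piece j s" by auto
  define t where "t = (of_int j + s) / of_int n"
  have "of_int n * t = of_int j + s" using N_pos by (simp add: t_def)
  moreover have "\<lfloor>of_int j + s\<rfloor> = j" using js(1,2) by linarith
  ultimately have "curve t = z" unfolding curve_pieces js(3) by simp
  thus "z \<in> CC" unfolding C_range by blast
qed

lemma crossings_eq: "crossings CC = (\<lambda>j. of_int (y j)) ` {0..<n}"
proof -
  have "z \<in> crossings CC \<longleftrightarrow> (\<exists>j\<in>{0..<n}. z = of_int (y j))" for z
  proof
    assume "z \<in> crossings CC"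
    then obtain j where "j \<in> {0..<n}" "z \<in> piece j ` {0..<1}" "z \<in> \<real>"
      unfolding crossings_def CC_eq by blast
    then obtain s where js: "j \<in> {0..<n}" "0 \<le> s" "s < 1" "z = piece j s" "z \<in> \<real>" by auto
    hence "s = 0" using piece_real[of s j] by simp
    thus "\<exists>j\<in>{0..<n}. z = of_int (y j)" using js by (auto simp: piece_ends)
  next
    assume "\<exists>j\<in>{0..<n}. z = of_int (y j)"
    then obtain j where "j \<in> {0..<n}" "z = piece j 0" by (auto simp: piece_ends)
    moreover from this have "z \<in> CC" unfolding CC_eq by (intro UN_I[of j]) auto
    moreover have "z \<in> \<real>" using calculation by (simp add: piece_ends)
    ultimately show "z \<in> crossings CC" by (simp add: crossings_def)
  qed
  thus ?thesis by blast
qed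

lemma card_crossings: "card (crossings CC) = 2 * N"
proof -
  have "inj_on (\<lambda>j. complex_of_int (y j)) {0..<n}" using y_inj by (auto simp: inj_on_def)
  thus ?thesis unfolding crossings_eq by (simp add: card_image nat_mult_distrib)
qed

lemma card_arcs_CC: "card (arcs CC X) = N"
  using card_arcs[of X] card_crossings by simp

definition open_arc :: "int \<Rightarrow> complex set" where "open_arc j = piece j ` {0<..<1}"

text \<open>For the converse, the cosine determines an angle between 0 and pi, the intermediate
  value theorem finds its parameter, and the half-plane fixes the sign of the imaginary
  part.\<close>

lemma open_arc_eq: "open_arc j = circ j \<inter> half (odd j)"
proof (intro equalityI subsetI)
  fix z assume "z \<in> open_arc j"
  thus "z \<in> circ j \<inter> half (odd j)" using piece_circ piece_half by (auto simp: open_arc_def)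
next
  fix z assume z: "z \<in> circ j \<inter> half (odd j)"
  define x where "x = (Re z - ctr j) / hw j"
  have hw: "hw j \<noteq> 0" "rad j > 0" using rad_ge[of j] by (auto simp: rad_def)
  have im: "sg j * Im z > 0" using z by (auto simp: half_def sg_def split: if_splits)
  have norm: "(Re z - ctr j)\<^sup>2 + (Im z)\<^sup>2 = (rad j)\<^sup>2"
    using z hw cmod_power2[of "z - of_real (ctr j)"] by (simp add: circ_def)
  have "x\<^sup>2 * (hw j)\<^sup>2 + (Im z)\<^sup>2 = (hw j)\<^sup>2"
    using norm hw by (simp add: x_def power_divide rad_def)
  hence x2: "(1 - x\<^sup>2) * (hw j)\<^sup>2 = (Im z)\<^sup>2" by (simp add: algebra_simps)
  moreover have "0 < (Im z)\<^sup>2" using im by (auto simp: zero_less_power2)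
  ultimately have "0 < (1 - x\<^sup>2) * (hw j)\<^sup>2" by simp
  hence "x\<^sup>2 < 1" using hw(1) by (simp add: zero_less_mult_iff)
  hence "\<bar>x\<bar> < 1" by (simp add: abs_square_less_1)
  hence x1: "-1 < x" "x < 1" by auto
  have a: "0 < arccos x" "arccos x < pi" using arccos_lt_bounded[OF x1] by auto
  have "\<exists>s\<ge>0. s \<le> 1 \<and> ang j s = arccos x"
    by (rule IVT) (use a in \<open>auto simp: ang_ends intro: DERIV_isCont[OF ang_deriv]\<close>)
  then obtain s where s: "0 \<le> s" "s \<le> 1" "ang j s = arccos x" by blast
  have "s \<noteq> 0" "s \<noteq> 1" using s(3) a ang_ends[of j] by auto
  hence s1: "s \<in> {0<..<1}" using s by auto
  have "rad j * sin (ang j s) = sg j * Im z"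
  proof (rule power2_eq_imp_eq)
    have "(rad j * sin (ang j s))\<^sup>2 = (1 - x\<^sup>2) * (hw j)\<^sup>2"
      unfolding s(3) using x1 by (simp add: power_mult_distrib sin_squared_eq rad_def)
    thus "(rad j * sin (ang j s))\<^sup>2 = (sg j * Im z)\<^sup>2" using x2 by (simp add: power_mult_distrib sg_def)
    show "0 \<le> rad j * sin (ang j s)" unfolding s(3) using hw(2) a by (intro mult_nonneg_nonneg sin_ge_zero) auto
  qed (use im in simp)
  hence "sg j * (rad j * sin (ang j s)) = Im z" using sg_rad_pos(1)[of j] by (metis mult.assoc mult_1)
  moreover have "ctr j + hw j * cos (ang j s) = Re z" unfolding s(3) using x1 hw by (simp add: x_def)
  ultimately have "z = piece j s" by (simp add: piece_def complex_eq_iff mult.assoc)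
  thus "z \<in> open_arc j" using s1 by (auto simp: open_arc_def)
qed

lemma CC_half: "CC \<inter> half X = (\<Union>j\<in>idx X. open_arc j)"
proof -
  have "z \<in> CC \<inter> half X \<longleftrightarrow> (\<exists>j\<in>idx X. z \<in> open_arc j)" for z
  proof
    assume z: "z \<in> CC \<inter> half X"
    then obtain j where "j \<in> {0..<n}" "z \<in> piece j ` {0..<1}" unfolding CC_eq by blast
    then obtain s where js: "j \<in> {0..<n}" "0 \<le> s" "s < 1" "z = piece j s" by auto
    have "s \<noteq> 0"
      using z js piece_real[of s j] half_not_Reals[of X] by (metis IntI Int_iff empty_iff)
    hence "z \<in> open_arc j" using js by (auto simp: open_arc_def)
    moreover from this have "odd j = X" using z unfolding open_arc_eq by (auto simp: half_def split: if_splits)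
    ultimately show "\<exists>j\<in>idx X. z \<in> open_arc j" using js(1) by (auto simp: idx_def)
  next
    assume "\<exists>j\<in>idx X. z \<in> open_arc j"
    then obtain j where j: "j \<in> idx X" "z \<in> open_arc j" by blast
    hence "z \<in> half X" unfolding open_arc_eq by (auto simp: idx_def)
    moreover have "z \<in> CC" using j unfolding CC_eq open_arc_def
      by (intro UN_I[of j]) (auto simp: idx_def)
    ultimately show "z \<in> CC \<inter> half X" by blast
  qed
  thus ?thesis by blast
qed

end

lemma sum_card_fibres_le:
  assumes "finite K" "finite J"
  shows "(\<Sum>\<kappa>\<in>K. card {j \<in> J. f j = \<kappa>}) \<le> card J"
proof -
  have "(\<Sum>\<kappa>\<in>K. card {j \<in> J. f j = \<kappa>}) = card (\<Union>\<kappa>\<in>K. {j \<in> J. f j = \<kappa>})"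
    using assms by (intro card_UN_disjoint[symmetric]) auto
  also have "\<dots> \<le> card J" using assms(2) by (intro card_mono) auto
  finally show ?thesis .
qed

lemma image_mset_two_values:
  assumes "finite A" "f ` A \<subseteq> {a, b}" "a \<noteq> b"
  shows "image_mset f (mset_set A) =
    replicate_mset (card {x \<in> A. f x = a}) a + replicate_mset (card {x \<in> A. f x = b}) b"
proof (rule multiset_eqI)
  fix c
  have "card {x \<in> A. f x = c} = 0" if "c \<noteq> a" "c \<noteq> b"
  proof -
    have "{x \<in> A. f x = c} = {}" using assms(2) that by auto
    thus ?thesis by (simp only: card.empty)
  qed
  thus "count (image_mset f (mset_set A)) c =
      count (replicate_mset (card {x \<in> A. f x = a}) a + replicate_mset (card {x \<in> A. f x = b}) b) c"
    unfolding card_vimage_mset_set[OF assms(1)] using assms(3) by (cases "c = a"; cases "c = b") simp_all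
qed

section \<open>Faces of a half-plane and their keys\<close>

context semicircles
begin

definition key :: "bool \<Rightarrow> complex \<Rightarrow> int set" where
  "key X z = {j \<in> idx X. cmod (z - of_real (ctr j)) < rad j}"

text \<open>The semicircles that cover the points just below the arc \<open>a\<close>, including
  \<open>a\<close>: by \<open>idx_nested\<close> these are the concentric ones that are at least as
  large.\<close>

definition up :: "bool \<Rightarrow> int \<Rightarrow> int set" where
  "up X a = {b \<in> idx X. ctr b = ctr a \<and> rad a \<le> rad b}"

definition above :: "bool \<Rightarrow> int \<Rightarrow> real \<Rightarrow> complex" where
  "above X a \<rho> = Complex (ctr a) (if X then \<rho> else - \<rho>)"

definition half_faces :: "bool \<Rightarrow> complex set set" where
  "half_faces X = components (sector CC X True) \<union> components (sector CC X False)"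

lemma Union_half_faces: "\<Union> (half_faces X) = half X - CC"
  using jordan(5) by (auto simp: half_faces_def Union_components[symmetric] sector_def)

lemma half_facesD:
  assumes "F \<in> half_faces X"
  shows "F \<subseteq> half X - CC" "connected F" "F \<noteq> {}" "finite (half_faces X)"
proof -
  show "F \<subseteq> half X - CC" using assms Union_half_faces by blast
  show "connected F" "F \<noteq> {}"
    using assms in_components_connected in_components_nonempty unfolding half_faces_def by blast+
qed (simp add: half_faces_def finite_faces)

lemma off_circ: "z \<in> half X - CC \<Longrightarrow> j \<in> idx X \<Longrightarrow> cmod (z - of_real (ctr j)) \<noteq> rad j"
  using CC_half[of X] open_arc_eq[of j] by (auto simp: circ_def idx_def)

text \<open>A face is connected and misses the circle of each index in \<open>idx X\<close>, so it
  lies wholly inside or wholly outside.\<close>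

lemma key_const:
  assumes F: "F \<in> half_faces X" and "z \<in> F" "w \<in> F"
  shows "key X z = key X w"
proof -
  have "cmod (u - of_real (ctr j)) < rad j"
    if j: "j \<in> idx X" and uv: "u \<in> F" "v \<in> F" "cmod (v - of_real (ctr j)) < rad j" for j u v
  proof (rule ccontr)
    assume "\<not> cmod (u - of_real (ctr j)) < rad j"
    moreover have "F \<subseteq> ball (of_real (ctr j)) (rad j) \<union> - cball (of_real (ctr j)) (rad j)"
      using off_circ[OF _ j] half_facesD(1)[OF F] by (force simp: dist_norm norm_minus_commute)
    moreover from this have "ball (of_real (ctr j)) (rad j) \<inter> F = {} \<or> - cball (of_real (ctr j)) (rad j) \<inter> F = {}"
      by (intro connectedD[OF half_facesD(2)[OF F]]) auto
    ultimately show False using uv by (auto simp: dist_norm norm_minus_commute)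
  qed
  thus ?thesis using assms(2,3) unfolding key_def by blast
qed

lemma cmod_above: "\<rho> \<ge> 0 \<Longrightarrow> cmod (above X a \<rho> - of_real (ctr a)) = \<rho>"
  by (simp add: above_def cmod_def)

lemma above_half: "\<rho> > 0 \<Longrightarrow> above X a \<rho> \<in> half X"
  by (simp add: above_def half_def)

text \<open>Concentric radii differ by at least 1, so no other semicircle passes through the axis
  between heights \<open>rad a - 1\<close> and \<open>rad a\<close>. Both the top of the arc and a
  point slightly below it are in this range.\<close>

lemma above_other:
  assumes ab: "a \<in> idx X" "b \<in> idx X" "a \<noteq> b" and \<rho>: "0 < \<rho>" "\<rho> \<le> rad a" "rad a - 1 < \<rho>"
  shows "cmod (above X a \<rho> - of_real (ctr b)) < rad b \<longleftrightarrow> b \<in> up X a"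
    "cmod (above X a \<rho> - of_real (ctr b)) \<noteq> rad b"
proof -
  have "(ctr a = ctr b \<and> \<bar>rad a - rad b\<bar> \<ge> 1) \<or> \<bar>ctr a - ctr b\<bar> \<ge> rad a + rad b"
    by (rule idx_nested[OF ab])
  thus "cmod (above X a \<rho> - of_real (ctr b)) < rad b \<longleftrightarrow> b \<in> up X a"
    "cmod (above X a \<rho> - of_real (ctr b)) \<noteq> rad b"
  proof (atomize(full), elim disjE conjE)
    assume c: "ctr a = ctr b" "\<bar>rad a - rad b\<bar> \<ge> 1"
    have "cmod (above X a \<rho> - of_real (ctr b)) = \<rho>" using cmod_above[of \<rho> X a] \<rho>(1) c(1) by simp
    thus "(cmod (above X a \<rho> - of_real (ctr b)) < rad b) = (b \<in> up X a) \<and>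
        cmod (above X a \<rho> - of_real (ctr b)) \<noteq> rad b"
      using c ab \<rho> by (auto simp: up_def)
  next
    assume c: "rad a + rad b \<le> \<bar>ctr a - ctr b\<bar>"
    have "Im (above X a \<rho>) \<noteq> 0" using \<rho> by (simp add: above_def)
    hence "cmod (above X a \<rho> - of_real (ctr b)) > rad b"
      using separated[OF c] cmod_above[of \<rho> X a] \<rho> by simp
    moreover have "ctr b \<noteq> ctr a" using c sg_rad_pos(2)[of a] sg_rad_pos(2)[of b] by auto
    ultimately show "(cmod (above X a \<rho> - of_real (ctr b)) < rad b) = (b \<in> up X a) \<and>
        cmod (above X a \<rho> - of_real (ctr b)) \<noteq> rad b"
      by (auto simp: up_def)
  qed
qed

lemma up_self: "a \<in> idx X \<Longrightarrow> a \<in> up X a"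
  by (simp add: up_def)

lemma up_inj:
  assumes "a \<in> idx X" "b \<in> idx X" "up X a = up X b"
  shows "a = b"
proof (rule ccontr)
  assume "a \<noteq> b"
  have "b \<in> up X a" "a \<in> up X b" using assms up_self by auto
  hence "ctr a = ctr b" "rad a = rad b" by (auto simp: up_def)
  thus False using idx_nested[OF assms(1,2) \<open>a \<noteq> b\<close>] sg_rad_pos(2)[of a] by auto
qed

lemma in_half_minus_CC:
  assumes "z \<in> half X" "\<And>j. j \<in> idx X \<Longrightarrow> cmod (z - of_real (ctr j)) \<noteq> rad j"
  shows "z \<in> half X - CC"
proof -
  have "z \<notin> open_arc j" if "j \<in> idx X" for j
    using assms(2)[OF that] by (simp add: open_arc_eq circ_def)
  thus ?thesis using assms(1) CC_half[of X] by blast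
qed

lemma key_up:
  assumes "a \<in> idx X"
  shows "\<exists>z \<in> half X - CC. key X z = up X a"
proof
  \<comment> \<open>The offset 1/4 is below the least possible radius 1/2 and below the gap 1
    between concentric semicircles.\<close>
  let ?z = "above X a (rad a - 1 / 4)"
  have r: "0 < rad a - 1 / 4" using rad_ge[of a] by simp
  have ne: "cmod (?z - of_real (ctr b)) < rad b \<longleftrightarrow> b \<in> up X a"
    "cmod (?z - of_real (ctr b)) \<noteq> rad b" if "b \<in> idx X" for b
    using above_other[OF assms that _ r] cmod_above[of "rad a - 1 / 4" X a] r up_self[OF assms]
    by (cases "a = b"; simp)+
  show "?z \<in> half X - CC" using r ne(2) by (intro in_half_minus_CC above_half)
  show "key X ?z = up X a" using ne(1) by (auto simp: key_def up_def)
qed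

lemma key_empty: "\<exists>z \<in> half X - CC. key X z = {}"
proof
  \<comment> \<open>A height above all semicircles at once.\<close>
  define B where "B = 1 + (\<Sum>j\<in>idx X. rad j)"
  let ?z = "above X 0 B"
  have rad: "rad j < B" if "j \<in> idx X" for j
  proof -
    have "rad j \<le> (\<Sum>j\<in>idx X. rad j)"
      using that sg_rad_pos(2) finite_idx by (intro member_le_sum) (auto intro: less_imp_le)
    thus ?thesis by (simp add: B_def)
  qed
  have "B > 0" using sg_rad_pos(2) by (simp add: B_def add_pos_nonneg sum_nonneg less_imp_le)
  moreover have "cmod (?z - of_real (ctr j)) > rad j" if "j \<in> idx X" for j
    using abs_Im_le_cmod[of "?z - of_real (ctr j)"] rad[OF that] \<open>B > 0\<close> by (simp add: above_def split: if_splits)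
  ultimately show "?z \<in> half X - CC" "key X ?z = {}"
    using above_half[of B X 0] in_half_minus_CC[of ?z X] by (fastforce simp: key_def)+
qed

definition face_key :: "bool \<Rightarrow> complex set \<Rightarrow> int set" where
  "face_key X F = key X (pick F)"

lemma face_key_eq: "F \<in> half_faces X \<Longrightarrow> z \<in> F \<Longrightarrow> face_key X F = key X z"
  unfolding face_key_def using key_const[of F X "pick F" z] pick_in[of F] by blast

definition keys :: "bool \<Rightarrow> int set set" where "keys X = insert {} (up X ` idx X)"

lemma card_keys: "card (keys X) = N + 1"
proof -
  have "card (up X ` idx X) = N"
    using up_inj card_idx by (subst card_image) (auto intro: inj_onI)
  moreover have "{} \<notin> up X ` idx X" using up_self by fastforce
  ultimately show ?thesis using finite_idx by (simp add: keys_def)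
qed

text \<open>All \<open>N + 1\<close> keys occur and there are at most \<open>N + 1\<close> faces, so the key determines the face.\<close>

lemma face_key_bij: "bij_betw (face_key X) (half_faces X) (keys X)"
proof -
  have fin: "finite (half_faces X)" by (simp add: half_faces_def finite_faces)
  have card_le: "card (half_faces X) \<le> N + 1"
    using card_faces_half(2)[of X] card_arcs_CC[of X] by (simp add: half_faces_def)
  have sub: "keys X \<subseteq> face_key X ` half_faces X"
  proof
    fix \<kappa> assume "\<kappa> \<in> keys X"
    then obtain z where z: "z \<in> half X - CC" "key X z = \<kappa>"
      unfolding keys_def using key_up[of _ X] key_empty[of X] by blast
    then obtain F where "F \<in> half_faces X" "z \<in> F" using Union_half_faces by blast
    thus "\<kappa> \<in> face_key X ` half_faces X" using face_key_eq z(2) by blast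
  qed
  have "card (face_key X ` half_faces X) \<le> card (half_faces X)" by (rule card_image_le[OF fin])
  moreover have "N + 1 \<le> card (face_key X ` half_faces X)"
    using card_mono[OF finite_imageI[OF fin] sub] card_keys by simp
  ultimately have "card (face_key X ` half_faces X) = card (half_faces X)"
    "card (keys X) = card (face_key X ` half_faces X)" using card_le card_keys[of X] by auto
  thus ?thesis
    unfolding bij_betw_def using eq_card_imp_inj_on[OF fin] card_subset_eq[OF finite_imageI[OF fin] sub] by simp
qed

text \<open>No other semicircle passes through the top of the arc \<open>j\<close>, so in a
  neighbourhood only membership of \<open>j\<close> in the key can vary.\<close>

lemma key_near_arc:
  assumes j: "j \<in> idx X" and F: "F \<in> half_faces X" and cl: "above X j (rad j) \<in> closure F"
  shows "face_key X F = up X j \<or> face_key X F = up X j - {j}"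
proof -
  define U where "U = (\<Inter>b\<in>idx X - {j}. if b \<in> up X j then ball (complex_of_real (ctr b)) (rad b)
     else - cball (of_real (ctr b)) (rad b))"
  have "open U" unfolding U_def using finite_idx by (intro open_INT) auto
  moreover have "above X j (rad j) \<in> U"
  proof -
    have "above X j (rad j) \<in> (if b \<in> up X j then ball (complex_of_real (ctr b)) (rad b)
     else - cball (of_real (ctr b)) (rad b))" if b: "b \<in> idx X - {j}" for b
      using above_other[OF j, of b "rad j"] b sg_rad_pos(2)[of j] by (auto simp: dist_norm norm_minus_commute)
    thus ?thesis unfolding U_def by blast
  qed
  ultimately have "U \<inter> F \<noteq> {}" using cl open_Int_closure_eq_empty by blast
  then obtain w where w: "w \<in> U" "w \<in> F" by blast
  have "b \<in> key X w \<longleftrightarrow> b \<in> up X j" if "b \<noteq> j" for b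
  proof (cases "b \<in> idx X")
    case True
    hence "w \<in> (if b \<in> up X j then ball (complex_of_real (ctr b)) (rad b) else - cball (of_real (ctr b)) (rad b))"
      using w(1) that unfolding U_def by blast
    thus ?thesis using True by (auto simp: key_def dist_norm norm_minus_commute split: if_splits)
  qed (simp add: key_def up_def)
  hence "key X w - {j} = up X j - {j}" by blast
  hence "key X w = up X j \<or> key X w = up X j - {j}" using up_self[OF j] by blast
  thus ?thesis using face_key_eq[OF F w(2)] by simp
qed

text \<open>The expected number of arcs around the face with key \<open>\<kappa>\<close>: an arc
  \<open>j\<close> has the key \<open>up X j\<close> on its inner side and loses \<open>j\<close> on
  its outer side.\<close>

definition mult :: "bool \<Rightarrow> int set \<Rightarrow> nat" where
  "mult X \<kappa> = card {j \<in> idx X. \<kappa> = up X j \<or> \<kappa> = up X j - {j}}"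

text \<open>Each arc component contains a whole semicircle, hence the top of one. Choosing such an
  index is injective, since distinct components are disjoint, and the key at that top is restricted
  by \<open>key_near_arc\<close>.\<close>

lemma arc_sides_le:
  assumes F: "F \<in> half_faces X"
  shows "arc_sides CC X F \<le> mult X (face_key X F)"
proof -
  define J where "J = {j \<in> idx X. face_key X F = up X j \<or> face_key X F = up X j - {j}}"
  define f where "f E = (SOME j. j \<in> idx X \<and> above X j (rad j) \<in> E)" for E :: "complex set"
  have top: "above X j (rad j) \<in> open_arc j" if "j \<in> idx X" for j
    using that above_half[of "rad j" X j] sg_rad_pos(2)[of j] cmod_above[of "rad j" X j]
    by (auto simp: open_arc_eq circ_def idx_def)
  have f: "f E \<in> idx X \<and> above X (f E) (rad (f E)) \<in> E" if E: "E \<in> arcs CC X" for E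
    unfolding f_def
  proof (rule someI_ex)
    obtain z where z: "z \<in> E" using arc_subset(2)[OF E] by blast
    then obtain j where j: "j \<in> idx X" "z \<in> open_arc j" using arc_subset(1)[OF E] CC_half by blast
    have "connected (open_arc j)"
      unfolding open_arc_def
      by (intro connected_continuous_image continuous_at_imp_continuous_on ballI
          has_vector_derivative_continuous[OF piece_deriv] connected_Ioo)
    moreover have "open_arc j \<subseteq> CC \<inter> half X" using j(1) CC_half by blast
    ultimately have "open_arc j \<subseteq> E"
      using components_maximal[of E "CC \<inter> half X" "open_arc j"] E z j(2) unfolding arcs_def by blast
    thus "\<exists>j. j \<in> idx X \<and> above X j (rad j) \<in> E" using j(1) top by blast
  qed
  have "f ` {E \<in> arcs CC X. E \<subseteq> frontier F} \<subseteq> J"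
  proof
    fix j assume "j \<in> f ` {E \<in> arcs CC X. E \<subseteq> frontier F}"
    then obtain E where E: "E \<in> arcs CC X" "E \<subseteq> frontier F" "j = f E" by blast
    hence "j \<in> idx X" "above X j (rad j) \<in> closure F" using f[OF E(1)] by (auto simp: frontier_def)
    thus "j \<in> J" using key_near_arc[OF _ F] by (simp add: J_def)
  qed
  moreover have "inj_on f {E \<in> arcs CC X. E \<subseteq> frontier F}"
  proof (rule inj_onI)
    fix E E' assume *: "E \<in> {E \<in> arcs CC X. E \<subseteq> frontier F}" "E' \<in> {E \<in> arcs CC X. E \<subseteq> frontier F}" "f E = f E'"
    hence "E \<inter> E' \<noteq> {}" using f[of E] f[of E'] by auto
    thus "E = E'" using * components_eq[of E "CC \<inter> half X" E'] by (auto simp: arcs_def)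
  qed
  moreover have "finite J" using finite_idx by (simp add: J_def)
  ultimately show ?thesis unfolding arc_sides_def mult_def J_def[symmetric] using card_inj_on_le by blast
qed

lemma sum_arc_sides_half: "(\<Sum>F\<in>half_faces X. arc_sides CC X F) = 2 * N"
proof -
  have "components (sector CC X True) \<inter> components (sector CC X False) = {}"
    by (rule sectors_disjoint) simp
  thus ?thesis
    unfolding half_faces_def by (simp add: sum.union_disjoint finite_faces sum_arc_sides card_arcs_CC)
qed

lemma card_half_faces: "card (half_faces X) = N + 1"
  using bij_betw_same_card[OF face_key_bij] card_keys by simp

lemma sum_mult_le: "(\<Sum>\<kappa>\<in>keys X. mult X \<kappa>) \<le> 2 * N"
proof -
  have fin: "finite (keys X)" using finite_idx by (simp add: keys_def)
  have "mult X \<kappa> \<le> card {j \<in> idx X. up X j = \<kappa>} + card {j \<in> idx X. up X j - {j} = \<kappa>}" for \<kappa>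
  proof -
    have "{j \<in> idx X. \<kappa> = up X j \<or> \<kappa> = up X j - {j}} =
        {j \<in> idx X. up X j = \<kappa>} \<union> {j \<in> idx X. up X j - {j} = \<kappa>}" by auto
    thus ?thesis unfolding mult_def by (simp add: card_Un_le)
  qed
  hence "(\<Sum>\<kappa>\<in>keys X. mult X \<kappa>) \<le>
      (\<Sum>\<kappa>\<in>keys X. card {j \<in> idx X. up X j = \<kappa>}) + (\<Sum>\<kappa>\<in>keys X. card {j \<in> idx X. up X j - {j} = \<kappa>})"
    unfolding sum.distrib[symmetric] by (rule sum_mono)
  also have "\<dots> \<le> N + N"
    using sum_card_fibres_le[OF fin finite_idx[of X]] card_idx by (intro add_mono) auto
  finally show ?thesis by simp
qed

text \<open>The face-by-face inequality has left-hand total exactly \<open>2 * N\<close>, and the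
  right-hand total is at most \<open>2 * N\<close> because each index counts for at most two keys.
  So equality holds for every face.\<close>

lemma arc_sides_eq:
  assumes "F \<in> half_faces X"
  shows "arc_sides CC X F = mult X (face_key X F)"
proof -
  have fin: "finite (half_faces X)" by (simp add: half_faces_def finite_faces)
  have "(\<Sum>F\<in>half_faces X. mult X (face_key X F)) = (\<Sum>\<kappa>\<in>keys X. mult X \<kappa>)"
    by (rule sum.reindex_bij_betw[OF face_key_bij])
  moreover have "(\<Sum>F\<in>half_faces X. arc_sides CC X F) \<le> (\<Sum>F\<in>half_faces X. mult X (face_key X F))"
    by (intro sum_mono arc_sides_le)
  ultimately have "(\<Sum>F\<in>half_faces X. arc_sides CC X F) = (\<Sum>F\<in>half_faces X. mult X (face_key X F))"
    using sum_arc_sides_half[of X] sum_mult_le[of X] by simp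
  from sum_mono_inv[OF this arc_sides_le assms fin] show ?thesis .
qed

definition outermost :: "bool \<Rightarrow> int set" where
  "outermost X = {j \<in> idx X. up X j = {j}}"

lemma mult_empty: "mult X {} = card (outermost X)"
proof -
  have "{j \<in> idx X. {} = up X j \<or> {} = up X j - {j}} = outermost X"
    using up_self by (auto simp: outermost_def)
  thus ?thesis by (simp add: mult_def)
qed

text \<open>Below the arc \<open>a\<close> there is at most one next smaller concentric arc. So
  every face other than the common exterior is a bigon or a 4-gon.\<close>

lemma mult_up:
  assumes a: "a \<in> idx X"
  shows "mult X (up X a) = 1 \<or> mult X (up X a) = 2"
proof -
  have "{j \<in> idx X. up X a = up X j \<or> up X a = up X j - {j}} =
      insert a {j \<in> idx X. up X a = up X j - {j}}"
    using a up_inj[OF a] by auto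
  moreover have "card {j \<in> idx X. up X a = up X j - {j}} \<le> 1"
  proof -
    \<comment> \<open>Two such arcs would be concentric, so one would lie in \<open>up\<close> of
      the other; after removal of the arc itself the two sets could not agree.\<close>
    have "j = j'" if j: "j \<in> idx X" "up X a = up X j - {j}" and j': "j' \<in> idx X" "up X a = up X j' - {j'}" for j j'
    proof (rule ccontr)
      assume ne: "j \<noteq> j'"
      have "a \<in> up X j" "a \<in> up X j'" using up_self[OF a] j(2) j'(2) by auto
      hence "ctr j = ctr j'" by (simp add: up_def)
      hence "j' \<in> up X j \<or> j \<in> up X j'" using j(1) j'(1) by (auto simp: up_def)
      thus False using j(2) j'(2) ne by blast
    qed
    thus ?thesis using finite_idx by (subst card_le_Suc0_iff_eq[unfolded One_nat_def[symmetric]]) auto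
  qed
  moreover have "a \<notin> {j \<in> idx X. up X a = up X j - {j}}" using up_self[OF a] by blast
  ultimately show ?thesis unfolding mult_def using finite_idx by (auto simp: card_insert_if le_Suc_eq)
qed

text \<open>The exterior has one arc for each outermost semicircle. The number of bigons among the
  remaining faces follows from the sum of all orders, 2N - 2(N + 1) = -2, instead of a search for
  innermost semicircles.\<close>

lemma half_orders:
  obtains r where "image_mset (face_order CC) (mset_set (half_faces X)) =
    {#int (card (outermost X)) - 2#} + replicate_mset (card (outermost X)) (-1) + replicate_mset r 0"
proof -
  have fin: "finite (half_faces X)" by (simp add: half_faces_def finite_faces)
  have order: "face_order CC F = int (mult X (face_key X F)) - 2" if "F \<in> half_faces X" for F
    using that face_order_eq[of F X] arc_sides_eq[OF that] unfolding half_faces_def by auto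
  obtain F0 where F0: "F0 \<in> half_faces X" "face_key X F0 = {}"
    using bij_betw_imp_surj_on[OF face_key_bij[of X]] unfolding keys_def by (metis imageE insertI1)
  define A where "A = half_faces X - {F0}"
  have A: "face_order CC F = -1 \<or> face_order CC F = 0" if "F \<in> A" for F
  proof -
    have F: "F \<in> half_faces X" "F \<noteq> F0" using that by (auto simp: A_def)
    hence "face_key X F \<noteq> {}"
      using F0 bij_betw_imp_inj_on[OF face_key_bij[of X]] by (metis inj_onD)
    moreover have "face_key X F \<in> keys X" using F(1) bij_betw_imp_surj_on[OF face_key_bij[of X]] by blast
    ultimately obtain a where "a \<in> idx X" "face_key X F = up X a" by (auto simp: keys_def)
    thus ?thesis using mult_up[of a X] order[OF F(1)] by auto
  qed
  have o0: "face_order CC F0 = int (card (outermost X)) - 2"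
    using order[OF F0(1)] F0(2) mult_empty by simp
  define r where "r = card {F \<in> A. face_order CC F = 0}"
  define b where "b = card {F \<in> A. face_order CC F = -1}"
  have finA: "finite A" using fin by (simp add: A_def)
  have img: "image_mset (face_order CC) (mset_set A) = replicate_mset b (-1) + replicate_mset r 0"
    unfolding b_def r_def using A by (intro image_mset_two_values finA) auto
  have "mset_set (half_faces X) = add_mset F0 (mset_set A)"
    unfolding A_def by (rule mset_set.remove[OF fin F0(1)])
  hence all: "image_mset (face_order CC) (mset_set (half_faces X)) =
      {#int (card (outermost X)) - 2#} + replicate_mset b (-1) + replicate_mset r 0"
    by (simp add: img o0)
  have "(\<Sum>F\<in>half_faces X. face_order CC F) = (\<Sum>F\<in>half_faces X. int (arc_sides CC X F) - 2)"
    by (intro sum.cong) (auto simp: order arc_sides_eq)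
  also have "\<dots> = -2"
    using sum_arc_sides_half[of X] card_half_faces[of X]
    by (simp add: sum_subtractf of_nat_sum[symmetric] del: of_nat_sum)
  finally have "(\<Sum>F\<in>half_faces X. face_order CC F) = -2" .
  moreover have "(\<Sum>F\<in>half_faces X. face_order CC F) = int (card (outermost X)) - 2 - int b"
    unfolding sum_unfold_sum_mset all by simp
  ultimately have "b = card (outermost X)" by simp
  thus ?thesis using that[of r] all by simp
qed

text \<open>The upper half-plane supplies the order k and k + 2 bigons. The lower one supplies two
  more: its exterior has a single arc, so it is a bigon too.\<close>

lemma in_stratum_CC:
  assumes "card (outermost True) = k + 2" "card (outermost False) = 1"
  shows "in_stratum CC ({#int k#} + replicate_mset (k + 4) (-1))"
proof -
  obtain r where r: "image_mset (face_order CC) (mset_set (half_faces True)) =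
    {#int (card (outermost True)) - 2#} + replicate_mset (card (outermost True)) (-1) + replicate_mset r 0"
    by (rule half_orders)
  obtain s where s: "image_mset (face_order CC) (mset_set (half_faces False)) =
    {#int (card (outermost False)) - 2#} + replicate_mset (card (outermost False)) (-1) + replicate_mset s 0"
    by (rule half_orders)
  have eq: "meander_faces CC = half_faces True \<union> half_faces False"
    by (auto simp: meander_faces_eq half_faces_def UNIV_bool)
  have "F \<notin> half_faces False" if "F \<in> half_faces True" for F
    using half_facesD(1,3)[OF that] half_facesD(1)[of F False] half_disjoint[of True] by auto
  hence disj: "half_faces True \<inter> half_faces False = {}" by blast
  have "mset_set (meander_faces CC) = mset_set (half_faces True) + mset_set (half_faces False)"
    unfolding eq using disj by (intro mset_set_Union) (simp_all add: half_faces_def finite_faces)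
  hence "face_orders CC = {#int k#} + replicate_mset (k + 4) (-1) + replicate_mset (r + s) 0"
    unfolding face_orders_def by (intro multiset_eqI) (simp add: r s assms)
  thus ?thesis unfolding in_stratum_def by blast
qed

end

section \<open>A meander with the minimal number of crossings\<close>

text \<open>The crossings are the integers \<open>\<plusminus> w m \<plusminus> 1\<close> for \<open>m \<le> k\<close>. All lower semicircles are
  centred at 0. The upper ones are \<open>k\<close> nested pairs and two single ones, so that their common
  exterior has \<open>k + 2\<close> arcs on its boundary.\<close>

definition w :: "int \<Rightarrow> int" where
  "w m = (if even m then 4 * m + 2 else - (4 * m + 2))"

text \<open>Start of the lower semicircle number \<open>p\<close> along the closed curve. For
  \<open>p\<close> up to \<open>k\<close> the curve runs outward on one side of the strip around the
  arc, then back on the other side, so the turn at \<open>k\<close> and the closing step are caps of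
  radius 1.\<close>

definition low :: "int \<Rightarrow> int \<Rightarrow> int" where
  "low k p = (let q = p mod (2 * k + 2) in if q \<le> k then 1 - w q else 1 + w (2 * k + 1 - q))"

text \<open>Lower semicircles are centred at 0, hence end at the negative of their start.\<close>

definition cross :: "int \<Rightarrow> int \<Rightarrow> int" where
  "cross k j = (if even j then low k (j div 2) else - low k (j div 2))"

section \<open>Arithmetic of the crossing sequence\<close>

lemma low_first: "0 \<le> p \<Longrightarrow> p \<le> k \<Longrightarrow> low k p = 1 - w p"
  by (simp add: low_def)

lemma low_second: "k < p \<Longrightarrow> p \<le> 2 * k + 1 \<Longrightarrow> 0 \<le> k \<Longrightarrow> low k p = 1 + w (2 * k + 1 - p)"
  by (simp add: low_def)

lemma low_per: "low k (p + (2 * k + 2)) = low k p"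
  by (simp add: low_def)

text \<open>Separating the direction of travel and the parity of the level removes \<open>w\<close>
  and \<open>mod\<close>, leaving four linear families for arithmetic procedures.\<close>

lemma low_values:
  assumes "0 \<le> a"
  shows "2 * a \<le> k \<Longrightarrow> low k (2 * a) = - (8 * a + 1)"
    "2 * a + 1 \<le> k \<Longrightarrow> low k (2 * a + 1) = 8 * a + 7"
    "2 * a \<le> k \<Longrightarrow> low k (2 * k + 1 - 2 * a) = 8 * a + 3"
    "2 * a + 1 \<le> k \<Longrightarrow> low k (2 * k - 2 * a) = - (8 * a + 5)"
proof -
  show "2 * a \<le> k \<Longrightarrow> low k (2 * a) = - (8 * a + 1)"
    using assms by (simp add: low_first w_def)
  show "2 * a + 1 \<le> k \<Longrightarrow> low k (2 * a + 1) = 8 * a + 7"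
    using assms by (simp add: low_first w_def)
  show "2 * a \<le> k \<Longrightarrow> low k (2 * k + 1 - 2 * a) = 8 * a + 3"
    using assms low_second[of k "2 * k + 1 - 2 * a"] by (simp add: w_def)
  have "2 * k + 1 - (2 * k - 2 * a) = 2 * a + 1" by simp
  thus "2 * a + 1 \<le> k \<Longrightarrow> low k (2 * k - 2 * a) = - (8 * a + 5)"
    using assms low_second[of k "2 * k - 2 * a"] by (simp add: w_def)
qed

lemma low_index_cases:
  fixes p k :: int
  assumes "0 \<le> p" "p \<le> 2 * k + 1"
  obtains a where "0 \<le> a" "p = 2 * a" "2 * a \<le> k" | a where "0 \<le> a" "p = 2 * a + 1" "2 * a + 1 \<le> k"
    | a where "0 \<le> a" "p = 2 * k + 1 - 2 * a" "2 * a \<le> k"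
    | a where "0 \<le> a" "p = 2 * k - 2 * a" "2 * a + 1 \<le> k"
proof -
  have "(\<exists>a. 0 \<le> a \<and> p = 2 * a \<and> 2 * a \<le> k) \<or> (\<exists>a. 0 \<le> a \<and> p = 2 * a + 1 \<and> 2 * a + 1 \<le> k) \<or>
    (\<exists>a. 0 \<le> a \<and> p = 2 * k + 1 - 2 * a \<and> 2 * a \<le> k) \<or>
    (\<exists>a. 0 \<le> a \<and> p = 2 * k - 2 * a \<and> 2 * a + 1 \<le> k)"
    using assms by presburger
  thus ?thesis using that by blast
qed

lemma abs_low_values:
  assumes "0 \<le> p" "p \<le> 2 * k + 1"
  obtains a where "0 \<le> a" "p = 2 * a" "\<bar>low k p\<bar> = 8 * a + 1" "2 * a \<le> k"
    | a where "0 \<le> a" "p = 2 * a + 1" "\<bar>low k p\<bar> = 8 * a + 7" "2 * a + 1 \<le> k"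
    | a where "0 \<le> a" "p = 2 * k + 1 - 2 * a" "\<bar>low k p\<bar> = 8 * a + 3" "2 * a \<le> k"
    | a where "0 \<le> a" "p = 2 * k - 2 * a" "\<bar>low k p\<bar> = 8 * a + 5" "2 * a + 1 \<le> k"
proof (rule low_index_cases[OF assms])
  show thesis if "0 \<le> a" "p = 2 * a" "2 * a \<le> k" for a
    using that \<open>\<And>a. 0 \<le> a \<Longrightarrow> p = 2 * a \<Longrightarrow> \<bar>low k p\<bar> = 8 * a + 1 \<Longrightarrow> 2 * a \<le> k \<Longrightarrow> thesis\<close>
      low_values(1)[of a k] by simp
  show thesis if "0 \<le> a" "p = 2 * a + 1" "2 * a + 1 \<le> k" for a
    using that \<open>\<And>a. 0 \<le> a \<Longrightarrow> p = 2 * a + 1 \<Longrightarrow> \<bar>low k p\<bar> = 8 * a + 7 \<Longrightarrow> 2 * a + 1 \<le> k \<Longrightarrow> thesis\<close>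
      low_values(2)[of a k] by simp
  show thesis if "0 \<le> a" "p = 2 * k + 1 - 2 * a" "2 * a \<le> k" for a
    using that \<open>\<And>a. 0 \<le> a \<Longrightarrow> p = 2 * k + 1 - 2 * a \<Longrightarrow> \<bar>low k p\<bar> = 8 * a + 3 \<Longrightarrow> 2 * a \<le> k \<Longrightarrow> thesis\<close>
      low_values(3)[of a k] by simp
  show thesis if "0 \<le> a" "p = 2 * k - 2 * a" "2 * a + 1 \<le> k" for a
    using that \<open>\<And>a. 0 \<le> a \<Longrightarrow> p = 2 * k - 2 * a \<Longrightarrow> \<bar>low k p\<bar> = 8 * a + 5 \<Longrightarrow> 2 * a + 1 \<le> k \<Longrightarrow> thesis\<close>
      low_values(4)[of a k] by simp
qed

text \<open>The four families have absolute values 1, 7, 3 and 5 modulo 8, and within a family the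
  value determines the parameter.\<close>

lemma abs_low_inj:
  assumes "0 \<le> p" "p \<le> 2 * k + 1" "0 \<le> q" "q \<le> 2 * k + 1" "\<bar>low k p\<bar> = \<bar>low k q\<bar>"
  shows "p = q"
proof -
  define S S' where S: "S = \<bar>low k p\<bar>" "S' = \<bar>low k q\<bar>"
  have "S = S'" using assms(5) S by simp
  show ?thesis
    by (rule abs_low_values[OF assms(1,2), folded S]; rule abs_low_values[OF assms(3,4), folded S];
        insert \<open>S = S'\<close>; (linarith | (clarsimp; presburger)))
qed

lemma low_nonzero: "0 \<le> p \<Longrightarrow> p \<le> 2 * k + 1 \<Longrightarrow> low k p \<noteq> 0"
  by (erule abs_low_values, assumption) auto

text \<open>The endpoints of the upper semicircle with number \<open>p\<close> are \<open>- low k p\<close> and \<open>low k (p + 1)\<close>.\<close>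

definition usum :: "int \<Rightarrow> int \<Rightarrow> int" where "usum k p = low k (p + 1) - low k p"
definition udiff :: "int \<Rightarrow> int \<Rightarrow> int" where "udiff k p = \<bar>low k p + low k (p + 1)\<bar>"

lemma upper_of:
  "low k p = x \<Longrightarrow> low k (p + 1) = y \<Longrightarrow> usum k p = y - x \<and> udiff k p = \<bar>x + y\<bar>"
  by (simp add: usum_def udiff_def)

text \<open>Cases 1 and 5 are the outer and inner semicircles of pairs on the right, cases 6 and 2
  those on the left. Cases 3 and 4 are the cap at the turn for even and odd \<open>k\<close>, and
  case 7 is the cap that closes the curve.\<close>

lemma upper_values:
  assumes "0 \<le> p" "p \<le> 2 * k + 1"
  obtains a where "0 \<le> a" "p = 2 * a" "2 * a < k" "usum k p = 16 * a + 8" "udiff k p = 6"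
    | a where "0 \<le> a" "p = 2 * a + 1" "2 * a + 1 < k" "usum k p = - (16 * a + 16)" "udiff k p = 2"
    | a where "0 \<le> a" "p = 2 * a" "2 * a = k" "usum k p = 16 * a + 4" "udiff k p = 2"
    | a where "0 \<le> a" "p = 2 * a + 1" "2 * a + 1 = k" "usum k p = - (16 * a + 12)" "udiff k p = 2"
    | a where "0 \<le> a" "p = 2 * k - 2 * a" "2 * a < k" "usum k p = 16 * a + 8" "udiff k p = 2"
    | a where "0 \<le> a" "p = 2 * k - 1 - 2 * a" "2 * a + 1 < k" "usum k p = - (16 * a + 16)" "udiff k p = 6"
    | "p = 2 * k + 1" "usum k p = - 4" "udiff k p = 2"
proof (rule low_index_cases[OF assms])
  fix a assume a: "0 \<le> a" "p = 2 * a" "2 * a \<le> k"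
  have v: "low k p = - (8 * a + 1)" unfolding a(2) by (rule low_values) (use a in auto)
  show thesis
  proof (cases "2 * a = k")
    case True
    have q: "p + 1 = 2 * k + 1 - 2 * a" using a True by simp
    have "low k (p + 1) = 8 * a + 3" unfolding q by (rule low_values) (use a in auto)
    thus thesis using upper_of[OF v] a True by (intro that(3)[of a]) auto
  next
    case False
    have q: "p + 1 = 2 * a + 1" using a by simp
    have "low k (p + 1) = 8 * a + 7" unfolding q by (rule low_values) (use a False in auto)
    thus thesis using upper_of[OF v] a False by (intro that(1)[of a]) auto
  qed
next
  fix a assume a: "0 \<le> a" "p = 2 * a + 1" "2 * a + 1 \<le> k"
  have v: "low k p = 8 * a + 7" unfolding a(2) by (rule low_values) (use a in auto)
  show thesis
  proof (cases "2 * a + 1 = k")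
    case True
    have q: "p + 1 = 2 * k - 2 * a" using a True by simp
    have "low k (p + 1) = - (8 * a + 5)" unfolding q by (rule low_values) (use a in auto)
    thus thesis using upper_of[OF v] a True by (intro that(4)[of a]) auto
  next
    case False
    have q: "p + 1 = 2 * (a + 1)" using a by simp
    have "low k (p + 1) = - (8 * (a + 1) + 1)" unfolding q by (rule low_values) (use a False in auto)
    thus thesis using upper_of[OF v] a False by (intro that(2)[of a]) auto
  qed
next
  fix a assume a: "0 \<le> a" "p = 2 * k + 1 - 2 * a" "2 * a \<le> k"
  have v: "low k p = 8 * a + 3" unfolding a(2) by (rule low_values) (use a in auto)
  show thesis
  proof (cases "a = 0")
    case True
    have q: "p + 1 = 2 * 0 + (2 * k + 2)" using a True by simp
    have "low k (p + 1) = - (8 * 0 + 1)" unfolding q low_per by (rule low_values) (use a True in auto)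
    thus thesis using upper_of[OF v] a True by (intro that(7)) auto
  next
    case False
    have q: "p + 1 = 2 * k - 2 * (a - 1)" using a by simp
    have "low k (p + 1) = - (8 * (a - 1) + 5)" unfolding q by (rule low_values) (use a False in auto)
    thus thesis using upper_of[OF v] a False by (intro that(6)[of "a - 1"]) auto
  qed
next
  fix a assume a: "0 \<le> a" "p = 2 * k - 2 * a" "2 * a + 1 \<le> k"
  have v: "low k p = - (8 * a + 5)" unfolding a(2) by (rule low_values) (use a in auto)
  have q: "p + 1 = 2 * k + 1 - 2 * a" using a by simp
  have "low k (p + 1) = 8 * a + 3" unfolding q by (rule low_values) (use a in auto)
  thus thesis using upper_of[OF v] a by (intro that(5)[of a]) auto
qed

lemma upper_nested:
  assumes "0 \<le> p" "p \<le> 2 * k + 1" "0 \<le> q" "q \<le> 2 * k + 1" "p \<noteq> q"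
  shows "(usum k p = usum k q \<and> \<bar>udiff k p - udiff k q\<bar> \<ge> 2) \<or>
    \<bar>usum k p - usum k q\<bar> \<ge> udiff k p + udiff k q"
proof -
  define S D S' D' where SD: "S = usum k p" "D = udiff k p" "S' = usum k q" "D' = udiff k q"
  \<comment> \<open>Distinct doubled centres are at least as far apart as the sum of the diameters
    involved. With sums and diameters replaced by variables, the 49 pairs of cases are problems in
    linear integer arithmetic.\<close>
  have "S = S' \<and> \<bar>D - D'\<bar> \<ge> 2" if "S - S' < D + D'" "S' - S < D + D'"
    by (rule upper_values[OF assms(1,2), folded SD]; rule upper_values[OF assms(3,4), folded SD];
        insert assms(5) that; rule conjI; (linarith | (clarsimp; presburger)))
  thus ?thesis unfolding SD by linarith
qed

context semicircles
begin

text \<open>Concentric semicircles are totally ordered by radius, so each centre carries exactly one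
  outermost semicircle.\<close>

lemma card_outermost: "card (outermost X) = card (ctr ` idx X)"
proof (rule bij_betw_same_card[of ctr], unfold bij_betw_def, intro conjI)
  show "inj_on ctr (outermost X)"
  proof (rule inj_onI)
    fix i j assume ij: "i \<in> outermost X" "j \<in> outermost X" "ctr i = ctr j"
    hence idx: "i \<in> idx X" "j \<in> idx X" and up: "up X i = {i}" "up X j = {j}"
      by (simp_all add: outermost_def)
    have "i \<in> up X j \<or> j \<in> up X i"
      using idx ij(3) linear[of "rad i" "rad j"] by (auto simp: up_def)
    thus "i = j" unfolding up by blast
  qed
  have "\<exists>j\<in>outermost X. ctr j = ctr a" if a: "a \<in> idx X" for a
  proof -
    define S where "S = {b \<in> idx X. ctr b = ctr a}"
    have S: "finite S" "S \<noteq> {}" using a finite_idx by (auto simp: S_def)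
    have "Max (rad ` S) \<in> rad ` S" using S by (intro Max_in) auto
    then obtain j where "j \<in> S" "rad j = Max (rad ` S)" by (metis imageE)
    hence j: "j \<in> S" "\<And>b. b \<in> S \<Longrightarrow> rad b \<le> rad j" using S(1) by auto
    have "b = j" if "b \<in> up X j" for b
    proof (rule ccontr)
      assume ne: "b \<noteq> j"
      have b: "b \<in> idx X" "ctr b = ctr j" "rad j \<le> rad b" "b \<in> S"
        using that j(1) by (auto simp: up_def S_def)
      hence "rad b = rad j" using j(2) by force
      thus False using idx_nested[OF b(1) _ ne] b(2) j(1) sg_rad_pos(2)[of j] by (auto simp: S_def)
    qed
    hence "j \<in> outermost X" using j(1) up_self by (auto simp: outermost_def S_def)
    thus ?thesis using j(1) by (auto simp: S_def)
  qed
  moreover have "outermost X \<subseteq> idx X" by (auto simp: outermost_def)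
  ultimately show "ctr ` outermost X = ctr ` idx X" by (blast intro: sym)
qed

end

section \<open>The example satisfies the nesting conditions and has the required exteriors\<close>

lemma even_endpoints:
  assumes "even i"
  shows "cross k i + cross k (i + 1) = 0" "\<bar>cross k i - cross k (i + 1)\<bar> = 2 * \<bar>low k (i div 2)\<bar>"
  using assms by (auto simp: cross_def)

lemma odd_endpoints:
  assumes "odd i"
  shows "cross k i + cross k (i + 1) = usum k (i div 2)"
    "\<bar>cross k i - cross k (i + 1)\<bar> = udiff k (i div 2)"
proof -
  have "(i + 1) div 2 = i div 2 + 1" "even (i + 1)" using assms by auto
  thus "cross k i + cross k (i + 1) = usum k (i div 2)"
    "\<bar>cross k i - cross k (i + 1)\<bar> = udiff k (i div 2)"
    using assms by (auto simp: cross_def usum_def udiff_def)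
qed

definition half_count :: "nat \<Rightarrow> nat" where "half_count k = 2 * k + 2"

lemma div_range: "i \<in> {0..<2 * int (half_count k)} \<Longrightarrow> 0 \<le> i div 2 \<and> i div 2 \<le> 2 * int k + 1"
  by (auto simp: half_count_def)

lemma div_neq: "even i = even j \<Longrightarrow> i \<noteq> j \<Longrightarrow> i div 2 \<noteq> (j::int) div 2"
  by presburger

interpretation cross: semicircles "half_count k" "cross (int k)" for k
proof
  show "0 < half_count k" by (simp add: half_count_def)
  show "cross (int k) (j + 2 * int (half_count k)) = cross (int k) j" for j
  proof -
    have "(j + 2 * int (half_count k)) div 2 = j div 2 + (2 * int k + 2)" by (simp add: half_count_def)
    moreover have "even (j + 2 * int (half_count k)) = even j" by simp
    ultimately show ?thesis unfolding cross_def by (simp only: low_per)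
  qed
  show "inj_on (cross (int k)) {0..<2 * int (half_count k)}"
  proof (rule inj_onI)
    fix i j assume ij: "i \<in> {0..<2 * int (half_count k)}" "j \<in> {0..<2 * int (half_count k)}"
      and eq: "cross (int k) i = cross (int k) j"
    have "\<bar>low (int k) (i div 2)\<bar> = \<bar>low (int k) (j div 2)\<bar>"
      using eq by (auto simp: cross_def split: if_splits)
    hence d: "i div 2 = j div 2"
      using abs_low_inj[of "i div 2" "int k" "j div 2"] div_range[OF ij(1)] div_range[OF ij(2)] by blast
    moreover have "even i = even j"
      using eq low_nonzero[of "j div 2" "int k"] div_range[OF ij(2)] d
      by (auto simp: cross_def split: if_splits)
    ultimately show "i = j" using div_neq by blast
  qed
  fix i j assume ij: "i \<in> {0..<2 * int (half_count k)}" "j \<in> {0..<2 * int (half_count k)}"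
    and par: "even i = even j" "i \<noteq> j"
  note r = div_range[OF ij(1)] div_range[OF ij(2)] div_neq[OF par]
  show "cross (int k) i + cross (int k) (i + 1) = cross (int k) j + cross (int k) (j + 1) \<and>
       2 \<le> \<bar>\<bar>cross (int k) i - cross (int k) (i + 1)\<bar> - \<bar>cross (int k) j - cross (int k) (j + 1)\<bar>\<bar> \<or>
       \<bar>cross (int k) i - cross (int k) (i + 1)\<bar> + \<bar>cross (int k) j - cross (int k) (j + 1)\<bar>
       \<le> \<bar>cross (int k) i + cross (int k) (i + 1) - (cross (int k) j + cross (int k) (j + 1))\<bar>"
  proof (cases "even i")
    case True
    hence ev: "even i" "even j" using par by auto
    have "\<bar>low (int k) (i div 2)\<bar> \<noteq> \<bar>low (int k) (j div 2)\<bar>"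
      using abs_low_inj[of "i div 2" "int k" "j div 2"] r by blast
    \<comment> \<open>The diameters are twice distinct integers, which gives the required gap
      between concentric lower semicircles.\<close>
    hence "2 \<le> \<bar>2 * \<bar>low (int k) (i div 2)\<bar> - 2 * \<bar>low (int k) (j div 2)\<bar>\<bar>" by linarith
    thus ?thesis unfolding even_endpoints[OF ev(1)] even_endpoints[OF ev(2)] by simp
  next
    case False
    hence od: "odd i" "odd j" using par by auto
    show ?thesis unfolding odd_endpoints[OF od(1)] odd_endpoints[OF od(2)]
      by (rule upper_nested) (use r in auto)
  qed
qed

lemma card_outermost_lower: "card (cross.outermost k False) = 1"
proof -
  have "cross.ctr k j = 0" if "j \<in> cross.idx k False" for j
  proof -
    have "even j" using that by (simp add: cross.idx_def)
    thus ?thesis by (simp only: cross.ctr_def even_endpoints)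
  qed
  moreover have "cross.idx k False \<noteq> {}"
    using cross.card_idx[of k False] by (auto simp: half_count_def)
  ultimately have "cross.ctr k ` cross.idx k False = {0}" by force
  thus ?thesis by (simp add: cross.card_outermost)
qed

text \<open>The doubled centres of the upper semicircles: -4 and \<open>2 * w (int k)\<close> come
  from the two caps, and each of the \<open>k\<close> nested pairs contributes one value.\<close>

lemma usum_image:
  "usum (int k) ` {0..2 * int k + 1} =
   insert (-4) (insert (2 * w (int k)) ((\<lambda>m. if even m then 8 * m + 8 else - (8 * m + 8)) ` {0..<int k}))"
  (is "?L = insert _ (insert _ (?f ` _))")
proof (intro equalityI subsetI)
  fix x assume "x \<in> ?L"
  then obtain p where p: "0 \<le> p" "p \<le> 2 * int k + 1" "x = usum (int k) p" by auto
  let ?R = "insert (-4) (insert (2 * w (int k)) (?f ` {0..<int k}))"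
  have odd_case: "x \<in> ?R" if "0 \<le> a" "2 * a + 1 < int k" "usum (int k) p = - (16 * a + 16)" for a
  proof -
    have "x = ?f (2 * a + 1)" "2 * a + 1 \<in> {0..<int k}" using p(3) that by simp_all
    thus ?thesis by blast
  qed
  show "x \<in> ?R"
  proof (rule upper_values[OF p(1,2)])
    fix a assume "0 \<le> a" "2 * a < int k" "usum (int k) p = 16 * a + 8"
    hence "x = ?f (2 * a)" "2 * a \<in> {0..<int k}" using p(3) by simp_all
    thus ?thesis by blast
  next
    fix a assume "2 * a = int k" "usum (int k) p = 16 * a + 4"
    hence "x = 2 * w (int k)" using p(3) by (simp add: w_def \<open>2 * a = int k\<close>[symmetric])
    thus ?thesis by blast
  next
    fix a assume "2 * a + 1 = int k" "usum (int k) p = - (16 * a + 12)"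
    hence "x = 2 * w (int k)" using p(3) by (simp add: w_def \<open>2 * a + 1 = int k\<close>[symmetric])
    thus ?thesis by blast
  next
    show "x \<in> ?R" if "0 \<le> a" "2 * a + 1 < int k" "usum (int k) p = - (16 * a + 16)" for a
      by (rule odd_case[OF that])
    show "x \<in> ?R" if "0 \<le> a" "2 * a + 1 < int k" "usum (int k) p = - (16 * a + 16)" for a
      by (rule odd_case[OF that])
  qed (use p(3) in auto)
next
  fix x assume "x \<in> insert (-4) (insert (2 * w (int k)) (?f ` {0..<int k}))"
  then consider "x = -4" | "x = 2 * w (int k)" | m where "0 \<le> m" "m < int k" "x = ?f m" by auto
  thus "x \<in> ?L"
  proof cases
    case 1
    have "low (int k) (2 * int k + 1) = 3" using low_values(3)[of 0 "int k"] by simp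
    moreover have "low (int k) (2 * int k + 1 + 1) = -1"
      using low_per[of "int k" 0] low_values(1)[of 0 "int k"] by (simp add: add_ac)
    ultimately have "usum (int k) (2 * int k + 1) = -4" by (simp add: usum_def)
    thus ?thesis using 1 by (intro image_eqI[of _ _ "2 * int k + 1"]) auto
  next
    case 2
    have "low (int k) (int k + 1) = 1 + w (int k)" using low_second[of "int k" "int k + 1"] by simp
    hence "usum (int k) (int k) = 2 * w (int k)" by (simp add: usum_def low_first)
    thus ?thesis using 2 by (intro image_eqI[of _ _ "int k"]) auto
  next
    case 3
    hence "usum (int k) m = x" by (simp add: usum_def low_first w_def)
    thus ?thesis using 3 by (intro image_eqI[of _ _ m]) auto
  qed
qed

text \<open>The values from the pairs are multiples of 8, whereas those of the caps are 4 modulo 8.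
  The caps differ because \<open>w\<close> never takes the value -2.\<close>

lemma card_usum: "card (usum (int k) ` {0..2 * int k + 1}) = k + 2"
proof -
  let ?f = "\<lambda>m::int. if even m then 8 * m + 8 else - (8 * m + 8)"
  have "inj_on ?f {0..<int k}" by (rule inj_onI) (auto split: if_splits)
  hence "card (?f ` {0..<int k}) = card {0..<int k}" by (rule card_image)
  hence "card (?f ` {0..<int k}) = k" by (simp only: card_atLeastLessThan_int)
  moreover have "2 * w (int k) \<notin> ?f ` {0..<int k}"
  proof
    assume "2 * w (int k) \<in> ?f ` {0..<int k}"
    then obtain m where "2 * w (int k) = ?f m" by blast
    hence "2 * w (int k) = 8 * m + 8 \<or> 2 * w (int k) = - (8 * m + 8)" by (cases "even m") auto
    moreover have "2 * w (int k) = 8 * int k + 4 \<or> 2 * w (int k) = - (8 * int k + 4)"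
      by (simp add: w_def)
    ultimately show False by presburger
  qed
  moreover have "-4 \<notin> ?f ` {0..<int k}"
  proof
    assume "-4 \<in> ?f ` {0..<int k}"
    then obtain m where "-4 = ?f m" by blast
    hence "-4 = 8 * m + 8 \<or> -4 = - (8 * m + 8)" by (cases "even m") auto
    thus False by presburger
  qed
  moreover have "-4 \<noteq> 2 * w (int k)" by (auto simp: w_def elim!: oddE)
  ultimately show ?thesis unfolding usum_image by (simp only: card_insert_if finite_insert finite_imageI
      finite_atLeastLessThan_int insert_iff) simp
qed

lemma card_outermost_upper: "card (cross.outermost k True) = k + 2"
proof -
  have "cross.ctr k ` cross.idx k True = (\<lambda>x. real_of_int x / 2) ` usum (int k) ` {0..2 * int k + 1}"
  proof (intro equalityI subsetI)
    fix c assume "c \<in> cross.ctr k ` cross.idx k True"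
    then obtain j where j: "j \<in> cross.idx k True" "c = cross.ctr k j" by blast
    hence od: "odd j" "j \<in> {0..<2 * int (half_count k)}" by (auto simp: cross.idx_def)
    have "c = real_of_int (usum (int k) (j div 2)) / 2"
      using j(2) odd_endpoints(1)[OF od(1), of "int k"] by (simp add: cross.ctr_def)
    moreover have "j div 2 \<in> {0..2 * int k + 1}" using div_range[OF od(2)] by simp
    ultimately show "c \<in> (\<lambda>x. real_of_int x / 2) ` usum (int k) ` {0..2 * int k + 1}" by blast
  next
    fix c assume "c \<in> (\<lambda>x. real_of_int x / 2) ` usum (int k) ` {0..2 * int k + 1}"
    then obtain p where p: "p \<in> {0..2 * int k + 1}" "c = real_of_int (usum (int k) p) / 2" by blast
    have "2 * p + 1 \<in> cross.idx k True" using p(1) unfolding cross.idx_def by (auto simp: half_count_def)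
    moreover have "c = cross.ctr k (2 * p + 1)"
      using p(2) odd_endpoints(1)[of "2 * p + 1" "int k"] by (simp add: cross.ctr_def)
    ultimately show "c \<in> cross.ctr k ` cross.idx k True" by blast
  qed
  moreover have "inj_on (\<lambda>x. real_of_int x / 2) A" for A by (auto intro: inj_onI)
  ultimately show ?thesis by (simp add: cross.card_outermost card_image card_usum)
qed

theorem proposition4p1:
  fixes k :: nat
  shows "is_minimum (4 * k + 4)
    {card (crossings C) | C. closed_meander C \<and>
       in_stratum C ({#int k#} + replicate_mset (k + 4) (-1))}"
  unfolding is_minimum_def
proof (intro conjI ballI)
  have "closed_meander (path_image (cross.curve k))"
    using closed_meander_iff cross.meander_curve by blast
  moreover have "in_stratum (path_image (cross.curve k)) ({#int k#} + replicate_mset (k + 4) (-1))"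
    using cross.in_stratum_CC card_outermost_upper card_outermost_lower by blast
  moreover have "card (crossings (path_image (cross.curve k))) = 4 * k + 4"
    using cross.card_crossings[of k] by (simp add: half_count_def)
  ultimately show "4 * k + 4 \<in> {card (crossings C) | C. closed_meander C \<and>
       in_stratum C ({#int k#} + replicate_mset (k + 4) (-1))}"
    by (metis (mono_tags, lifting) mem_Collect_eq)
next
  fix n assume "n \<in> {card (crossings C) | C. closed_meander C \<and>
       in_stratum C ({#int k#} + replicate_mset (k + 4) (-1))}"
  thus "4 * k + 4 \<le> n"
    using closed_meander_iff meander.crossings_lower_bound by blast
qed

end
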